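(* Let $r>1$. For every $\beta$ with $0<\beta<1$ there is a constant $c(\beta)$ such that the following holds for all $\epsilon>0$ and $\rho>0$. Let $f\in C_0^\infty(D_r)$, let $g=\mathcal{D}f$, and let $g^\epsilon\in L^2([-1,1]\times S^1)$ satisfy $\|g^\epsilon-g\|_{L^2([-1,1]\times S^1)}<\epsilon$. Then for any $f_1,f_2\in C_0^\infty(D_r)$ with $\|\mathcal{D}f_i-g^\epsilon\|_{L^2([-1,1]\times S^1)}<\epsilon$ and $\|f_i\|_{H^\beta(\mathbb{R}^2)}\le\rho$ for $i=1,2$, $$\|f_1-f_2\|_{L^2(\mathbb{R}^2)}\le c(\beta)\,\rho^{\frac{3/2}{\beta+3/2}}\,\epsilon^{\frac{\beta}{\beta+3/2}}.$$
   Context: Functions are real valued. $D_r=\{(x,y)\in\mathbb{R}^2: x^2+(y-(r+1)/2)^2<(r-1)^2/4\}$. $C_0^\infty(\Omega)$ denotes the smooth functions with compact support contained in the open set $\Omega\subseteq\mathbb{R}^2$, extended by zero to $\mathbb{R}^2$. $Z=\mathbb{R}\times S^1$, with $\phi\in S^1$ regarded as an angle modulo $2\pi$. With $\hat f(\xi)=(2\pi)^{-1}\int_{\mathbb{R}^2}f(x)e^{-ix\cdot\xi}\,\mathrm{d}x$, the Sobolev norm is $\|f\|^2_{H^\alpha(\mathbb{R}^2)}=\int_{\mathbb{R}^2}(1+|\xi|^2)^\alpha|\hat f(\xi)|^2\,\mathrm{d}\xi$. Also $\|g\|^2_{L^2([-1,1]\times S^1)}=\int_{S^1}\int_{-1}^1|g(p,\phi)|^2\,\mathrm{d}p\,\mathrm{d}\phi$.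 Disc transform. For $q>0$, $D_{q,\phi}$ is the disc of diameter $q$ whose centre has polar coordinates $(q/2,\phi)$ (so its boundary passes through the origin). For $f\in C_0^\infty(\mathbb{R}^2)$ and $p>0$ put $\mathcal{D}_1f(p,\phi)=\iint_{D_{1/p,\phi}}f\,\mathrm{d}A$, and let $\mathcal{D}_1f(0^+,\phi)=\lim_{p\to0^+}\mathcal{D}_1f(p,\phi)$. Define $\mathcal{D}_2f$ on $Z$ by $\mathcal{D}_2f(p,\phi)=\mathcal{D}_1f(p,\phi)$ for $p>0$, $\mathcal{D}_2f(p,\phi)=\mathcal{D}_1f(-p,\phi+\pi)$ for $p<0$, and $\mathcal{D}_2f(0,\phi)=\frac{1}{2}\left(\mathcal{D}_1f(0^+,\phi)+\mathcal{D}_1f(0^+,\phi+\pi)\right)$. Let $c(\phi)=\frac{1}{2}\left(\mathcal{D}_1f(0^+,\phi+\pi)-\mathcal{D}_1f(0^+,\phi)\right)$ and $\mathcal{D}f(p,\phi)=\mathcal{D}_2f(p,\phi)+c(\phi)\,\mathrm{sgn}(p)$, with $\mathrm{sgn}(0)=0$. (The function $c(\phi)$ here is unrelated to the constant $c(\beta)$.) The number $r$ is fixed, and the constant $c(\beta)$ may depend on $r$ as well as on $\beta$, but not on $f,f_1,f_2,g^\epsilon,\epsilon,\rho$. *)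

theory Defs
  imports "HOL-Analysis.Analysis"
begin

text \<open>The plane is \<^typ>\<open>real \<times> real\<close>, whose library norm is Euclidean.\<close>

text \<open>\<open>k\<close> times continuously differentiable on the whole space, by recursion over directional
  derivatives. At the last level only continuity is asked, so level \<open>k\<close> is exactly the class
  of \<open>C\<close>-\<open>k\<close> functions.\<close>

primrec Ck :: "nat \<Rightarrow> ('a::euclidean_space \<Rightarrow> real) \<Rightarrow> bool" where
  "Ck 0 f \<longleftrightarrow> continuous_on UNIV f"
| "Ck (Suc k) f \<longleftrightarrow>
     (\<forall>x. f differentiable (at x)) \<and> (\<forall>v. Ck k (\<lambda>x. frechet_derivative f (at x) v))"

definition smooth :: "('a::euclidean_space \<Rightarrow> real) \<Rightarrow> bool" where
  "smooth f \<longleftrightarrow> (\<forall>k. Ck k f)"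

definition C0_infinity :: "('a::euclidean_space) set \<Rightarrow> ('a \<Rightarrow> real) set" where
  "C0_infinity \<Omega> =
     {f. smooth f \<and> compact (closure {x. f x \<noteq> 0}) \<and> closure {x. f x \<noteq> 0} \<subseteq> \<Omega>}"

definition D_region :: "real \<Rightarrow> (real \<times> real) set" where
  "D_region r = {(x, y). x\<^sup>2 + (y - (r + 1) / 2)\<^sup>2 < (r - 1)\<^sup>2 / 4}"

definition origin_disc :: "real \<Rightarrow> real \<Rightarrow> (real \<times> real) set" where
  "origin_disc q \<phi> = ball (q / 2 * cos \<phi>, q / 2 * sin \<phi>) (q / 2)"

text \<open>Functions on \<open>Z = \<real> \<times> S\<^sup>1\<close> are functions of \<open>(p, \<phi>)\<close> with a real angle \<open>\<phi>\<close>; lemma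
  \<open>disc_transform_periodic\<close> below shows that the disc transform is well defined modulo \<open>2\<pi>\<close>.
  \<open>disc_D1\<close> is only meaningful for \<open>p > 0\<close>.\<close>

definition disc_D1 :: "(real \<times> real \<Rightarrow> real) \<Rightarrow> real \<Rightarrow> real \<Rightarrow> real" where
  "disc_D1 f p \<phi> = set_lebesgue_integral lborel (origin_disc (1 / p) \<phi>) f"

definition disc_D1_zero :: "(real \<times> real \<Rightarrow> real) \<Rightarrow> real \<Rightarrow> real" where
  "disc_D1_zero f \<phi> = Lim (at_right 0) (\<lambda>p. disc_D1 f p \<phi>)"

definition disc_D2 :: "(real \<times> real \<Rightarrow> real) \<Rightarrow> real \<Rightarrow> real \<Rightarrow> real" where
  "disc_D2 f p \<phi> =
     (if p > 0 then disc_D1 f p \<phi>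
      else if p < 0 then disc_D1 f (- p) (\<phi> + pi)
      else (disc_D1_zero f \<phi> + disc_D1_zero f (\<phi> + pi)) / 2)"

definition jump_correction :: "(real \<times> real \<Rightarrow> real) \<Rightarrow> real \<Rightarrow> real" where
  "jump_correction f \<phi> = (disc_D1_zero f (\<phi> + pi) - disc_D1_zero f \<phi>) / 2"

definition disc_transform :: "(real \<times> real \<Rightarrow> real) \<Rightarrow> real \<times> real \<Rightarrow> real" where
  "disc_transform f = (\<lambda>(p, \<phi>). disc_D2 f p \<phi> + jump_correction f \<phi> * sgn p)"

lemma disc_transform_periodic:
  "disc_transform f (p, \<phi> + 2 * pi) = disc_transform f (p, \<phi>)"
proof -
  have D1: "disc_D1 f q (\<psi> + 2 * pi) = disc_D1 f q \<psi>" for q \<psi>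
    by (simp add: disc_D1_def origin_disc_def)
  then have D1_zero: "disc_D1_zero f (\<psi> + 2 * pi) = disc_D1_zero f \<psi>" for \<psi>
    by (simp add: disc_D1_zero_def)
  have "\<phi> + 2 * pi + pi = (\<phi> + pi) + 2 * pi" by simp
  then show ?thesis
    by (simp only: disc_transform_def disc_D2_def jump_correction_def D1 D1_zero prod.case)
qed

text \<open>The cylinder \<open>[-1,1] \<times> S\<^sup>1\<close>, with \<open>S\<^sup>1\<close> cut open to one period; Lebesgue measure on it is
  \<open>dp d\<phi>\<close>.\<close>

definition cylinder :: "(real \<times> real) set" where
  "cylinder = {-1..1} \<times> {0..<2 * pi}"

definition L2_on :: "('a::euclidean_space) set \<Rightarrow> ('a \<Rightarrow> real) set" where
  "L2_on S = {g. g \<in> borel_measurable (lebesgue_on S) \<and> integrable (lebesgue_on S) (\<lambda>x. (g x)\<^sup>2)}"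

text \<open>The Bochner integral of a non-integrable function is \<open>0\<close>, so the following two norms are
  meaningful only where the integrand is integrable.\<close>

definition L2_norm_on :: "('a::euclidean_space) set \<Rightarrow> ('a \<Rightarrow> real) \<Rightarrow> real" where
  "L2_norm_on S g = sqrt (\<integral>x. (g x)\<^sup>2 \<partial>lebesgue_on S)"

definition fourier :: "(real \<times> real \<Rightarrow> real) \<Rightarrow> real \<times> real \<Rightarrow> complex" where
  "fourier f \<xi> =
     complex_of_real (1 / (2 * pi)) *
       (\<integral>x. complex_of_real (f x) * exp (- \<i> * complex_of_real (x \<bullet> \<xi>)) \<partial>lborel)"

definition sobolev_norm :: "real \<Rightarrow> (real \<times> real \<Rightarrow> real) \<Rightarrow> real" where
  "sobolev_norm \<alpha> f =
     sqrt (\<integral>\<xi>. (1 + (norm \<xi>)\<^sup>2) powr \<alpha> * (cmod (fourier f \<xi>))\<^sup>2 \<partial>lborel)"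

end

theory Submission
  imports Defs "HOL-Probability.Probability"
begin

text \<open>The statement is linear. For \<open>h = f1 - f2\<close> the triangle inequality gives data
  \<open>\<D>h\<close> of norm below \<open>2\<epsilon>\<close> and a Sobolev norm of at most \<open>2\<rho>\<close>, and it remains to bound \<open>h\<close> by
  these two quantities.

  The inversion \<open>\<Psi> x = x / |x|\<^sup>2\<close> maps the disc of diameter \<open>1/p\<close> in direction \<open>\<phi>\<close> to the half plane
  \<open>y \<bullet> \<theta> > p\<close> with \<open>\<theta> = (cos \<phi>, sin \<phi>)\<close>. Thus \<open>\<D>h\<close> consists of half-plane masses of the image of \<open>h\<close>
  under \<open>\<Psi>\<close>, and the \<open>p\<close>-derivative of such a mass is, up to sign, a Radon transform. Undoing the
  Radon transform costs half a derivative and the differentiation in \<open>p\<close> costs one more, which is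
  where the exponent \<open>3/2\<close> comes from. The image of the support lies inside the unit disc, so the
  range \<open>-1 \<le> p \<le> 1\<close> sees all of it.

  Rather than transporting Sobolev norms through \<open>\<Psi>\<close>, the proof tests \<open>h\<close> against Gaussian kernels
  \<open>\<gamma>\<^sub>t\<close> of width \<open>t \<le> 1\<close> and evaluates the form
  \<open>A\<^sub>t = \<integral>\<integral> h(x) h(y) \<gamma>\<^sub>t(\<Psi> x - \<Psi> y) dx dy\<close> in two ways.

  \<^item> On the Fourier side \<open>A\<^sub>t\<close> is the energy of the Fourier transform of the image of \<open>h\<close>, damped by a
    Gaussian of width \<open>1/t\<close>. In polar coordinates its restriction to a ray is the one-dimensional
    Fourier transform of a Radon transform, and integration by parts and Bessel's inequality bound it by half-plane
    masses; hence \<open>A\<^sub>t \<le> C t\<^sup>-\<^sup>3 \<parallel>\<D>h\<parallel>\<^sup>2\<close> (\<open>inverted_energy_le_cylinder_energy\<close>). The data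
    give the half-plane masses only modulo the total mass of \<open>h\<close> and the jump correction. Both are
    recovered from the regions of the cylinder where \<open>\<D>h\<close> is constant in \<open>p\<close>, and these exist
    because the inverted disc stays away from the origin and approaches the unit circle only at
    \<open>(0, 1)\<close> (\<open>peak_slice\<close>, \<open>jump_correction_le\<close>).

  \<^item> In physical space \<open>2 h(x) h(y) = h(x)\<^sup>2 + h(y)\<^sup>2 - (h(x) - h(y))\<^sup>2\<close>. The squares contribute at
    least a multiple of \<open>\<parallel>h\<parallel>\<^sup>2\<close>, and since \<open>\<Psi>\<close> is bi-Lipschitz on an annulus around the support, the
    differences are dominated by the same expression without \<open>\<Psi>\<close> (\<open>L2_le_inverted_energy\<close>). By
    Plancherel's identity that expression is at most \<open>t\<^sup>2\<^sup>\<beta>\<close> times the squared Sobolev norm, up to a constant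
    (\<open>sobolev_bounds\<close>).

  Together \<open>\<parallel>h\<parallel>\<^sup>2 \<le> C (t\<^sup>-\<^sup>3 \<epsilon>\<^sup>2 + t\<^sup>2\<^sup>\<beta> \<rho>\<^sup>2)\<close> for all \<open>0 < t \<le> 1\<close> (\<open>stability_trade_off\<close>), and the
  choice \<open>t = (\<epsilon>/\<rho>)\<^bsup>1/(\<beta> + 3/2)\<^esup>\<close> balances the two terms (\<open>optimise_scale\<close>).\<close>

section \<open>Weighted Fourier energy as a quadratic form\<close>

lemma integrable_mult_pair:
  fixes f :: "'a::euclidean_space \<Rightarrow> 'c::{real_normed_field,banach,second_countable_topology}" and g :: "'b::euclidean_space \<Rightarrow> 'c"
  assumes f: "integrable lborel f" and g: "integrable lborel g"
  shows "integrable (lborel \<Otimes>\<^sub>M lborel) (\<lambda>z. f (fst z) * g (snd z))"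
    and "(\<integral>z. f (fst z) * g (snd z) \<partial>(lborel \<Otimes>\<^sub>M lborel)) = (\<integral>x. f x \<partial>lborel) * (\<integral>y. g y \<partial>lborel)"
proof -
  have [measurable]: "f \<in> borel_measurable borel" "g \<in> borel_measurable borel"
    using f g by auto
  show 1: "integrable (lborel \<Otimes>\<^sub>M lborel) (\<lambda>z. f (fst z) * g (snd z))"
  proof (rule lborel_pair.Fubini_integrable)
    show "integrable lborel (\<lambda>x. \<integral>y. norm (f (fst (x, y)) * g (snd (x, y))) \<partial>lborel)"
      using f g by (simp add: norm_mult)
    show "AE x in lborel. integrable lborel (\<lambda>y. f (fst (x, y)) * g (snd (x, y)))"
      using g by simp
  qed measurable
  have "(\<integral>z. f (fst z) * g (snd z) \<partial>(lborel \<Otimes>\<^sub>M lborel)) = (\<integral>x. \<integral>y. f x * g y \<partial>lborel \<partial>lborel)"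
    using lborel_pair.integral_fst'[OF 1] by simp
  also have "\<dots> = (\<integral>x. f x \<partial>lborel) * (\<integral>y. g y \<partial>lborel)"
    using f g by (simp)
  finally show "(\<integral>z. f (fst z) * g (snd z) \<partial>(lborel \<Otimes>\<^sub>M lborel)) = (\<integral>x. f x \<partial>lborel) * (\<integral>y. g y \<partial>lborel)" .
qed

lemma fourier_integral_norm_square:
  fixes f :: "'a::euclidean_space \<Rightarrow> real" and s :: "'a \<Rightarrow> real"
  assumes f: "integrable lborel f" and s: "s \<in> borel_measurable borel"
  shows "(cmod (\<integral>x. f x * cis (- s x) \<partial>lborel))\<^sup>2
    = (\<integral>z. f (fst z) * f (snd z) * cos (s (fst z) - s (snd z)) \<partial>(lborel \<Otimes>\<^sub>M lborel))"
proof -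
  have [measurable]: "f \<in> borel_measurable borel" "s \<in> borel_measurable borel"
    using f s by auto
  have ic: "integrable lborel (\<lambda>x. f x * cos (s x))"
    by (rule Bochner_Integration.integrable_bound[OF f]) (auto simp: abs_mult mult_left_le)
  have isn: "integrable lborel (\<lambda>x. f x * sin (s x))"
    by (rule Bochner_Integration.integrable_bound[OF f]) (auto simp: abs_mult mult_left_le)
  have i: "integrable lborel (\<lambda>x. complex_of_real (f x) * cis (- s x))"
  proof (rule Bochner_Integration.integrable_bound[OF f])
    show "(\<lambda>x. complex_of_real (f x) * cis (- s x)) \<in> borel_measurable lborel"
      unfolding cis_conv_exp by measurable
  qed (auto simp: norm_mult)
  let ?N = "\<integral>x. f x * cis (- s x) \<partial>lborel"
  have "Re ?N = (\<integral>x. f x * cos (s x) \<partial>lborel)"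
    by (subst integral_Re[OF i, symmetric]) simp
  moreover have "Im ?N = - (\<integral>x. f x * sin (s x) \<partial>lborel)"
    by (subst integral_Im[OF i, symmetric]) simp
  ultimately have "(cmod ?N)\<^sup>2 = (\<integral>x. f x * cos (s x) \<partial>lborel) * (\<integral>x. f x * cos (s x) \<partial>lborel)
     + (\<integral>x. f x * sin (s x) \<partial>lborel) * (\<integral>x. f x * sin (s x) \<partial>lborel)"
    unfolding cmod_power2 by (simp add: power2_eq_square)
  also have "\<dots> = (\<integral>z. (f (fst z) * cos (s (fst z))) * (f (snd z) * cos (s (snd z)))
     + (f (fst z) * sin (s (fst z))) * (f (snd z) * sin (s (snd z))) \<partial>(lborel \<Otimes>\<^sub>M lborel))"
    using integrable_mult_pair[OF ic ic] integrable_mult_pair[OF isn isn] by simp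
  also have "\<dots> = (\<integral>z. f (fst z) * f (snd z) * cos (s (fst z) - s (snd z)) \<partial>(lborel \<Otimes>\<^sub>M lborel))"
    by (rule arg_cong[where f="integral\<^sup>L _"]) (auto simp: cos_diff algebra_simps)
  finally show ?thesis .
qed

text \<open>Expanding the square and exchanging the integrals puts the whole
  frequency dependence into the kernel \<open>\<integral> w(\<xi>) cos(\<xi> \<bullet> z) d\<xi>\<close>. The phase map \<open>\<Psi>\<close> is arbitrary, so the
  identity serves the ordinary Fourier transform and, without a change of variables, the Fourier
  transform of the image of \<open>f\<close> under the inversion.\<close>

lemma weighted_fourier_energy:
  fixes f :: "'a::euclidean_space \<Rightarrow> real" and \<Psi> :: "'a \<Rightarrow> 'b::euclidean_space" and w :: "'b \<Rightarrow> real"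
  assumes f: "integrable lborel f" and \<Psi>: "\<Psi> \<in> borel_measurable borel" and w: "integrable lborel w"
  shows "integrable lborel (\<lambda>\<xi>. w \<xi> * (cmod (\<integral>x. f x * cis (- (\<xi> \<bullet> \<Psi> x)) \<partial>lborel))\<^sup>2)" (is ?int)
    and "(\<integral>\<xi>. w \<xi> * (cmod (\<integral>x. f x * cis (- (\<xi> \<bullet> \<Psi> x)) \<partial>lborel))\<^sup>2 \<partial>lborel)
      = (\<integral>z. f (fst z) * f (snd z) * (\<integral>\<xi>. w \<xi> * cos (\<xi> \<bullet> (\<Psi> (fst z) - \<Psi> (snd z))) \<partial>lborel)
          \<partial>(lborel \<Otimes>\<^sub>M lborel))" (is ?eq)
proof -
  note [measurable] = \<Psi>
  have [measurable]: "f \<in> borel_measurable borel" "w \<in> borel_measurable borel"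
    using f w by auto
  have ff: "integrable lborel (\<lambda>z. f (fst z) * f (snd z))"
    using integrable_mult_pair(1)[OF f f] by (simp add: lborel_prod)
  let ?F = "\<lambda>\<xi> z. w \<xi> * (f (fst z) * f (snd z) * cos (\<xi> \<bullet> \<Psi> (fst z) - \<xi> \<bullet> \<Psi> (snd z)))"
  have *: "integrable (lborel \<Otimes>\<^sub>M lborel) (case_prod ?F)"
  proof (rule Bochner_Integration.integrable_bound[OF integrable_mult_pair(1)[OF w ff]])
    have [measurable]: "(\<lambda>z. f (fst z) * f (snd z)) \<in> borel_measurable borel"
      using ff by auto
    have [measurable]: "(\<lambda>z::'a \<times> 'a. \<Psi> (fst z)) \<in> borel_measurable borel" "(\<lambda>z::'a \<times> 'a. \<Psi> (snd z)) \<in> borel_measurable borel"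
      by (intro measurable_compose[OF _ \<Psi>] borel_measurable_continuous_onI continuous_intros)+
    show "case_prod ?F \<in> borel_measurable (lborel \<Otimes>\<^sub>M lborel)"
      by measurable
  qed (auto simp: abs_mult intro!: AE_I2 mult_left_mono mult_left_le)
  have e: "w \<xi> * (cmod (\<integral>x. f x * cis (- (\<xi> \<bullet> \<Psi> x)) \<partial>lborel))\<^sup>2 = (\<integral>z. ?F \<xi> z \<partial>lborel)" for \<xi>
    by (subst fourier_integral_norm_square[OF f]) (simp_all add: lborel_prod)
  show ?int unfolding e by (rule lborel_pair.integrable_fst[OF *])
  have "(\<integral>\<xi>. w \<xi> * (cmod (\<integral>x. f x * cis (- (\<xi> \<bullet> \<Psi> x)) \<partial>lborel))\<^sup>2 \<partial>lborel)
    = (\<integral>z. (\<integral>\<xi>. ?F \<xi> z \<partial>lborel) \<partial>lborel)"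
    unfolding e by (rule lborel_pair.Fubini_integral[OF *, symmetric])
  also have "\<dots> = (\<integral>z. f (fst z) * f (snd z) * (\<integral>\<xi>. w \<xi> * cos (\<xi> \<bullet> (\<Psi> (fst z) - \<Psi> (snd z))) \<partial>lborel)
          \<partial>lborel)"
    by (subst integral_mult_right_zero[symmetric]) (simp add: inner_diff_right mult_ac)
  finally show ?eq by (simp add: lborel_prod)
qed

text \<open>Rescaling of the characteristic function of the standard normal
  distribution.\<close>

lemma gaussian_fourier_line:
  fixes \<tau> z :: real
  assumes "\<tau> > 0"
  shows "integrable lborel (\<lambda>s. exp (-(\<tau>\<^sup>2 * s\<^sup>2 / 2)))"
    and "(\<integral>s. exp (-(\<tau>\<^sup>2 * s\<^sup>2 / 2)) * cos (s * z) \<partial>lborel) = sqrt (2 * pi) / \<tau> * exp (-(z\<^sup>2 / (2 * \<tau>\<^sup>2)))"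
    and "(\<integral>s. exp (-(\<tau>\<^sup>2 * s\<^sup>2 / 2)) * sin (s * z) \<partial>lborel) = 0"
proof -
  have i0: "integrable lborel (\<lambda>s. std_normal_density (0 + \<tau> * s))"
    by (rule lborel_integrable_real_affine) (use assms in auto)
  have e: "exp (-(\<tau>\<^sup>2 * s\<^sup>2 / 2)) = sqrt (2 * pi) * std_normal_density (0 + \<tau> * s)" for s
    by (simp add: std_normal_density_def power_mult_distrib)
  show i1: "integrable lborel (\<lambda>s. exp (-(\<tau>\<^sup>2 * s\<^sup>2 / 2)))"
    unfolding e using i0 by simp
  have ic: "integrable lborel (\<lambda>x. complex_of_real (std_normal_density x) * iexp (y * x))" for y
    by (rule Bochner_Integration.integrable_bound[OF integrable_normal_density[of 1 0]])
       (auto simp: norm_mult)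
  have ch: "(\<integral>x. std_normal_density x *\<^sub>R iexp (y * x) \<partial>lborel) = complex_of_real (exp (-(y\<^sup>2) / 2))" for y
    using char_std_normal_distribution
    unfolding char_def fun_eq_iff by (subst (asm) integral_density) auto
  have c: "(\<integral>x. std_normal_density x * cos (y * x) \<partial>lborel) = exp (-(y\<^sup>2) / 2)" for y
  proof -
    have "(\<integral>x. std_normal_density x * cos (y * x) \<partial>lborel)
        = Re (\<integral>x. std_normal_density x *\<^sub>R iexp (y * x) \<partial>lborel)"
      by (subst integral_Re[symmetric]) (use ic[of y] in \<open>auto simp: scaleR_conv_of_real Re_exp Im_exp\<close>)
    then show ?thesis unfolding ch by simp
  qed
  have s: "(\<integral>x. std_normal_density x * sin (y * x) \<partial>lborel) = 0" for y
  proof -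
    have "(\<integral>x. std_normal_density x * sin (y * x) \<partial>lborel)
        = Im (\<integral>x. std_normal_density x *\<^sub>R iexp (y * x) \<partial>lborel)"
      by (subst integral_Im[symmetric]) (use ic[of y] in \<open>auto simp: scaleR_conv_of_real Re_exp Im_exp\<close>)
    then show ?thesis unfolding ch by simp
  qed
  have "(\<integral>x. std_normal_density x * cos (z / \<tau> * x) \<partial>lborel)
      = \<tau> * (\<integral>s. std_normal_density (0 + \<tau> * s) * cos (z / \<tau> * (0 + \<tau> * s)) \<partial>lborel)"
    using assms by (subst lborel_integral_real_affine[of \<tau> _ 0]) auto
  then have C: "(\<integral>s. std_normal_density (0 + \<tau> * s) * cos (z / \<tau> * (0 + \<tau> * s)) \<partial>lborel)
      = exp (-((z / \<tau>)\<^sup>2) / 2) / \<tau>"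
    unfolding c using assms by (simp add: field_simps)
  have "exp (-(\<tau>\<^sup>2 * s\<^sup>2 / 2)) * cos (s * z)
      = sqrt (2 * pi) * (std_normal_density (0 + \<tau> * s) * cos (z / \<tau> * (0 + \<tau> * s)))" for s
    unfolding e using assms by (simp add: mult.commute)
  then have "(\<integral>s. exp (-(\<tau>\<^sup>2 * s\<^sup>2 / 2)) * cos (s * z) \<partial>lborel)
      = sqrt (2 * pi) * (exp (-((z / \<tau>)\<^sup>2) / 2) / \<tau>)"
    by (simp only: integral_mult_right_zero C)
  then show "(\<integral>s. exp (-(\<tau>\<^sup>2 * s\<^sup>2 / 2)) * cos (s * z) \<partial>lborel) = sqrt (2 * pi) / \<tau> * exp (-(z\<^sup>2 / (2 * \<tau>\<^sup>2)))"
    by (simp add: power_divide mult.commute)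
  have "(\<integral>x. std_normal_density x * sin (z / \<tau> * x) \<partial>lborel)
      = \<tau> * (\<integral>s. std_normal_density (0 + \<tau> * s) * sin (z / \<tau> * (0 + \<tau> * s)) \<partial>lborel)"
    using assms by (subst lborel_integral_real_affine[of \<tau> _ 0]) auto
  then have S: "(\<integral>s. std_normal_density (0 + \<tau> * s) * sin (z / \<tau> * (0 + \<tau> * s)) \<partial>lborel) = 0"
    unfolding s using assms by simp
  have "exp (-(\<tau>\<^sup>2 * s\<^sup>2 / 2)) * sin (s * z)
      = sqrt (2 * pi) * (std_normal_density (0 + \<tau> * s) * sin (z / \<tau> * (0 + \<tau> * s)))" for s
    unfolding e using assms by (simp add: mult.commute)
  then show "(\<integral>s. exp (-(\<tau>\<^sup>2 * s\<^sup>2 / 2)) * sin (s * z) \<partial>lborel) = 0"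
    by (simp only: integral_mult_right_zero S mult_zero_right)
qed

text \<open>The centred normal density on the plane, with standard deviation \<open>t\<close> in each
  coordinate.\<close>

definition gauss :: "real \<Rightarrow> real \<times> real \<Rightarrow> real" where
  "gauss t z = exp (-((norm z)\<^sup>2 / (2 * t\<^sup>2))) / (2 * pi * t\<^sup>2)"

lemma norm_prod_power2: "(norm (z :: real \<times> real))\<^sup>2 = (fst z)\<^sup>2 + (snd z)\<^sup>2"
  by (cases z) (simp add: norm_Pair)

lemma gaussian_fourier_plane:
  fixes t :: real and z :: "real \<times> real"
  assumes "t > 0"
  shows "integrable lborel (\<lambda>\<xi>::real \<times> real. exp (-(t\<^sup>2 * (norm \<xi>)\<^sup>2 / 2)))"
    and "(\<integral>\<xi>. exp (-(t\<^sup>2 * (norm \<xi>)\<^sup>2 / 2)) * cos (\<xi> \<bullet> z) \<partial>lborel) = (2 * pi)\<^sup>2 * gauss t z"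
proof -
  note G = gaussian_fourier_line[OF assms]
  let ?e = "\<lambda>s::real. exp (-(t\<^sup>2 * s\<^sup>2 / 2))"
  have e: "exp (-(t\<^sup>2 * (norm \<xi>)\<^sup>2 / 2)) = ?e (fst \<xi>) * ?e (snd \<xi>)" for \<xi> :: "real \<times> real"
    unfolding norm_prod_power2 by (simp add: exp_add[symmetric] algebra_simps add_divide_distrib)
  have ic: "integrable lborel (\<lambda>s. ?e s * cos (s * y))" for y
    by (rule Bochner_Integration.integrable_bound[OF G(1)]) (auto simp: abs_mult)
  have isn: "integrable lborel (\<lambda>s. ?e s * sin (s * y))" for y
    by (rule Bochner_Integration.integrable_bound[OF G(1)]) (auto simp: abs_mult)
  show "integrable lborel (\<lambda>\<xi>::real \<times> real. exp (-(t\<^sup>2 * (norm \<xi>)\<^sup>2 / 2)))"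
    unfolding e using integrable_mult_pair(1)[OF G(1) G(1)] by (simp add: lborel_prod)
  have "(\<integral>\<xi>. exp (-(t\<^sup>2 * (norm \<xi>)\<^sup>2 / 2)) * cos (\<xi> \<bullet> z) \<partial>lborel)
     = (\<integral>\<xi>. (?e (fst \<xi>) * cos (fst \<xi> * fst z)) * (?e (snd \<xi>) * cos (snd \<xi> * snd z))
          - (?e (fst \<xi>) * sin (fst \<xi> * fst z)) * (?e (snd \<xi>) * sin (snd \<xi> * snd z)) \<partial>(lborel \<Otimes>\<^sub>M lborel))"
    unfolding e lborel_prod
    by (rule arg_cong[where f="integral\<^sup>L _"]) (auto simp: inner_prod_def cos_add algebra_simps)
  also have "\<dots> = (sqrt (2 * pi) / t * exp (-((fst z)\<^sup>2 / (2 * t\<^sup>2)))) * (sqrt (2 * pi) / t * exp (-((snd z)\<^sup>2 / (2 * t\<^sup>2))))"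
    using integrable_mult_pair[OF ic ic] integrable_mult_pair[OF isn isn] by (simp add: G)
  also have "\<dots> = (sqrt (2 * pi))\<^sup>2 / t\<^sup>2 * exp (-((norm z)\<^sup>2 / (2 * t\<^sup>2)))"
    unfolding norm_prod_power2 by (simp add: exp_add[symmetric] power2_eq_square algebra_simps add_divide_distrib flip: exp_add)
  also have "\<dots> = (2 * pi)\<^sup>2 * gauss t z"
    by (simp add: gauss_def power2_eq_square)
  finally show "(\<integral>\<xi>. exp (-(t\<^sup>2 * (norm \<xi>)\<^sup>2 / 2)) * cos (\<xi> \<bullet> z) \<partial>lborel) = (2 * pi)\<^sup>2 * gauss t z" .
qed

lemma gauss_nonneg [simp]: "0 \<le> gauss t z"
  by (simp add: gauss_def)

lemma gauss_minus_commute: "gauss t (x - y) = gauss t (y - x)"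
  by (simp add: gauss_def norm_minus_commute)

lemma gauss_le: "gauss t z \<le> 1 / (2 * pi * t\<^sup>2)"
  by (simp add: gauss_def divide_right_mono)

lemma borel_measurable_gauss [measurable]: "gauss t \<in> borel_measurable borel"
  unfolding gauss_def by measurable

lemma gauss_integral:
  assumes "t > 0"
  shows "integrable lborel (gauss t)" and "(\<integral>z. gauss t z \<partial>lborel) = 1"
proof -
  have e: "gauss t z = exp (-((1/t)\<^sup>2 * (norm z)\<^sup>2 / 2)) * cos (z \<bullet> 0) / (2 * pi * t\<^sup>2)" for z
    by (simp add: gauss_def power_divide)
  have "integrable lborel (\<lambda>z::real \<times> real. exp (-((1/t)\<^sup>2 * (norm z)\<^sup>2 / 2)) / (2 * pi * t\<^sup>2))"
    using gaussian_fourier_plane(1)[of "1/t"] assms by simp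
  then show "integrable lborel (gauss t)"
    by (simp add: gauss_def[abs_def] power_divide mult.commute)
  have "(\<integral>z. gauss t z \<partial>lborel) = (\<integral>z. exp (-((1/t)\<^sup>2 * (norm z)\<^sup>2 / 2)) * cos (z \<bullet> (0 :: real \<times> real)) \<partial>lborel) / (2 * pi * t\<^sup>2)"
    unfolding e by (rule integral_divide_zero)
  also have "\<dots> = 1"
    using gaussian_fourier_plane(2)[of "1/t" 0] assms by (simp add: gauss_def power2_eq_square)
  finally show "(\<integral>z. gauss t z \<partial>lborel) = 1" .
qed

lemma nn_integral_gauss_shift:
  assumes "t > 0"
  shows "(\<integral>\<^sup>+y. gauss t (x - y) \<partial>lborel) = 1"
proof -
  have "(\<integral>\<^sup>+y. gauss t (y - x) \<partial>lborel) = (\<integral>\<^sup>+y. gauss t y \<partial>distr lborel borel ((+) (- x)))"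
    by (subst nn_integral_distr) auto
  also have "\<dots> = 1"
    using gauss_integral[OF assms] by (simp add: lborel_distr_plus nn_integral_eq_integral)
  finally show ?thesis by (simp add: gauss_minus_commute)
qed

section \<open>Polar coordinates with a signed radius\<close>

lemma SUP_attained:
  fixes h :: "nat \<Rightarrow> ennreal"
  assumes "\<And>n. h n \<le> v" and "h m = v"
  shows "(SUP n. h n) = v"
  using assms by (metis SUP_least SUP_upper UNIV_I antisym)

text \<open>The substitution rule is applied on the compact intervals between
  \<open>arctan (-n)\<close> and \<open>arctan n\<close>; monotone convergence then gives the open interval.\<close>

lemma nn_integral_tan_substitution:
  fixes f :: "real \<Rightarrow> real"
  assumes [measurable]: "f \<in> borel_measurable borel"
  shows "(\<integral>\<^sup>+s. f s \<partial>lborel)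
    = (\<integral>\<^sup>+\<psi>. ennreal (f (tan \<psi>) * inverse ((cos \<psi>)\<^sup>2)) * indicator {-(pi/2)<..<pi/2} \<psi> \<partial>lborel)"
proof -
  have [measurable]: "(tan :: real \<Rightarrow> real) \<in> borel_measurable borel"
    unfolding tan_def by measurable
  define a where "a n = arctan (real n)" for n
  have a: "0 \<le> a n" "a n < pi/2" "- (pi/2) < a n" for n
    using arctan_bounded[of "real n"] by (auto simp: a_def)
  have a_mono: "a m \<le> a n" if "m \<le> n" for m n
    using that by (simp add: a_def arctan_le_iff)
  have step: "(\<integral>\<^sup>+s. f s * indicator {-real n..real n} s \<partial>lborel)
      = (\<integral>\<^sup>+\<psi>. f (tan \<psi>) * inverse ((cos \<psi>)\<^sup>2) * indicator {-a n..a n} \<psi> \<partial>lborel)" for n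
  proof -
    have t: "tan (a n) = real n" "tan (- a n) = - real n" by (auto simp: a_def tan_arctan)
    have cos_nz: "cos x \<noteq> 0" if "x \<in> {-a n..a n}" for x
      using cos_gt_zero_pi[of x] a[of n] that by auto
    have "continuous_on {-a n..a n} (\<lambda>x. inverse ((cos x)\<^sup>2))"
      using cos_nz by (auto intro!: continuous_intros)
    moreover have "set_borel_measurable borel {tan (- a n)..tan (a n)} f"
      unfolding set_borel_measurable_def by measurable
    moreover have "(tan has_real_derivative inverse ((cos x)\<^sup>2)) (at x)" if "x \<in> {-a n..a n}" for x
      using DERIV_tan cos_nz[OF that] .
    ultimately have "(\<integral>\<^sup>+s. f s * indicator {tan (- a n)..tan (a n)} s \<partial>lborel)
        = (\<integral>\<^sup>+\<psi>. f (tan \<psi>) * inverse ((cos \<psi>)\<^sup>2) * indicator {-a n..a n} \<psi> \<partial>lborel)"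
      using a[of n] by (intro nn_integral_substitution) auto
    then show ?thesis unfolding t .
  qed
  have "(\<integral>\<^sup>+s. f s \<partial>lborel) = (\<integral>\<^sup>+s. (SUP n. ennreal (f s * indicator {-real n..real n} s)) \<partial>lborel)"
  proof (rule nn_integral_cong)
    fix s :: real
    obtain n :: nat where n: "\<bar>s\<bar> \<le> n" using real_arch_simple by blast
    show "ennreal (f s) = (SUP n. ennreal (f s * indicator {-real n..real n} s))"
      by (rule SUP_attained[symmetric, of _ _ n]) (use n in \<open>auto split: split_indicator\<close>)
  qed
  also have "\<dots> = (SUP n. (\<integral>\<^sup>+s. ennreal (f s * indicator {-real n..real n} s) \<partial>lborel))"
    by (rule nn_integral_monotone_convergence_SUP)
       (auto simp: incseq_def le_fun_def split: split_indicator)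
  also have "\<dots> = (SUP n. (\<integral>\<^sup>+\<psi>. f (tan \<psi>) * inverse ((cos \<psi>)\<^sup>2) * indicator {-a n..a n} \<psi> \<partial>lborel))"
    unfolding step ..
  also have "\<dots> = (\<integral>\<^sup>+\<psi>. (SUP n. ennreal (f (tan \<psi>) * inverse ((cos \<psi>)\<^sup>2) * indicator {-a n..a n} \<psi>)) \<partial>lborel)"
  proof (rule nn_integral_monotone_convergence_SUP[symmetric])
    show "incseq (\<lambda>n \<psi>. ennreal (f (tan \<psi>) * inverse ((cos \<psi>)\<^sup>2) * indicator {-a n..a n} \<psi>))"
      unfolding incseq_def le_fun_def
      by (auto split: split_indicator dest!: a_mono)
  qed measurable
  also have "\<dots> = (\<integral>\<^sup>+\<psi>. ennreal (f (tan \<psi>) * inverse ((cos \<psi>)\<^sup>2)) * indicator {-(pi/2)<..<pi/2} \<psi> \<partial>lborel)"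
  proof (rule nn_integral_cong)
    fix \<psi> :: real
    let ?v = "f (tan \<psi>) * inverse ((cos \<psi>)\<^sup>2)"
    show "(SUP n. ennreal (?v * indicator {-a n..a n} \<psi>)) = ennreal ?v * indicator {-(pi/2)<..<pi/2} \<psi>"
    proof (cases "\<psi> \<in> {-(pi/2)<..<pi/2}")
      case True
      obtain n :: nat where n: "\<bar>tan \<psi>\<bar> \<le> n" using real_arch_simple by blast
      have "arctan (tan \<psi>) \<le> a n" "arctan (- real n) \<le> arctan (tan \<psi>)"
        using n unfolding a_def arctan_le_iff by auto
      then have "\<psi> \<in> {-a n..a n}"
        using True by (simp add: arctan_tan a_def arctan_minus)
      then have "(SUP n. ennreal (?v * indicator {-a n..a n} \<psi>)) = ennreal ?v"
        by (intro SUP_attained[of _ _ n]) (auto split: split_indicator)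
      then show ?thesis using True by simp
    next
      case False
      then have "indicator {-a n..a n} \<psi> = (0::real)" for n
        using a[of n] by (auto split: split_indicator)
      then show ?thesis using False by simp
    qed
  qed
  finally show ?thesis .
qed

text \<open>Lines through the origin are parametrised by half of the circle and a
  radius of either sign. A full real line of radii is what the one-dimensional Fourier analysis on
  each line needs. The angle comes from writing a point as \<open>(b tan \<psi>, b)\<close>, so that \<open>\<phi> = \<pi>/2 - \<psi>\<close>.\<close>

lemma nn_integral_polar_half_circle:
  fixes g :: "real \<times> real \<Rightarrow> real"
  assumes [measurable]: "g \<in> borel_measurable borel" and nonneg: "\<And>z. 0 \<le> g z"
  shows "(\<integral>\<^sup>+z. g z \<partial>lborel)
    = (\<integral>\<^sup>+\<phi>. (\<integral>\<^sup>+\<sigma>. ennreal (\<bar>\<sigma>\<bar> * g (\<sigma> * cos \<phi>, \<sigma> * sin \<phi>)) \<partial>lborel) * indicator {0<..<pi} \<phi> \<partial>lborel)"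
proof -
  have [measurable]: "g \<in> borel_measurable (borel \<Otimes>\<^sub>M borel)"
    by (simp add: borel_prod)
  let ?I = "indicator {-(pi/2)<..<pi/2} :: real \<Rightarrow> ennreal"
  have "(\<integral>\<^sup>+z. g z \<partial>lborel) = (\<integral>\<^sup>+b. \<integral>\<^sup>+a. g (a, b) \<partial>lborel \<partial>lborel)"
    by (subst lborel_prod[symmetric], subst lborel_pair.nn_integral_snd[symmetric]) auto
  also have "\<dots> = (\<integral>\<^sup>+b. \<integral>\<^sup>+s. ennreal (\<bar>b\<bar> * g (b * s, b)) \<partial>lborel \<partial>lborel)"
  proof (rule nn_integral_cong_AE)
    have "AE b in lborel. b \<noteq> (0::real)" by (rule AE_lborel_singleton)
    then show "AE b in lborel. (\<integral>\<^sup>+a. g (a, b) \<partial>lborel) = (\<integral>\<^sup>+s. ennreal (\<bar>b\<bar> * g (b * s, b)) \<partial>lborel)"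
    proof eventually_elim
      case (elim b)
      have "(\<integral>\<^sup>+a. ennreal (g (a, b)) \<partial>lborel) = \<bar>b\<bar> * (\<integral>\<^sup>+s. ennreal (g (0 + b * s, b)) \<partial>lborel)"
        by (rule nn_integral_real_affine) (use elim in auto)
      also have "\<dots> = (\<integral>\<^sup>+s. ennreal (\<bar>b\<bar> * g (b * s, b)) \<partial>lborel)"
        by (subst nn_integral_cmult[symmetric]) (auto simp: ennreal_mult nonneg)
      finally show ?case .
    qed
  qed
  also have "\<dots> = (\<integral>\<^sup>+b. \<integral>\<^sup>+\<psi>. ennreal (\<bar>b\<bar> * g (b * tan \<psi>, b) * inverse ((cos \<psi>)\<^sup>2)) * ?I \<psi> \<partial>lborel \<partial>lborel)"
    by (subst nn_integral_tan_substitution) auto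
  also have "\<dots> = (\<integral>\<^sup>+\<psi>. \<integral>\<^sup>+b. ennreal (\<bar>b\<bar> * g (b * tan \<psi>, b) * inverse ((cos \<psi>)\<^sup>2)) * ?I \<psi> \<partial>lborel \<partial>lborel)"
    by (rule lborel_pair.Fubini') (auto simp: tan_def)
  also have "\<dots> = (\<integral>\<^sup>+\<psi>. (\<integral>\<^sup>+\<sigma>. ennreal (\<bar>\<sigma>\<bar> * g (\<sigma> * sin \<psi>, \<sigma> * cos \<psi>)) \<partial>lborel) * ?I \<psi> \<partial>lborel)"
  proof (rule nn_integral_cong)
    fix \<psi> :: real
    show "(\<integral>\<^sup>+b. ennreal (\<bar>b\<bar> * g (b * tan \<psi>, b) * inverse ((cos \<psi>)\<^sup>2)) * ?I \<psi> \<partial>lborel)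
       = (\<integral>\<^sup>+\<sigma>. ennreal (\<bar>\<sigma>\<bar> * g (\<sigma> * sin \<psi>, \<sigma> * cos \<psi>)) \<partial>lborel) * ?I \<psi>"
    proof (cases "\<psi> \<in> {-(pi/2)<..<pi/2}")
      case True
      then have c: "cos \<psi> > 0" using cos_gt_zero_pi[of \<psi>] by auto
      have "(\<integral>\<^sup>+b. ennreal (\<bar>b\<bar> * g (b * tan \<psi>, b) * inverse ((cos \<psi>)\<^sup>2)) \<partial>lborel)
         = \<bar>cos \<psi>\<bar> * (\<integral>\<^sup>+\<sigma>. ennreal (\<bar>0 + cos \<psi> * \<sigma>\<bar> * g ((0 + cos \<psi> * \<sigma>) * tan \<psi>, 0 + cos \<psi> * \<sigma>) * inverse ((cos \<psi>)\<^sup>2)) \<partial>lborel)"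
        by (rule nn_integral_real_affine) (use c in auto)
      also have "\<dots> = (\<integral>\<^sup>+\<sigma>. \<bar>cos \<psi>\<bar> * ennreal (\<bar>0 + cos \<psi> * \<sigma>\<bar> * g ((0 + cos \<psi> * \<sigma>) * tan \<psi>, 0 + cos \<psi> * \<sigma>) * inverse ((cos \<psi>)\<^sup>2)) \<partial>lborel)"
        by (rule nn_integral_cmult[symmetric]) simp
      also have "\<dots> = (\<integral>\<^sup>+\<sigma>. ennreal (\<bar>\<sigma>\<bar> * g (\<sigma> * sin \<psi>, \<sigma> * cos \<psi>)) \<partial>lborel)"
        using c by (intro nn_integral_cong)
          (auto simp: ennreal_mult[symmetric] nonneg tan_def abs_mult power2_eq_square field_simps)
      finally show ?thesis using True by simp
    qed simp
  qed
  also have "\<dots> = (\<integral>\<^sup>+\<phi>. (\<integral>\<^sup>+\<sigma>. ennreal (\<bar>\<sigma>\<bar> * g (\<sigma> * cos \<phi>, \<sigma> * sin \<phi>)) \<partial>lborel) * indicator {0<..<pi} \<phi> \<partial>lborel)"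
  proof -
    have i: "?I (pi/2 + (-1) * \<phi>) = indicator {0<..<pi} \<phi>" for \<phi>
      by (auto split: split_indicator)
    have sc: "sin (pi/2 + (-1) * \<phi>) = cos \<phi>" "cos (pi/2 + (-1) * \<phi>) = sin \<phi>" for \<phi> :: real
      using cos_sin_eq[of \<phi>] sin_cos_eq[of \<phi>] by simp_all
    have "(\<lambda>\<psi>. (\<integral>\<^sup>+\<sigma>. ennreal (\<bar>\<sigma>\<bar> * g (\<sigma> * sin \<psi>, \<sigma> * cos \<psi>)) \<partial>lborel) * ?I \<psi>) \<in> borel_measurable borel"
      by measurable
    from nn_integral_real_affine[OF this, of "-1" "pi/2", unfolded sc i] show ?thesis
      by simp
  qed
  finally show ?thesis .
qed

section \<open>Gaussian quadratic forms and moduli of continuity\<close>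

lemma gaussian_energy:
  fixes f :: "'a::euclidean_space \<Rightarrow> real" and \<Psi> :: "'a \<Rightarrow> real \<times> real"
  assumes f: "integrable lborel f" and \<Psi>: "\<Psi> \<in> borel_measurable borel" and t: "t > 0"
  shows "integrable lborel (\<lambda>\<xi>. exp (-(t\<^sup>2 * (norm \<xi>)\<^sup>2 / 2)) * (cmod (\<integral>x. f x * cis (- (\<xi> \<bullet> \<Psi> x)) \<partial>lborel))\<^sup>2)"
    and "(\<integral>\<xi>. exp (-(t\<^sup>2 * (norm \<xi>)\<^sup>2 / 2)) * (cmod (\<integral>x. f x * cis (- (\<xi> \<bullet> \<Psi> x)) \<partial>lborel))\<^sup>2 \<partial>lborel)
      = (2 * pi)\<^sup>2 * (\<integral>z. f (fst z) * f (snd z) * gauss t (\<Psi> (fst z) - \<Psi> (snd z)) \<partial>(lborel \<Otimes>\<^sub>M lborel))"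
proof -
  note E = weighted_fourier_energy[OF f \<Psi> gaussian_fourier_plane(1)[OF t]]
  show "integrable lborel (\<lambda>\<xi>. exp (-(t\<^sup>2 * (norm \<xi>)\<^sup>2 / 2)) * (cmod (\<integral>x. f x * cis (- (\<xi> \<bullet> \<Psi> x)) \<partial>lborel))\<^sup>2)"
    by (rule E(1))
  have "f (fst z) * f (snd z) * ((2 * pi)\<^sup>2 * gauss t (\<Psi> (fst z) - \<Psi> (snd z)))
      = (2 * pi)\<^sup>2 * (f (fst z) * f (snd z) * gauss t (\<Psi> (fst z) - \<Psi> (snd z)))" for z
    by simp
  then show "(\<integral>\<xi>. exp (-(t\<^sup>2 * (norm \<xi>)\<^sup>2 / 2)) * (cmod (\<integral>x. f x * cis (- (\<xi> \<bullet> \<Psi> x)) \<partial>lborel))\<^sup>2 \<partial>lborel)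
      = (2 * pi)\<^sup>2 * (\<integral>z. f (fst z) * f (snd z) * gauss t (\<Psi> (fst z) - \<Psi> (snd z)) \<partial>(lborel \<Otimes>\<^sub>M lborel))"
    unfolding E(2) gaussian_fourier_plane(2)[OF t] by (simp only: integral_mult_right_zero)
qed

text \<open>Polarisation, \<open>2ab = a\<^sup>2 + b\<^sup>2 - (a - b)\<^sup>2\<close>, under the integral; by symmetry of
  the kernel the two squares contribute equally.\<close>

lemma kernel_form_split:
  fixes f :: "'a::euclidean_space \<Rightarrow> real" and k :: "'a \<Rightarrow> 'a \<Rightarrow> real"
  assumes [measurable]: "f \<in> borel_measurable borel"
    and k[measurable]: "case_prod k \<in> borel_measurable (lborel \<Otimes>\<^sub>M lborel)"
    and sym: "\<And>x y. k x y = k y x" and nonneg: "\<And>x y. 0 \<le> k x y"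
    and int: "integrable (lborel \<Otimes>\<^sub>M lborel) (\<lambda>(x, y). (f x)\<^sup>2 * k x y)"
  shows "integrable (lborel \<Otimes>\<^sub>M lborel) (\<lambda>(x, y). (f x - f y)\<^sup>2 * k x y)"
    and "(\<integral>(x, y). f x * f y * k x y \<partial>(lborel \<Otimes>\<^sub>M lborel))
      = (\<integral>(x, y). (f x)\<^sup>2 * k x y \<partial>(lborel \<Otimes>\<^sub>M lborel))
        - (\<integral>(x, y). (f x - f y)\<^sup>2 * k x y \<partial>(lborel \<Otimes>\<^sub>M lborel)) / 2"
proof -
  let ?P = "lborel \<Otimes>\<^sub>M lborel :: ('a \<times> 'a) measure"
  have int': "integrable ?P (\<lambda>(x, y). (f y)\<^sup>2 * k x y)"
    using lborel_pair.integrable_product_swap[OF int] by (simp add: sym)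
  have eq: "(\<integral>(x, y). (f y)\<^sup>2 * k x y \<partial>?P) = (\<integral>(x, y). (f x)\<^sup>2 * k x y \<partial>?P)"
    using lborel_pair.integral_product_swap[OF borel_measurable_integrable[OF int]] by (simp add: sym)
  have sum: "integrable ?P (\<lambda>(x, y). (f x)\<^sup>2 * k x y + (f y)\<^sup>2 * k x y)"
    using Bochner_Integration.integrable_add[OF int int'] by (simp add: split_beta')
  have ff: "integrable ?P (\<lambda>(x, y). f x * f y * k x y)"
  proof (rule Bochner_Integration.integrable_bound[OF sum])
    have "\<bar>f x * f y * k x y\<bar> \<le> (f x)\<^sup>2 * k x y + (f y)\<^sup>2 * k x y" for x y
    proof -
      have "\<bar>f x * f y\<bar> \<le> (f x)\<^sup>2 + (f y)\<^sup>2"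
        using sum_squares_bound[of "\<bar>f x\<bar>" "\<bar>f y\<bar>"] abs_ge_zero[of "f x * f y"] unfolding abs_mult power2_abs by linarith
      from mult_right_mono[OF this nonneg] show ?thesis
        by (simp add: abs_mult nonneg distrib_right)
    qed
    then show "AE z in ?P. norm (case z of (x, y) \<Rightarrow> f x * f y * k x y)
        \<le> norm (case z of (x, y) \<Rightarrow> (f x)\<^sup>2 * k x y + (f y)\<^sup>2 * k x y)"
      by (auto intro!: AE_I2 order_trans[OF _ abs_ge_self])
  qed measurable
  have e: "(\<lambda>(x, y). (f x - f y)\<^sup>2 * k x y)
      = (\<lambda>z. (case z of (x, y) \<Rightarrow> (f x)\<^sup>2 * k x y + (f y)\<^sup>2 * k x y) - 2 * (case z of (x, y) \<Rightarrow> f x * f y * k x y))"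
    by (auto simp: power2_eq_square algebra_simps)
  show "integrable ?P (\<lambda>(x, y). (f x - f y)\<^sup>2 * k x y)"
    unfolding e using sum ff by auto
  have "(\<integral>(x, y). (f x - f y)\<^sup>2 * k x y \<partial>?P) = (\<integral>(x, y). (f x)\<^sup>2 * k x y + (f y)\<^sup>2 * k x y \<partial>?P)
      - 2 * (\<integral>(x, y). f x * f y * k x y \<partial>?P)"
    unfolding e using sum ff by simp
  also have "(\<integral>(x, y). (f x)\<^sup>2 * k x y + (f y)\<^sup>2 * k x y \<partial>?P) = 2 * (\<integral>(x, y). (f x)\<^sup>2 * k x y \<partial>?P)"
    using Bochner_Integration.integral_add[OF int int'] by (simp add: split_beta' eq[unfolded split_beta'])
  finally show "(\<integral>(x, y). f x * f y * k x y \<partial>?P)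
      = (\<integral>(x, y). (f x)\<^sup>2 * k x y \<partial>?P) - (\<integral>(x, y). (f x - f y)\<^sup>2 * k x y \<partial>?P) / 2"
    by (simp add: field_simps)
qed

text \<open>A quadratic-mean modulus of continuity at scale \<open>s\<close>. On the Fourier side it is
  the energy with the weight \<open>1 - exp (- s\<^sup>2 |\<xi>|\<^sup>2 / 2)\<close>.\<close>

definition gauss_modulus :: "real \<Rightarrow> (real \<times> real \<Rightarrow> real) \<Rightarrow> real" where
  "gauss_modulus s f = (\<integral>(x, y). (f x - f y)\<^sup>2 * gauss s (x - y) \<partial>(lborel \<Otimes>\<^sub>M lborel)) / 2"

lemma gauss_pair_integral:
  fixes g :: "real \<times> real \<Rightarrow> real"
  assumes g: "integrable lborel g" and s: "s > 0"
  shows "integrable (lborel \<Otimes>\<^sub>M lborel) (\<lambda>(x, y). g x * gauss s (x - y))"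
    and "(\<integral>(x, y). g x * gauss s (x - y) \<partial>(lborel \<Otimes>\<^sub>M lborel)) = (\<integral>x. g x \<partial>lborel)"
proof -
  have [measurable]: "g \<in> borel_measurable borel" using g by auto
  have ig: "integrable lborel (\<lambda>y. gauss s (x - y))" "(\<integral>y. gauss s (x - y) \<partial>lborel) = 1" for x
  proof -
    show "integrable lborel (\<lambda>y. gauss s (x - y))"
      by (rule integrableI_nonneg) (auto simp: nn_integral_gauss_shift[OF s])
    then have "ennreal (\<integral>y. gauss s (x - y) \<partial>lborel) = 1"
      by (subst nn_integral_eq_integral[symmetric]) (auto simp: nn_integral_gauss_shift[OF s])
    then show "(\<integral>y. gauss s (x - y) \<partial>lborel) = 1"
      by simp
  qed
  show int: "integrable (lborel \<Otimes>\<^sub>M lborel) (\<lambda>(x, y). g x * gauss s (x - y))"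
  proof (rule lborel_pair.Fubini_integrable)
    show "(\<lambda>(x, y). g x * gauss s (x - y)) \<in> borel_measurable (lborel \<Otimes>\<^sub>M lborel)"
      by measurable
  qed (use g in \<open>auto simp: abs_mult ig\<close>)
  show "(\<integral>(x, y). g x * gauss s (x - y) \<partial>(lborel \<Otimes>\<^sub>M lborel)) = (\<integral>x. g x \<partial>lborel)"
    using lborel_pair.integral_fst'[OF int] by (simp add: ig)
qed

lemma gauss_modulus_split:
  fixes f :: "real \<times> real \<Rightarrow> real"
  assumes [measurable]: "f \<in> borel_measurable borel" and f2: "integrable lborel (\<lambda>x. (f x)\<^sup>2)" and s: "s > 0"
  shows "integrable (lborel \<Otimes>\<^sub>M lborel) (\<lambda>(x, y). (f x - f y)\<^sup>2 * gauss s (x - y))"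
    and "(\<integral>(x, y). f x * f y * gauss s (x - y) \<partial>(lborel \<Otimes>\<^sub>M lborel))
      = (\<integral>x. (f x)\<^sup>2 \<partial>lborel) - gauss_modulus s f"
proof -
  have m: "(\<lambda>(x, y). gauss s (x - y)) \<in> borel_measurable (lborel \<Otimes>\<^sub>M lborel)"
    by measurable
  note sp = kernel_form_split[OF assms(1) m gauss_minus_commute gauss_nonneg gauss_pair_integral(1)[OF f2 s]]
  show "integrable (lborel \<Otimes>\<^sub>M lborel) (\<lambda>(x, y). (f x - f y)\<^sup>2 * gauss s (x - y))"
    by (rule sp(1))
  show "(\<integral>(x, y). f x * f y * gauss s (x - y) \<partial>(lborel \<Otimes>\<^sub>M lborel))
      = (\<integral>x. (f x)\<^sup>2 \<partial>lborel) - gauss_modulus s f"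
    using sp(2) gauss_pair_integral(2)[OF f2 s] by (simp add: gauss_modulus_def)
qed

section \<open>Comparison of a function with its inverted image\<close>

definition inversion :: "real \<times> real \<Rightarrow> real \<times> real" where
  "inversion x = x /\<^sub>R (norm x)\<^sup>2"

lemma borel_measurable_inversion [measurable]: "inversion \<in> borel_measurable borel"
  unfolding inversion_def by measurable

lemma norm_inversion_diff:
  assumes "x \<noteq> 0" "y \<noteq> 0"
  shows "norm (inversion x - inversion y) = norm (x - y) / (norm x * norm y)"
proof -
  have n: "norm x \<noteq> 0" "norm y \<noteq> 0" using assms by auto
  have "(norm (inversion x - inversion y))\<^sup>2 = (norm (x - y) / (norm x * norm y))\<^sup>2"
    unfolding inversion_def power_divide power_mult_distrib power2_norm_eq_inner
    using assms by (simp add: inner_diff_left inner_diff_right inner_commute power2_eq_square field_simps)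
  then show ?thesis by (simp add: power2_eq_iff_nonneg)
qed

lemma D_region_norm:
  assumes "r > 1" "x \<in> D_region r"
  shows "1 < norm x" "norm x < r"
proof -
  obtain a b where x: "x = (a, b)" by (cases x)
  have *: "a\<^sup>2 + b\<^sup>2 - (r + 1) * b + r < 0"
    using assms(2) by (simp add: x D_region_def power2_eq_square field_simps)
  have N: "(norm x)\<^sup>2 = a\<^sup>2 + b\<^sup>2" by (simp add: x norm_Pair)
  have "(b - 1) * (b - r) < 0" 
  proof -
    have "(b - 1) * (b - r) = b\<^sup>2 - (r + 1) * b + r" by (simp add: power2_eq_square algebra_simps)
    then show ?thesis using * zero_le_power2[of a] by linarith
  qed
  then have b: "1 < b" "b < r" using assms(1) by (auto simp: mult_less_0_iff)
  have "b\<^sup>2 \<le> (norm x)\<^sup>2" using N by simp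
  then have "b \<le> norm x" by (rule power2_le_imp_le) simp
  then show "1 < norm x" using b by simp
  have "(norm x)\<^sup>2 < (r + 1) * b - r" using * N by simp
  also have "\<dots> < (r + 1) * r - r" using b assms(1) by (intro diff_strict_right_mono mult_strict_left_mono) auto
  finally have "(norm x)\<^sup>2 < r\<^sup>2" by (simp add: power2_eq_square algebra_simps)
  then show "norm x < r" by (rule power_less_imp_less_base) (use assms(1) in simp)
qed

lemma measure_ball_plane: "0 \<le> e \<Longrightarrow> measure lborel (ball (x :: real \<times> real) e) = pi * e\<^sup>2"
  by (simp add: content_ball unit_ball_vol_2 power2_eq_square)

text \<open>On the annulus \<open>1/2 \<le> |x| \<le> r + 1\<close>, a neighbourhood of the support, the
  inversion expands distances at most by the factor \<open>4\<close> and shrinks them at most by \<open>(r + 1)\<^sup>2\<close>. The first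
  bound keeps \<open>\<integral> \<gamma>\<^sub>t(\<Psi> x - \<Psi> y) dy\<close> away from zero for \<open>x\<close> in the support, because points \<open>y\<close> within
  \<open>t/2\<close> of \<open>x\<close> contribute a fixed amount. The second one dominates the kernel by a Gaussian in
  \<open>x - y\<close> of width \<open>(r + 1)\<^sup>2 t\<close>. Restricting the kernel to the annulus is essential: far out \<open>\<Psi> y\<close>
  tends to the origin, and the kernel would not be integrable in \<open>y\<close>.\<close>

theorem L2_le_inverted_energy:
  fixes f :: "real \<times> real \<Rightarrow> real"
  assumes r: "r > 1" and f: "integrable lborel f" and f2: "integrable lborel (\<lambda>x. (f x)\<^sup>2)"
    and supp: "\<And>x. x \<notin> D_region r \<Longrightarrow> f x = 0" and t: "0 < t" "t \<le> 1"
  shows "exp (-1/2) / 8 * (\<integral>x. (f x)\<^sup>2 \<partial>lborel)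
    \<le> (\<integral>(x, y). f x * f y * gauss t (inversion x - inversion y) \<partial>(lborel \<Otimes>\<^sub>M lborel))
      + (r + 1) ^ 4 * gauss_modulus ((r + 1)\<^sup>2 * t) f"
proof -
  have [measurable]: "f \<in> borel_measurable borel" using f by auto
  let ?P = "lborel \<Otimes>\<^sub>M lborel :: ((real \<times> real) \<times> (real \<times> real)) measure"
  define R where "R = (r + 1)\<^sup>2"
  have R: "R > 0" using r by (simp add: R_def)
  define \<Omega> :: "(real \<times> real) set" where "\<Omega> = {x. 1/2 \<le> norm x \<and> norm x \<le> r + 1}"
  have [measurable]: "\<Omega> \<in> sets borel" unfolding \<Omega>_def by measurable
  define k where "k x y = gauss t (inversion x - inversion y) * indicator \<Omega> x * indicator \<Omega> y" for x y
  have k_nonneg: "0 \<le> k x y" for x y by (simp add: k_def)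
  have k_sym: "k x y = k y x" for x y unfolding k_def gauss_minus_commute[of t "inversion x"] by simp
  have k_meas[measurable]: "case_prod k \<in> borel_measurable ?P" unfolding k_def by measurable
  have D_\<Omega>: "x \<in> \<Omega>" if "x \<in> D_region r" for x
    using D_region_norm[OF r that] by (simp add: \<Omega>_def)
  have "\<Omega> \<subseteq> cball 0 (r + 1)" by (auto simp: \<Omega>_def)
  then have "emeasure lborel \<Omega> \<le> emeasure lborel (cball 0 (r + 1) :: (real \<times> real) set)"
    by (intro emeasure_mono) auto
  also have "\<dots> < \<infinity>" using emeasure_lborel_cball_finite by simp
  finally have i\<Omega>: "integrable lborel (indicator \<Omega> :: _ \<Rightarrow> real)"
    by (intro integrable_real_indicator) auto
  have int: "integrable ?P (\<lambda>(x, y). (f x)\<^sup>2 * k x y)"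
  proof (rule Bochner_Integration.integrable_bound)
    show "integrable ?P (\<lambda>z. ((f (fst z))\<^sup>2 * (1 / (2 * pi * t\<^sup>2))) * indicator \<Omega> (snd z))"
      by (rule integrable_mult_pair[OF _ i\<Omega>]) (use f2 in simp)
    show "(\<lambda>(x, y). (f x)\<^sup>2 * k x y) \<in> borel_measurable ?P" by measurable
    have "norm (case z of (x, y) \<Rightarrow> (f x)\<^sup>2 * k x y)
      \<le> norm ((f (fst z))\<^sup>2 * (1 / (2 * pi * t\<^sup>2)) * indicator \<Omega> (snd z))" for z
      using gauss_le[of t "inversion (fst z) - inversion (snd z)"]
      using mult_left_mono[OF gauss_le, of "(f (fst z))\<^sup>2" t "inversion (fst z) - inversion (snd z)"]
      by (cases z) (auto simp: k_def abs_mult split: split_indicator)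
    then show "AE z in ?P. norm (case z of (x, y) \<Rightarrow> (f x)\<^sup>2 * k x y)
      \<le> norm ((f (fst z))\<^sup>2 * (1 / (2 * pi * t\<^sup>2)) * indicator \<Omega> (snd z))" by simp
  qed
  have ffk: "f x * f y * gauss t (inversion x - inversion y) = f x * f y * k x y" for x y
    using supp[of x] supp[of y] D_\<Omega>[of x] D_\<Omega>[of y] by (auto simp: k_def indicator_def)
  have "integrable lborel (\<lambda>x. (f x)\<^sup>2 * (\<integral>y. k x y \<partial>lborel))"
    using lborel_pair.integrable_fst'[OF int] by simp
  moreover have "exp (-1/2) / 8 * (f x)\<^sup>2 \<le> (f x)\<^sup>2 * (\<integral>y. k x y \<partial>lborel)" for x
  proof (cases "x \<in> D_region r")
    case True
    note nx = D_region_norm[OF r True]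
    \<comment> \<open>\<open>t \<le> 1\<close> keeps the ball of radius \<open>t/2\<close> inside the annulus\<close>
    have B\<Omega>: "y \<in> \<Omega>" if "y \<in> ball x (t/2)" for y
    proof -
      have "\<bar>norm x - norm y\<bar> \<le> norm (x - y)" by (rule norm_triangle_ineq3)
      also have "\<dots> < 1/2" using that t by (simp add: dist_norm)
      finally show ?thesis using nx unfolding \<Omega>_def mem_Collect_eq by (intro conjI; linarith)
    qed
    have low: "exp (-1/2) / (2 * pi * t\<^sup>2) * indicator (ball x (t/2)) y \<le> k x y" for y
    proof (cases "y \<in> ball x (t/2)")
      case yB: True
      have ny: "1/2 \<le> norm y" using B\<Omega>[OF yB] by (simp add: \<Omega>_def)
      have "1 * (1/2) \<le> norm x * norm y" using nx ny by (intro mult_mono) auto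
      then have "norm (x - y) / (norm x * norm y) \<le> norm (x - y) / (1/2)"
        by (intro divide_left_mono) auto
      then have "norm (inversion x - inversion y) \<le> norm (x - y) / (1/2)"
        using nx ny by (subst norm_inversion_diff) auto
      also have "\<dots> \<le> t" using yB by (simp add: dist_norm)
      finally have "(norm (inversion x - inversion y))\<^sup>2 \<le> t\<^sup>2" by (intro power_mono) auto
      then have "(norm (inversion x - inversion y))\<^sup>2 / (2 * t\<^sup>2) \<le> t\<^sup>2 / (2 * t\<^sup>2)"
        by (intro divide_right_mono) auto
      also have "\<dots> = 1/2" using t by simp
      finally have "(norm (inversion x - inversion y))\<^sup>2 / (2 * t\<^sup>2) \<le> 1/2" .
      then have "exp (-1/2) / (2 * pi * t\<^sup>2) \<le> gauss t (inversion x - inversion y)"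
        unfolding gauss_def by (intro divide_right_mono) auto
      then show ?thesis using yB B\<Omega>[OF yB] D_\<Omega>[OF True] by (simp add: k_def)
    qed (simp add: k_nonneg)
    have ik: "integrable lborel (\<lambda>y. k x y)"
    proof (rule Bochner_Integration.integrable_bound)
      show "integrable lborel (\<lambda>y. 1 / (2 * pi * t\<^sup>2) * indicator \<Omega> y :: real)" using i\<Omega> by simp
      show "(\<lambda>y. k x y) \<in> borel_measurable lborel" unfolding k_def by measurable
    qed (auto simp: k_def gauss_le split: split_indicator)
    have "exp (-1/2) / 8 = (\<integral>y. exp (-1/2) / (2 * pi * t\<^sup>2) * indicator (ball x (t/2)) y \<partial>lborel)"
      using t by (simp add: measure_ball_plane power_divide)
    also have "\<dots> \<le> (\<integral>y. k x y \<partial>lborel)"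
      by (intro integral_mono ik low integrable_mult_right integrable_real_indicator)
         (use emeasure_lborel_ball_finite[of x "t/2"] in auto)
    finally show ?thesis using mult_left_mono[of "exp (-1/2) / 8" "\<integral>y. k x y \<partial>lborel" "(f x)\<^sup>2"]
      by (simp add: mult.commute)
  qed (simp add: supp)
  ultimately have "(\<integral>x. exp (-1/2) / 8 * (f x)\<^sup>2 \<partial>lborel) \<le> (\<integral>x. (f x)\<^sup>2 * (\<integral>y. k x y \<partial>lborel) \<partial>lborel)"
    using f2 by (intro integral_mono) auto
  also have "\<dots> = (\<integral>(x, y). (f x)\<^sup>2 * k x y \<partial>?P)"
    using lborel_pair.integral_fst'[OF int] by simp
  finally have 1: "exp (-1/2) / 8 * (\<integral>x. (f x)\<^sup>2 \<partial>lborel) \<le> (\<integral>(x, y). (f x)\<^sup>2 * k x y \<partial>?P)"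
    by simp
  note sp = kernel_form_split[OF \<open>f \<in> borel_measurable borel\<close> k_meas k_sym k_nonneg int]
  have Rt: "R * t > 0" using R t by simp
  note gm = gauss_modulus_split(1)[OF \<open>f \<in> borel_measurable borel\<close> f2 Rt]
  have k_up: "k x y \<le> R\<^sup>2 * gauss (R * t) (x - y)" for x y
  proof (cases "x \<in> \<Omega> \<and> y \<in> \<Omega>")
    case True
    then have n: "1/2 \<le> norm x" "norm x \<le> r + 1" "1/2 \<le> norm y" "norm y \<le> r + 1" by (auto simp: \<Omega>_def)
    have "norm x * norm y \<le> R" unfolding R_def power2_eq_square using n r by (intro mult_mono) auto
    moreover have "0 < norm x * norm y" using n by (intro mult_pos_pos) auto
    ultimately have "norm (x - y) / R \<le> norm (inversion x - inversion y)"
      using n by (subst norm_inversion_diff) (auto intro!: divide_left_mono)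
    then have "(norm (x - y) / R)\<^sup>2 \<le> (norm (inversion x - inversion y))\<^sup>2"
      using R by (intro power_mono) auto
    then have "(norm (x - y))\<^sup>2 / (2 * (R * t)\<^sup>2) \<le> (norm (inversion x - inversion y))\<^sup>2 / (2 * t\<^sup>2)"
      using R t by (simp add: field_simps)
    then have "gauss t (inversion x - inversion y) \<le> R\<^sup>2 * gauss (R * t) (x - y)"
      using R t divide_right_mono[of "exp (-((norm (inversion x - inversion y))\<^sup>2 / (2 * t\<^sup>2)))"
          "exp (-((norm (x - y))\<^sup>2 / (2 * (R * t)\<^sup>2)))" "2 * pi * t\<^sup>2"]
      by (simp add: gauss_def power_mult_distrib mult.assoc)
    then show ?thesis using True by (simp add: k_def)
  qed (auto simp: k_def)
  have "(\<integral>(x, y). (f x - f y)\<^sup>2 * k x y \<partial>?P) \<le> (\<integral>z. R\<^sup>2 * (case z of (x, y) \<Rightarrow> (f x - f y)\<^sup>2 * gauss (R * t) (x - y)) \<partial>?P)"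
    using sp(1) gm mult_left_mono[OF k_up, of "(f x - f y)\<^sup>2" x y for x y]
    by (intro integral_mono) (auto simp: mult_ac)
  also have "\<dots> = R\<^sup>2 * (2 * gauss_modulus (R * t) f)" by (simp add: gauss_modulus_def)
  finally show ?thesis
    using 1 sp(2) unfolding ffk R_def by (simp add: power_mult[symmetric])
qed

section \<open>Plancherel's identity and the Sobolev norm\<close>

lemma cmod_fourier_power2:
  "(cmod (fourier f \<xi>))\<^sup>2 = (cmod (\<integral>x. f x * cis (- (\<xi> \<bullet> x)) \<partial>lborel))\<^sup>2 / (2 * pi)\<^sup>2"
proof -
  have "exp (- \<i> * complex_of_real (x \<bullet> \<xi>)) = cis (- (\<xi> \<bullet> x))" for x
    by (simp add: cis_conv_exp inner_commute)
  then show ?thesis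
    unfolding fourier_def norm_mult power_mult_distrib by (simp add: norm_divide power_divide)
qed

lemma borel_measurable_fourier:
  assumes "f \<in> borel_measurable borel"
  shows "fourier f \<in> borel_measurable borel"
proof -
  note [measurable] = assms
  show ?thesis unfolding fourier_def by measurable
qed

lemma gaussian_fourier_energy:
  assumes f: "integrable lborel f" and f2: "integrable lborel (\<lambda>x. (f x)\<^sup>2)" and s: "s > 0"
  shows "integrable lborel (\<lambda>\<xi>. exp (-(s\<^sup>2 * (norm \<xi>)\<^sup>2 / 2)) * (cmod (fourier f \<xi>))\<^sup>2)"
    and "(\<integral>\<xi>. exp (-(s\<^sup>2 * (norm \<xi>)\<^sup>2 / 2)) * (cmod (fourier f \<xi>))\<^sup>2 \<partial>lborel)
      = (\<integral>x. (f x)\<^sup>2 \<partial>lborel) - gauss_modulus s f"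
proof -
  have id: "(\<lambda>x::real \<times> real. x) \<in> borel_measurable borel" by simp
  have [measurable]: "f \<in> borel_measurable borel" using f by auto
  note E = gaussian_energy[OF f id s]
  show "integrable lborel (\<lambda>\<xi>. exp (-(s\<^sup>2 * (norm \<xi>)\<^sup>2 / 2)) * (cmod (fourier f \<xi>))\<^sup>2)"
    unfolding cmod_fourier_power2 using E(1) by simp
  have "(\<integral>\<xi>. exp (-(s\<^sup>2 * (norm \<xi>)\<^sup>2 / 2)) * (cmod (fourier f \<xi>))\<^sup>2 \<partial>lborel)
      = (\<integral>\<xi>. exp (-(s\<^sup>2 * (norm \<xi>)\<^sup>2 / 2)) * (cmod (\<integral>x. f x * cis (- (\<xi> \<bullet> x)) \<partial>lborel))\<^sup>2 \<partial>lborel) / (2 * pi)\<^sup>2"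
    unfolding cmod_fourier_power2 times_divide_eq_right by (rule integral_divide_zero)
  also have "\<dots> = (\<integral>(x, y). f x * f y * gauss s (x - y) \<partial>(lborel \<Otimes>\<^sub>M lborel))"
    unfolding E(2) by (simp add: split_beta')
  also have "\<dots> = (\<integral>x. (f x)\<^sup>2 \<partial>lborel) - gauss_modulus s f"
    by (rule gauss_modulus_split(2)[OF _ f2 s]) simp
  finally show "(\<integral>\<xi>. exp (-(s\<^sup>2 * (norm \<xi>)\<^sup>2 / 2)) * (cmod (fourier f \<xi>))\<^sup>2 \<partial>lborel)
      = (\<integral>x. (f x)\<^sup>2 \<partial>lborel) - gauss_modulus s f" .
qed

lemma gauss_modulus_nonneg: "0 \<le> gauss_modulus s f"
  unfolding gauss_modulus_def by (intro divide_nonneg_nonneg Bochner_Integration.integral_nonneg) auto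

text \<open>With \<open>u = |z|\<^sup>2 / (4 s\<^sup>2)\<close> this is \<open>u exp (- 2u) \<le> exp (- u)\<close>: the quadratic
  factor is absorbed by widening the Gaussian.\<close>

lemma norm_power2_mult_gauss_le:
  assumes "s > 0"
  shows "(norm z)\<^sup>2 * gauss s z \<le> 8 * s\<^sup>2 * gauss (sqrt 2 * s) z"
proof -
  define u where "u = (norm z)\<^sup>2 / (4 * s\<^sup>2)"
  have z: "(norm z)\<^sup>2 = 4 * s\<^sup>2 * u" using assms by (simp add: u_def)
  have "u \<le> exp u" using exp_ge_add_one_self[of u] by linarith
  then have "u * exp (- (2 * u)) \<le> exp u * exp (- (2 * u))" by (rule mult_right_mono) simp
  also have "\<dots> = exp (- u)" by (simp add: exp_add[symmetric])
  finally have "u * exp (- (2 * u)) \<le> exp (- u)" .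
  then have "4 * s\<^sup>2 * (u * exp (- (2 * u))) / (2 * pi * s\<^sup>2) \<le> 4 * s\<^sup>2 * exp (- u) / (2 * pi * s\<^sup>2)"
    by (intro divide_right_mono mult_left_mono) auto
  moreover have "(norm z)\<^sup>2 / (2 * s\<^sup>2) = 2 * u" "(norm z)\<^sup>2 / (2 * (sqrt 2 * s)\<^sup>2) = u"
    using assms by (simp_all add: u_def power_mult_distrib)
  ultimately show ?thesis
    using assms unfolding gauss_def by (simp add: z power_mult_distrib mult_ac)
qed

text \<open>Differences vanish unless one of the two points lies in \<open>S\<close>, and then
  they are at most \<open>L |x - y|\<close>, whose mean square under the Gaussian is of order \<open>s\<^sup>2\<close>.\<close>

lemma gauss_modulus_lipschitz:
  assumes [measurable]: "f \<in> borel_measurable borel" and f2: "integrable lborel (\<lambda>x. (f x)\<^sup>2)" and s: "s > 0"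
    and lip: "\<And>x y. \<bar>f x - f y\<bar> \<le> L * norm (x - y)"
    and S[measurable]: "S \<in> sets borel" and S_fin: "emeasure lborel S < \<infinity>"
    and supp: "\<And>x. x \<notin> S \<Longrightarrow> f x = 0"
  shows "gauss_modulus s f \<le> 8 * L\<^sup>2 * measure lborel S * s\<^sup>2"
proof -
  let ?P = "lborel \<Otimes>\<^sub>M lborel :: ((real \<times> real) \<times> (real \<times> real)) measure"
  let ?g = "gauss (sqrt 2 * s)"
  have s2: "sqrt 2 * s > 0" using s by simp
  have iS: "integrable lborel (indicator S :: _ \<Rightarrow> real)" using S_fin by simp
  note g1 = gauss_pair_integral[OF iS s2]
  have g2: "integrable ?P (\<lambda>(x, y). indicator S y * ?g (x - y))"
    using lborel_pair.integrable_product_swap[OF g1(1)] by (simp add: gauss_minus_commute[of _ "snd _"] split_beta')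
  have g2': "(\<integral>(x, y). indicator S y * ?g (x - y) \<partial>?P) = measure lborel S"
  proof -
    have "(\<integral>(x, y). indicator S y * ?g (y - x) \<partial>?P) = (\<integral>(x, y). indicator S x * ?g (x - y) \<partial>?P)"
      using lborel_pair.integral_product_swap[OF borel_measurable_integrable[OF g1(1)]] by simp
    then show ?thesis using g1(2) unfolding gauss_minus_commute[of _ "snd _" "fst _"] by (simp add: gauss_minus_commute)
  qed
  have "(f x - f y)\<^sup>2 * gauss s (x - y) \<le> 8 * L\<^sup>2 * s\<^sup>2 * (indicator S x * ?g (x - y) + indicator S y * ?g (x - y))" for x y
  proof (cases "x \<in> S \<or> y \<in> S")
    case True
    have "(f x - f y)\<^sup>2 \<le> (L * norm (x - y))\<^sup>2"
      using lip[of x y] by (metis abs_ge_zero power2_abs power_mono)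
    then have "(f x - f y)\<^sup>2 * gauss s (x - y) \<le> L\<^sup>2 * ((norm (x - y))\<^sup>2 * gauss s (x - y))"
      by (simp add: power_mult_distrib mult_right_mono flip: mult.assoc)
    also have "\<dots> \<le> L\<^sup>2 * (8 * s\<^sup>2 * ?g (x - y))"
      by (intro mult_left_mono norm_power2_mult_gauss_le s) auto
    also have "\<dots> = 8 * L\<^sup>2 * s\<^sup>2 * (1 * ?g (x - y))" by simp
    also have "\<dots> \<le> 8 * L\<^sup>2 * s\<^sup>2 * ((indicator S x + indicator S y) * ?g (x - y))"
      using True by (intro mult_left_mono mult_right_mono) (auto split: split_indicator)
    finally show ?thesis by (simp add: distrib_right)
  qed (simp add: supp)
  then have "(\<integral>(x, y). (f x - f y)\<^sup>2 * gauss s (x - y) \<partial>?P)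
      \<le> (\<integral>z. 8 * L\<^sup>2 * s\<^sup>2 * ((case z of (x, y) \<Rightarrow> indicator S x * ?g (x - y)) + (case z of (x, y) \<Rightarrow> indicator S y * ?g (x - y))) \<partial>?P)"
    using g1(1) g2 by (intro integral_mono gauss_modulus_split(1)[OF _ f2 s]) auto
  also have "\<dots> = 8 * L\<^sup>2 * s\<^sup>2 * (measure lborel S + measure lborel S)"
    using g1 g2 g2' by simp
  finally show ?thesis by (simp add: gauss_modulus_def algebra_simps)
qed

text \<open>The Gaussian-damped energy of the Fourier transform is
  \<open>\<parallel>f\<parallel>\<^sup>2\<close> minus the modulus, so a modulus tending to zero gives Plancherel's identity by monotone
  convergence as the damping disappears. Once it is available, the modulus is the energy with weight
  \<open>1 - exp (- s\<^sup>2 |\<xi>|\<^sup>2 / 2)\<close>; where \<open>s\<^sup>2 |\<xi>|\<^sup>2 \<le> 2\<close> this weight is at least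
  \<open>s\<^sup>2 |\<xi>|\<^sup>2 / 4\<close>, so the decay rate \<open>s\<^sup>2\<close> also bounds the second moment of the energy.\<close>

theorem plancherel_of_small_modulus:
  assumes f: "integrable lborel f" and f2: "integrable lborel (\<lambda>x. (f x)\<^sup>2)"
    and mod: "\<And>s. s > 0 \<Longrightarrow> gauss_modulus s f \<le> C * s\<^sup>2"
  shows "integrable lborel (\<lambda>\<xi>. (cmod (fourier f \<xi>))\<^sup>2)"
    and "(\<integral>\<xi>. (cmod (fourier f \<xi>))\<^sup>2 \<partial>lborel) = (\<integral>x. (f x)\<^sup>2 \<partial>lborel)"
    and "integrable lborel (\<lambda>\<xi>. (norm \<xi>)\<^sup>2 * (cmod (fourier f \<xi>))\<^sup>2)"
proof -
  have [measurable]: "f \<in> borel_measurable borel" using f by auto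
  have [measurable]: "fourier f \<in> borel_measurable borel" by (rule borel_measurable_fourier) simp
  let ?a = "\<lambda>\<xi>. (cmod (fourier f \<xi>))\<^sup>2"
  define s where "s n = 1 / real (Suc n)" for n
  have s: "s n > 0" for n by (simp add: s_def)
  have s_mono: "s n \<le> s m" if "m \<le> n" for m n using that by (simp add: s_def field_simps)
  have s0: "s \<longlonglongrightarrow> 0" unfolding s_def by (rule LIMSEQ_Suc[OF lim_1_over_n])
  have s2: "(\<lambda>n. C * (s n)\<^sup>2) \<longlonglongrightarrow> 0"
    using tendsto_mult_left[OF tendsto_power[OF s0, of 2], of C] by simp
  note E = gaussian_fourier_energy[OF f f2 s]
  have m0: "(\<lambda>n. gauss_modulus (s n) f) \<longlonglongrightarrow> 0"
    by (rule tendsto_sandwich[OF _ _ tendsto_const s2]) (auto simp: gauss_modulus_nonneg mod s)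
  have lim: "(\<lambda>n. \<integral>\<xi>. exp (-((s n)\<^sup>2 * (norm \<xi>)\<^sup>2 / 2)) * ?a \<xi> \<partial>lborel) \<longlonglongrightarrow> (\<integral>x. (f x)\<^sup>2 \<partial>lborel)"
    unfolding E(2) using tendsto_diff[OF tendsto_const m0] by simp
  have mono: "AE \<xi> in lborel. mono (\<lambda>n. exp (-((s n)\<^sup>2 * (norm \<xi>)\<^sup>2 / 2)) * ?a \<xi>)"
    using s s_mono less_imp_le[OF s] by (intro AE_I2 monoI mult_right_mono) (auto intro!: mult_right_mono power_mono)
  have conv: "AE \<xi> in lborel. (\<lambda>n. exp (-((s n)\<^sup>2 * (norm \<xi>)\<^sup>2 / 2)) * ?a \<xi>) \<longlonglongrightarrow> ?a \<xi>"
  proof (rule AE_I2)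
    fix \<xi> :: "real \<times> real"
    have "(\<lambda>n. exp (-((s n)\<^sup>2 * (norm \<xi>)\<^sup>2 / 2)) * ?a \<xi>) \<longlonglongrightarrow> exp (-(0\<^sup>2 * (norm \<xi>)\<^sup>2 / 2)) * ?a \<xi>"
      by (intro tendsto_intros s0) auto
    then show "(\<lambda>n. exp (-((s n)\<^sup>2 * (norm \<xi>)\<^sup>2 / 2)) * ?a \<xi>) \<longlonglongrightarrow> ?a \<xi>" by simp
  qed
  note MC = E(1) mono conv lim
  show ia: "integrable lborel ?a"
    by (rule integrable_monotone_convergence[OF MC]) simp
  show eq: "(\<integral>\<xi>. ?a \<xi> \<partial>lborel) = (\<integral>x. (f x)\<^sup>2 \<partial>lborel)"
    by (rule integral_monotone_convergence[OF MC]) simp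
  let ?u = "\<lambda>n \<xi>. (norm \<xi>)\<^sup>2 * ?a \<xi> * indicator {\<xi>. (s n)\<^sup>2 * (norm \<xi>)\<^sup>2 \<le> 2} \<xi>"
  have bound: "(\<integral>\<^sup>+\<xi>. ?u n \<xi> \<partial>lborel) \<le> ennreal (4 * C)" for n
  proof -
    have "?u n \<xi> \<le> 4 / (s n)\<^sup>2 * ((1 - exp (-((s n)\<^sup>2 * (norm \<xi>)\<^sup>2 / 2))) * ?a \<xi>)" for \<xi>
    proof (cases "(s n)\<^sup>2 * (norm \<xi>)\<^sup>2 \<le> 2")
      case True
      define u where "u = (s n)\<^sup>2 * (norm \<xi>)\<^sup>2 / 2"
      have u: "0 \<le> u" "u \<le> 1" using True by (auto simp: u_def)
      have "exp (- u) \<le> 1 / (1 + u)"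
        using exp_ge_add_one_self[of u] u by (simp add: exp_minus divide_simps)
      also have "\<dots> \<le> 1 - u / 2" using u mult_left_mono[of u 1 u] by (simp add: field_simps)
      finally have "u / 2 \<le> 1 - exp (- u)" by simp
      then have "4 / (s n)\<^sup>2 * (u / 2 * ?a \<xi>) \<le> 4 / (s n)\<^sup>2 * ((1 - exp (- u)) * ?a \<xi>)"
        by (intro mult_left_mono mult_right_mono) auto
      moreover have "4 / (s n)\<^sup>2 * (u / 2 * ?a \<xi>) = (norm \<xi>)\<^sup>2 * ?a \<xi>"
        using s[of n] by (simp add: u_def)
      ultimately show ?thesis using True by (simp add: u_def)
    qed simp
    then have "(\<integral>\<^sup>+\<xi>. ?u n \<xi> \<partial>lborel) \<le> (\<integral>\<^sup>+\<xi>. 4 / (s n)\<^sup>2 * ((1 - exp (-((s n)\<^sup>2 * (norm \<xi>)\<^sup>2 / 2))) * ?a \<xi>) \<partial>lborel)"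
      by (intro nn_integral_mono ennreal_leI)
    also have "\<dots> = ennreal (\<integral>\<xi>. 4 / (s n)\<^sup>2 * (?a \<xi> - exp (-((s n)\<^sup>2 * (norm \<xi>)\<^sup>2 / 2)) * ?a \<xi>) \<partial>lborel)"
    proof -
      have "0 \<le> 4 / (s n)\<^sup>2 * ((1 - exp (-((s n)\<^sup>2 * (norm \<xi>)\<^sup>2 / 2))) * ?a \<xi>)" for \<xi> :: "real \<times> real"
        by (intro mult_nonneg_nonneg) auto
      then show ?thesis
        unfolding left_diff_distrib mult_1
        by (intro nn_integral_eq_integral AE_I2) (use ia E(1)[of n] in auto)
    qed
    also have "(\<integral>\<xi>. 4 / (s n)\<^sup>2 * (?a \<xi> - exp (-((s n)\<^sup>2 * (norm \<xi>)\<^sup>2 / 2)) * ?a \<xi>) \<partial>lborel) = 4 / (s n)\<^sup>2 * gauss_modulus (s n) f"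
      using ia E[of n] eq by simp
    also have "\<dots> \<le> 4 / (s n)\<^sup>2 * (C * (s n)\<^sup>2)" by (intro mult_left_mono mod s) auto
    also have "\<dots> = 4 * C" using s[of n] by simp
    finally show ?thesis by (simp add: ennreal_leI)
  qed
  have "(\<integral>\<^sup>+\<xi>. (norm \<xi>)\<^sup>2 * ?a \<xi> \<partial>lborel) = (\<integral>\<^sup>+\<xi>. (SUP n. ennreal (?u n \<xi>)) \<partial>lborel)"
  proof (rule nn_integral_cong, rule SUP_attained[symmetric])
    fix \<xi> :: "real \<times> real"
    have "(\<lambda>n. (s n)\<^sup>2 * (norm \<xi>)\<^sup>2) \<longlonglongrightarrow> 0\<^sup>2 * (norm \<xi>)\<^sup>2" by (intro tendsto_intros s0)
    then have "eventually (\<lambda>n. (s n)\<^sup>2 * (norm \<xi>)\<^sup>2 < 2) sequentially" by (rule order_tendstoD) simp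
    then obtain n where "(s n)\<^sup>2 * (norm \<xi>)\<^sup>2 < 2" by (auto simp: eventually_sequentially)
    then show "ennreal (?u (SOME n. (s n)\<^sup>2 * (norm \<xi>)\<^sup>2 < 2) \<xi>) = ennreal ((norm \<xi>)\<^sup>2 * ?a \<xi>)"
      using someI[of "\<lambda>n. (s n)\<^sup>2 * (norm \<xi>)\<^sup>2 < 2" n] by simp
  qed (auto intro!: ennreal_leI split: split_indicator)
  also have "\<dots> = (SUP n. \<integral>\<^sup>+\<xi>. ?u n \<xi> \<partial>lborel)"
  proof (rule nn_integral_monotone_convergence_SUP)
    have "(s n)\<^sup>2 * q \<le> 2" if "m \<le> n" "(s m)\<^sup>2 * q \<le> 2" "q \<ge> 0" for m n q
      using that s_mono[of m n] less_imp_le[OF s[of n]] by (meson mult_right_mono order_trans power_mono)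
    then show "incseq (\<lambda>n \<xi>. ennreal (?u n \<xi>))"
      unfolding incseq_def le_fun_def by (auto intro!: ennreal_leI split: split_indicator)
  qed measurable
  also have "\<dots> \<le> ennreal (4 * C)" by (rule SUP_least) (rule bound)
  finally show "integrable lborel (\<lambda>\<xi>. (norm \<xi>)\<^sup>2 * (cmod (fourier f \<xi>))\<^sup>2)"
    by (intro integrableI_nonneg) (auto simp: le_less_trans)
qed

text \<open>The first claim makes the other two meaningful: the Bochner integral inside
  \<open>sobolev_norm\<close> would be \<open>0\<close> for a non-integrable integrand. It follows from
  \<open>(1 + |\<xi>|\<^sup>2)\<^sup>\<beta> \<le> 1 + |\<xi>|\<^sup>2\<close>. The last claim rests on \<open>1 - exp (- u/2) \<le> min 1 u \<le> u\<^sup>\<beta>\<close> with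
  \<open>u = s\<^sup>2 |\<xi>|\<^sup>2\<close>.\<close>

theorem sobolev_bounds:
  assumes f: "integrable lborel f" and f2: "integrable lborel (\<lambda>x. (f x)\<^sup>2)"
    and mod: "\<And>s. s > 0 \<Longrightarrow> gauss_modulus s f \<le> C * s\<^sup>2"
    and \<beta>: "0 < \<beta>" "\<beta> < 1"
  shows "integrable lborel (\<lambda>\<xi>. (1 + (norm \<xi>)\<^sup>2) powr \<beta> * (cmod (fourier f \<xi>))\<^sup>2)"
    and "(\<integral>x. (f x)\<^sup>2 \<partial>lborel) \<le> (sobolev_norm \<beta> f)\<^sup>2"
    and "\<And>s. s > 0 \<Longrightarrow> gauss_modulus s f \<le> s powr (2 * \<beta>) * (sobolev_norm \<beta> f)\<^sup>2"
proof -
  have [measurable]: "f \<in> borel_measurable borel" using f by auto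
  have [measurable]: "fourier f \<in> borel_measurable borel" by (rule borel_measurable_fourier) simp
  let ?a = "\<lambda>\<xi>. (cmod (fourier f \<xi>))\<^sup>2"
  let ?w = "\<lambda>\<xi>::real \<times> real. (1 + (norm \<xi>)\<^sup>2) powr \<beta>"
  note P = plancherel_of_small_modulus[OF f f2 mod]
  show iw: "integrable lborel (\<lambda>\<xi>. ?w \<xi> * ?a \<xi>)"
  proof (rule Bochner_Integration.integrable_bound[OF Bochner_Integration.integrable_add[OF P(1,3)]])
    have "?w \<xi> \<le> 1 + (norm \<xi>)\<^sup>2" for \<xi>
      using powr_mono[of \<beta> 1 "1 + (norm \<xi>)\<^sup>2"] \<beta> by simp
    from mult_right_mono[OF this, of "?a _"]
    show "AE \<xi> in lborel. norm (?w \<xi> * ?a \<xi>) \<le> norm (?a \<xi> + (norm \<xi>)\<^sup>2 * ?a \<xi>)"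
      by (auto simp: distrib_right)
  qed measurable
  have sob: "(sobolev_norm \<beta> f)\<^sup>2 = (\<integral>\<xi>. ?w \<xi> * ?a \<xi> \<partial>lborel)"
    unfolding sobolev_norm_def by (rule real_sqrt_pow2) (auto intro!: Bochner_Integration.integral_nonneg)
  have "?a \<xi> \<le> ?w \<xi> * ?a \<xi>" for \<xi>
    using mult_right_mono[of 1 "?w \<xi>" "?a \<xi>"] ge_one_powr_ge_zero[of "1 + (norm \<xi>)\<^sup>2" \<beta>] \<beta> by simp
  then have "(\<integral>\<xi>. ?a \<xi> \<partial>lborel) \<le> (\<integral>\<xi>. ?w \<xi> * ?a \<xi> \<partial>lborel)"
    by (intro integral_mono iw P(1))
  then show "(\<integral>x. (f x)\<^sup>2 \<partial>lborel) \<le> (sobolev_norm \<beta> f)\<^sup>2"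
    using P(2) by (simp add: sob)
  fix s :: real assume s: "s > 0"
  note E = gaussian_fourier_energy[OF f f2 s]
  have w: "1 - exp (-(s\<^sup>2 * (norm \<xi>)\<^sup>2 / 2)) \<le> s powr (2 * \<beta>) * ?w \<xi>" for \<xi>
  proof -
    define u where "u = s\<^sup>2 * (norm \<xi>)\<^sup>2"
    have u: "0 \<le> u" by (simp add: u_def)
    have "1 - exp (-(u / 2)) \<le> u powr \<beta>"
    proof (cases "u \<le> 1")
      case True
      have "1 - exp (-(u / 2)) \<le> u / 2" using exp_ge_add_one_self[of "-(u / 2)"] by linarith
      also have "\<dots> \<le> u powr 1" using u by simp
      also have "\<dots> \<le> u powr \<beta>" using powr_mono'[of \<beta> 1 u] u True \<beta> by simp
      finally show ?thesis .
    next
      case False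
      then have "1 \<le> u powr \<beta>" using \<beta> by (intro ge_one_powr_ge_zero) auto
      moreover have "exp (-(u / 2)) > 0" by simp
      ultimately show ?thesis by linarith
    qed
    also have "u powr \<beta> \<le> (s\<^sup>2 * (1 + (norm \<xi>)\<^sup>2)) powr \<beta>"
      using \<beta> u unfolding u_def by (intro powr_mono2 mult_left_mono) auto
    also have "\<dots> = s powr (2 * \<beta>) * ?w \<xi>"
      using s by (simp add: powr_mult powr_powr flip: powr_numeral)
    finally show ?thesis by (simp add: u_def)
  qed
  have "gauss_modulus s f = (\<integral>\<xi>. ?a \<xi> - exp (-(s\<^sup>2 * (norm \<xi>)\<^sup>2 / 2)) * ?a \<xi> \<partial>lborel)"
    using P E by simp
  also have "\<dots> \<le> (\<integral>\<xi>. s powr (2 * \<beta>) * (?w \<xi> * ?a \<xi>) \<partial>lborel)"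
    using mult_right_mono[OF w, of "?a _"] P(1) E(1) iw by (intro integral_mono) (auto simp: left_diff_distrib mult.assoc)
  finally show "gauss_modulus s f \<le> s powr (2 * \<beta>) * (sobolev_norm \<beta> f)\<^sup>2"
    by (simp add: sob)
qed

text \<open>Each directional derivative is continuous and vanishes off a compact set,
  hence is bounded; finitely many basis directions control the derivative as a linear map.\<close>

lemma C0_infinity_lipschitz:
  fixes f :: "'a::euclidean_space \<Rightarrow> real"
  assumes f: "f \<in> C0_infinity \<Omega>"
  obtains L where "\<And>x y. \<bar>f x - f y\<bar> \<le> L * norm (x - y)"
proof -
  define D where "D x = frechet_derivative f (at x)" for x
  define K where "K = closure {x. f x \<noteq> 0}"
  have K: "compact K" using f by (simp add: C0_infinity_def K_def)
  have "Ck (Suc 0) f" using f unfolding C0_infinity_def smooth_def by blast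
  then have der: "(f has_derivative D x) (at x)" and cont: "continuous_on UNIV (\<lambda>x. D x v)" for x v
    by (auto simp: D_def frechet_derivative_works)
  have D_zero: "D x v = 0" if "x \<notin> K" for x v
  proof -
    have "(f has_derivative (\<lambda>_. 0)) (at x)"
    proof (rule has_derivative_transform_within_open[where f = "\<lambda>_. 0" and s = "- K"])
      show "0 = f y" if "y \<in> - K" for y
        using that closure_subset[of "{x. f x \<noteq> 0}"] by (auto simp: K_def)
    qed (use that in \<open>auto simp: K_def\<close>)
    from has_derivative_unique[OF this der] show ?thesis by (metis)
  qed
  have "\<exists>B. \<forall>x. \<bar>D x v\<bar> \<le> B" for v
  proof -
    have "bounded ((\<lambda>x. D x v) ` K)"
      by (intro compact_imp_bounded compact_continuous_image K continuous_on_subset[OF cont]) auto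
    then obtain B where "\<forall>x\<in>K. \<bar>D x v\<bar> \<le> B" by (auto simp: bounded_iff)
    then have "\<bar>D x v\<bar> \<le> max B 0" for x by (cases "x \<in> K") (auto simp: D_zero le_max_iff_disj)
    then show ?thesis by blast
  qed
  then obtain B where B: "\<And>v x. \<bar>D x v\<bar> \<le> B v" by metis
  have "onorm (D x) \<le> (\<Sum>b\<in>Basis. B b)" for x
  proof (rule onorm_le)
    fix v
    have lin: "linear (D x)" using der by (rule has_derivative_linear)
    have "D x v = D x (\<Sum>b\<in>Basis. (v \<bullet> b) *\<^sub>R b)" by (simp add: euclidean_representation)
    also have "\<dots> = (\<Sum>b\<in>Basis. (v \<bullet> b) * D x b)"
      by (simp add: linear_sum[OF lin] linear_cmul[OF lin])
    finally have "norm (D x v) \<le> (\<Sum>b\<in>Basis. \<bar>v \<bullet> b\<bar> * \<bar>D x b\<bar>)"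
      by (simp add: sum_abs[THEN order_trans] abs_mult[symmetric])
    also have "\<dots> \<le> (\<Sum>b\<in>Basis. norm v * B b)"
      by (intro sum_mono mult_mono Basis_le_norm B) auto
    finally show "norm (D x v) \<le> (\<Sum>b\<in>Basis. B b) * norm v"
      by (subst sum_distrib_right) (simp add: mult.commute)
  qed
  then have "norm (f x - f y) \<le> (\<Sum>b\<in>Basis. B b) * norm (x - y)" for x y
    using der by (intro differentiable_bound[of UNIV f D]) (auto intro: has_derivative_at_withinI)
  then show thesis by (intro that) simp
qed

section \<open>One-dimensional Fourier analysis on a ray\<close>

text \<open>Polarisation again: the form of a normal density, which has mass one,
  is at most \<open>\<parallel>K\<parallel>\<^sup>2\<close> since the squared differences enter with a negative sign.\<close>

lemma gaussian_bessel_inequality: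
  fixes K :: "real \<Rightarrow> real"
  assumes K: "integrable lborel K" and K2: "integrable lborel (\<lambda>p. (K p)\<^sup>2)" and \<tau>: "\<tau> > 0"
  shows "integrable lborel (\<lambda>\<sigma>. exp (-(\<tau>\<^sup>2 * \<sigma>\<^sup>2 / 2)) * (cmod (\<integral>p. K p * cis (- (\<sigma> * p)) \<partial>lborel))\<^sup>2)"
    and "(\<integral>\<sigma>. exp (-(\<tau>\<^sup>2 * \<sigma>\<^sup>2 / 2)) * (cmod (\<integral>p. K p * cis (- (\<sigma> * p)) \<partial>lborel))\<^sup>2 \<partial>lborel)
      \<le> 2 * pi * (\<integral>p. (K p)\<^sup>2 \<partial>lborel)"
proof -
  have [measurable]: "K \<in> borel_measurable borel" using K by auto
  have id: "(\<lambda>p::real. p) \<in> borel_measurable borel" by simp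
  note E = weighted_fourier_energy[OF K id gaussian_fourier_line(1)[OF \<tau>], unfolded inner_real_def]
  show "integrable lborel (\<lambda>\<sigma>. exp (-(\<tau>\<^sup>2 * \<sigma>\<^sup>2 / 2)) * (cmod (\<integral>p. K p * cis (- (\<sigma> * p)) \<partial>lborel))\<^sup>2)"
    by (rule E(1))
  let ?P = "lborel \<Otimes>\<^sub>M lborel :: (real \<times> real) measure"
  let ?k = "\<lambda>x y. normal_density x \<tau> y"
  have k_sym: "?k x y = ?k y x" for x y
    by (simp add: normal_density_def power2_commute)
  have k_meas[measurable]: "case_prod ?k \<in> borel_measurable ?P"
    unfolding normal_density_def by measurable
  have int: "integrable ?P (\<lambda>(x, y). (K x)\<^sup>2 * ?k x y)"
  proof (rule lborel_pair.Fubini_integrable)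
    show "(\<lambda>(x, y). (K x)\<^sup>2 * ?k x y) \<in> borel_measurable ?P" by measurable
  qed (use K2 \<tau> in \<open>auto simp: abs_mult\<close>)
  note sp = kernel_form_split[OF \<open>K \<in> borel_measurable borel\<close> k_meas k_sym normal_density_nonneg int]
  have k: "sqrt (2 * pi) / \<tau> * exp (-((x - y)\<^sup>2 / (2 * \<tau>\<^sup>2))) = 2 * pi * ?k x y" for x y
    using \<tau> by (simp add: normal_density_def power2_commute real_sqrt_mult field_simps)
  have "K x * K y * (2 * pi * ?k x y) = 2 * pi * (K x * K y * ?k x y)" for x y by simp
  then have "(\<integral>\<sigma>. exp (-(\<tau>\<^sup>2 * \<sigma>\<^sup>2 / 2)) * (cmod (\<integral>p. K p * cis (- (\<sigma> * p)) \<partial>lborel))\<^sup>2 \<partial>lborel)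
     = 2 * pi * (\<integral>(x, y). K x * K y * ?k x y \<partial>?P)"
    unfolding E(2) gaussian_fourier_line(2)[OF \<tau>] k by (simp only: integral_mult_right_zero split_beta')
  also have "(\<integral>(x, y). K x * K y * ?k x y \<partial>?P) \<le> (\<integral>(x, y). (K x)\<^sup>2 * ?k x y \<partial>?P)"
  proof -
    have "0 \<le> (\<integral>(x, y). (K x - K y)\<^sup>2 * ?k x y \<partial>?P)"
      by (rule Bochner_Integration.integral_nonneg) auto
    then show ?thesis using sp(2) by linarith
  qed
  also have "(\<integral>(x, y). (K x)\<^sup>2 * ?k x y \<partial>?P) = (\<integral>x. (K x)\<^sup>2 \<partial>lborel)"
    using lborel_pair.integral_fst'[OF int] \<tau> by simp
  finally show "(\<integral>\<sigma>. exp (-(\<tau>\<^sup>2 * \<sigma>\<^sup>2 / 2)) * (cmod (\<integral>p. K p * cis (- (\<sigma> * p)) \<partial>lborel))\<^sup>2 \<partial>lborel)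
      \<le> 2 * pi * (\<integral>p. (K p)\<^sup>2 \<partial>lborel)" by simp
qed

text \<open>The half line is open for \<open>p \<ge> 0\<close> and closed for \<open>p < 0\<close>. In both cases either it
  or its complement is an open half line pointing away from \<open>0\<close>, as the disc transform measures them,
  so the masses on the boundary circles never enter.\<close>

definition beyond :: "real \<Rightarrow> real \<Rightarrow> bool" where
  "beyond p s \<longleftrightarrow> (if 0 \<le> p then p < s else p \<le> s)"

definition upper_mass :: "('a::euclidean_space \<Rightarrow> real) \<Rightarrow> ('a \<Rightarrow> real) \<Rightarrow> real \<Rightarrow> real" where
  "upper_mass f s p = (\<integral>x. f x * of_bool (beyond p (s x)) \<partial>lborel)"

text \<open>Up to an endpoint the points \<open>p\<close> of \<open>[-1, 1]\<close> with \<open>beyond p s\<close> form the interval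
  \<open>[-1, s]\<close>, where the fundamental theorem of calculus applies.\<close>

lemma integral_cis_beyond:
  fixes \<sigma> s :: real
  assumes s: "-1 \<le> s" "s \<le> 1"
  shows "\<i> * \<sigma> * (\<integral>p. complex_of_real (indicator {-1..1} p * of_bool (beyond p s)) * cis (- (\<sigma> * p)) \<partial>lborel) = cis \<sigma> - cis (- (\<sigma> * s))"
proof -
  have "has_bochner_integral lborel (\<lambda>p. indicator {-1..s} p *\<^sub>R (- \<i> * \<sigma> * cis (- (\<sigma> * p)))) (cis (- (\<sigma> * s)) - cis (- (\<sigma> * (-1))))"
  proof (rule has_bochner_integral_FTC_Icc[OF s(1)])
    show "((\<lambda>p. cis (- (\<sigma> * p))) has_vector_derivative - \<i> * \<sigma> * cis (- (\<sigma> * x))) (at x within {- 1..s})" for x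
    proof -
      have "((\<lambda>z. exp (- \<i> * \<sigma> * z)) has_field_derivative - \<i> * \<sigma> * exp (- \<i> * \<sigma> * x)) (at (complex_of_real x))"
        by (auto intro!: derivative_eq_intros)
      from has_vector_derivative_real_field[OF this] show ?thesis
        by (simp add: mult.assoc cis_conv_exp)
    qed
    show "continuous_on {- 1..s} (\<lambda>p. - \<i> * \<sigma> * cis (- (\<sigma> * p)))"
      by (intro continuous_intros)
  qed
  then have "(\<integral>p. indicator {-1..s} p *\<^sub>R (- \<i> * \<sigma> * cis (- (\<sigma> * p))) \<partial>lborel) = cis (- (\<sigma> * s)) - cis \<sigma>"
    by (simp add: has_bochner_integral_iff)
  also have "(\<integral>p. indicator {-1..s} p *\<^sub>R (- \<i> * \<sigma> * cis (- (\<sigma> * p))) \<partial>lborel)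
      = (\<integral>p. - \<i> * \<sigma> * (complex_of_real (indicator {-1..1} p * of_bool (beyond p s)) * cis (- (\<sigma> * p))) \<partial>lborel)"
  proof (rule integral_cong_AE)
    have m[measurable]: "(\<lambda>p. cis (- (\<sigma> * p))) \<in> borel_measurable lborel"
      unfolding cis_conv_exp by measurable
    show "(\<lambda>p. indicator {-1..s} p *\<^sub>R (- \<i> * \<sigma> * cis (- (\<sigma> * p)))) \<in> borel_measurable lborel"
      by measurable
    show "(\<lambda>p. - \<i> * \<sigma> * (complex_of_real (indicator {-1..1} p * of_bool (beyond p s)) * cis (- (\<sigma> * p)))) \<in> borel_measurable lborel"
      unfolding beyond_def of_bool_def by measurable
    have "AE p in lborel. p \<noteq> s" by (rule AE_lborel_singleton)
    then show "AE p in lborel. indicator {-1..s} p *\<^sub>R (- \<i> * \<sigma> * cis (- (\<sigma> * p)))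
        = - \<i> * \<sigma> * (complex_of_real (indicator {-1..1} p * of_bool (beyond p s)) * cis (- (\<sigma> * p)))"
      by eventually_elim (use s in \<open>auto simp: beyond_def indicator_def\<close>)
  qed
  also have "\<dots> = - \<i> * \<sigma> * (\<integral>p. complex_of_real (indicator {-1..1} p * of_bool (beyond p s)) * cis (- (\<sigma> * p)) \<partial>lborel)"
    by (rule integral_mult_right_zero)
  finally show ?thesis by (simp add: algebra_simps)
qed

context
  fixes f :: "'a::euclidean_space \<Rightarrow> real" and s :: "'a \<Rightarrow> real"
  assumes f: "integrable lborel f" and s_meas[measurable]: "s \<in> borel_measurable borel"
    and s_bound: "\<And>x. f x \<noteq> 0 \<Longrightarrow> -1 \<le> s x \<and> s x \<le> 1"
begin

lemma borel_measurable_source [measurable]: "f \<in> borel_measurable borel"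
  using f by auto

lemma measurable_beyond: "(\<lambda>z. of_bool (beyond (fst z) (s (snd z))) :: real) \<in> borel_measurable (borel \<Otimes>\<^sub>M borel)"
  unfolding beyond_def of_bool_def by measurable

lemma borel_measurable_upper_mass: "upper_mass f s \<in> borel_measurable borel"
proof -
  note [measurable] = measurable_beyond
  have "(\<lambda>p. \<integral>x. f x * of_bool (beyond (fst (p, x)) (s (snd (p, x)))) \<partial>lborel) \<in> borel_measurable borel"
    by measurable
  then show ?thesis unfolding upper_mass_def[abs_def] by simp
qed

lemma upper_mass_bound: "\<bar>upper_mass f s p\<bar> \<le> (\<integral>x. \<bar>f x\<bar> \<partial>lborel)"
proof -
  have "\<bar>upper_mass f s p\<bar> \<le> (\<integral>x. \<bar>f x * of_bool (beyond p (s x))\<bar> \<partial>lborel)"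
    unfolding upper_mass_def by (rule integral_abs_bound)
  also have "\<dots> \<le> (\<integral>x. \<bar>f x\<bar> \<partial>lborel)"
    by (rule integral_mono') (use f in auto)
  finally show ?thesis .
qed

lemma upper_mass_window_integrable:
  "integrable lborel (\<lambda>p. indicator {-1..1} p * upper_mass f s p)"
  "integrable lborel (\<lambda>p. (indicator {-1..1} p * upper_mass f s p)\<^sup>2)"
proof -
  note [measurable] = borel_measurable_upper_mass
  let ?B = "\<integral>x. \<bar>f x\<bar> \<partial>lborel"
  have i: "integrable lborel (\<lambda>p::real. indicator {-1..1} p * c :: real)" for c
    by simp
  show "integrable lborel (\<lambda>p. indicator {-1..1} p * upper_mass f s p)"
    by (rule Bochner_Integration.integrable_bound[OF i[of ?B]])
       (use upper_mass_bound in \<open>auto simp: indicator_def intro!: AE_I2 order_trans[OF _ abs_ge_self]\<close>)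
  have "(upper_mass f s p)\<^sup>2 \<le> ?B\<^sup>2" for p
    using power_mono[OF upper_mass_bound abs_ge_zero, of p 2] by simp
  then show "integrable lborel (\<lambda>p. (indicator {-1..1} p * upper_mass f s p)\<^sup>2)"
    by (intro Bochner_Integration.integrable_bound[OF i[of "?B\<^sup>2"]]) (auto simp: indicator_def)
qed

text \<open>An integration by parts that never differentiates \<open>upper_mass\<close>: instead of a
  Radon transform being the derivative of a mass function, the exponential is written as an integral
  and Fubini's theorem is applied. The total mass appears as the boundary term at \<open>p = -1\<close>.\<close>

lemma fourier_by_upper_mass:
  "(\<integral>x. f x * cis (- (\<sigma> * s x)) \<partial>lborel)
    = (\<integral>x. f x \<partial>lborel) * cis \<sigma>
      - \<i> * \<sigma> * (\<integral>p. (indicator {-1..1} p * upper_mass f s p) * cis (- (\<sigma> * p)) \<partial>lborel)"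
proof -
  note [measurable] = measurable_beyond
  let ?\<chi> = "\<lambda>x p. indicator {-1..1} p * of_bool (beyond p (s x)) :: real"
  let ?F = "\<lambda>x p. complex_of_real (f x) * (?\<chi> x p * cis (- (\<sigma> * p)))"
  have [measurable]: "(\<lambda>z. cis (- (\<sigma> * snd z))) \<in> borel_measurable (lborel \<Otimes>\<^sub>M lborel)"
    unfolding cis_conv_exp by measurable
  have i1: "integrable lborel (indicator {-1..1} :: real \<Rightarrow> real)" by simp
  have \<chi>m: "(\<lambda>z. of_bool (beyond (snd z) (s (fst z))) :: real) \<in> borel_measurable (borel \<Otimes>\<^sub>M borel)"
    unfolding beyond_def of_bool_def by measurable
  have int: "integrable (lborel \<Otimes>\<^sub>M lborel) (case_prod ?F)"
  proof (rule Bochner_Integration.integrable_bound[OF integrable_mult_pair(1)[OF f i1]])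
    note [measurable] = \<chi>m
    have "(\<lambda>z. complex_of_real (f (fst z)) * (complex_of_real (indicator {-1..1} (snd z)
        * of_bool (beyond (snd z) (s (fst z)))) * cis (- (\<sigma> * snd z)))) \<in> borel_measurable (lborel \<Otimes>\<^sub>M lborel)"
      by measurable
    then show "case_prod ?F \<in> borel_measurable (lborel \<Otimes>\<^sub>M lborel)"
      by (simp add: split_beta')
  qed (auto simp: norm_mult indicator_def)
  have "(\<integral>x. f x * cis (- (\<sigma> * s x)) \<partial>lborel) = (\<integral>x. f x * cis \<sigma> - \<i> * \<sigma> * (\<integral>p. ?F x p \<partial>lborel) \<partial>lborel)"
  proof (rule Bochner_Integration.integral_cong[OF refl])
    fix x
    show "f x * cis (- (\<sigma> * s x)) = f x * cis \<sigma> - \<i> * \<sigma> * (\<integral>p. ?F x p \<partial>lborel)"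
    proof (cases "f x = 0")
      case False
      from integral_cis_beyond[of "s x" \<sigma>] s_bound[OF False]
      have "\<i> * \<sigma> * (\<integral>p. ?\<chi> x p * cis (- (\<sigma> * p)) \<partial>lborel) = cis \<sigma> - cis (- (\<sigma> * s x))"
        by blast
      then have "f x * (\<i> * \<sigma> * (\<integral>p. ?\<chi> x p * cis (- (\<sigma> * p)) \<partial>lborel)) = f x * (cis \<sigma> - cis (- (\<sigma> * s x)))"
        by (rule arg_cong)
      then show ?thesis unfolding integral_mult_right_zero by (simp only: right_diff_distrib mult_ac) (simp add: algebra_simps)
    qed simp
  qed
  also have "\<dots> = (\<integral>x. f x * cis \<sigma> \<partial>lborel) - (\<integral>x. \<i> * \<sigma> * (\<integral>p. ?F x p \<partial>lborel) \<partial>lborel)"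
    using f lborel_pair.integrable_fst[OF int] by (intro Bochner_Integration.integral_diff) auto
  also have "(\<integral>x. f x * cis \<sigma> \<partial>lborel) = (\<integral>x. f x \<partial>lborel) * cis \<sigma>"
    by simp
  also have "(\<integral>x. \<i> * \<sigma> * (\<integral>p. ?F x p \<partial>lborel) \<partial>lborel) = \<i> * \<sigma> * (\<integral>p. (\<integral>x. ?F x p \<partial>lborel) \<partial>lborel)"
    unfolding lborel_pair.Fubini_integral[OF int] by (rule integral_mult_right_zero)
  also have "(\<lambda>p. \<integral>x. ?F x p \<partial>lborel) = (\<lambda>p. (indicator {-1..1} p * upper_mass f s p) * cis (- (\<sigma> * p)))"
  proof
    fix p
    have "?F x p = (indicator {-1..1} p * cis (- (\<sigma> * p))) * complex_of_real (f x * of_bool (beyond p (s x)))" for x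
      by (simp add: of_real_indicator)
    then show "(\<integral>x. ?F x p \<partial>lborel) = (indicator {-1..1} p * upper_mass f s p) * cis (- (\<sigma> * p))"
      unfolding upper_mass_def by (simp only: integral_mult_right_zero integral_complex_of_real) (simp add: of_real_indicator)
  qed
  finally show ?thesis .
qed

text \<open>The factor \<open>|\<sigma>|\<close> is the Jacobian of polar coordinates, and by
  \<open>fourier_by_upper_mass\<close> the transform grows by one more factor \<open>|\<sigma>|\<close> relative to that of
  \<open>upper_mass\<close>. Half of the Gaussian pays for the resulting \<open>|\<sigma>|\<^sup>3\<close> at the price \<open>t\<^sup>-\<^sup>3\<close>, the
  other half remains for Bessel's inequality.\<close>

theorem ray_energy_bound:
  assumes t: "0 < t" "t \<le> 1"
  shows "(\<integral>\<^sup>+\<sigma>. ennreal (\<bar>\<sigma>\<bar> * (exp (-(t\<^sup>2 * \<sigma>\<^sup>2 / 2)) * (cmod (\<integral>x. f x * cis (- (\<sigma> * s x)) \<partial>lborel))\<^sup>2)) \<partial>lborel)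
    \<le> ennreal (32 * pi / t ^ 3 * ((\<integral>x. f x \<partial>lborel)\<^sup>2 + (\<integral>p. (indicator {-1..1} p * upper_mass f s p)\<^sup>2 \<partial>lborel)))"
proof -
  define M where "M = (\<integral>x. f x \<partial>lborel)"
  define J where "J = (\<integral>p. (indicator {-1..1} p * upper_mass f s p)\<^sup>2 \<partial>lborel)"
  have J: "0 \<le> J" unfolding J_def by simp
  define K where "K \<sigma> = (\<integral>p. (indicator {-1..1} p * upper_mass f s p) * cis (- (\<sigma> * p)) \<partial>lborel)" for \<sigma> :: real
  define \<tau> where "\<tau> = t / sqrt 2"
  have \<tau>: "\<tau> > 0" using t by (simp add: \<tau>_def)
  have \<tau>2: "\<tau>\<^sup>2 = t\<^sup>2 / 2" by (simp add: \<tau>_def power_divide)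
  let ?g = "\<lambda>\<sigma>. exp (-(\<tau>\<^sup>2 * \<sigma>\<^sup>2 / 2))"
  note B = gaussian_bessel_inequality[OF upper_mass_window_integrable \<tau>, folded K_def J_def]
  note G = gaussian_fourier_line(1)[OF \<tau>]
  have G': "(\<integral>\<sigma>. ?g \<sigma> \<partial>lborel) = sqrt (2 * pi) / \<tau>"
    using gaussian_fourier_line(2)[OF \<tau>, of 0] by simp
  have pt: "\<bar>\<sigma>\<bar> * (exp (-(t\<^sup>2 * \<sigma>\<^sup>2 / 2)) * (cmod (\<integral>x. f x * cis (- (\<sigma> * s x)) \<partial>lborel))\<^sup>2)
      \<le> 2 * M\<^sup>2 / t * ?g \<sigma> + 16 / t ^ 3 * (?g \<sigma> * (cmod (K \<sigma>))\<^sup>2)" for \<sigma> :: real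
  proof -
    have "cmod (\<integral>x. f x * cis (- (\<sigma> * s x)) \<partial>lborel) = cmod (M * cis \<sigma> - \<i> * \<sigma> * K \<sigma>)"
      unfolding fourier_by_upper_mass M_def K_def ..
    also have "\<dots> \<le> cmod (M * cis \<sigma>) + cmod (\<i> * \<sigma> * K \<sigma>)"
      by (rule norm_triangle_ineq4)
    also have "\<dots> = \<bar>M\<bar> + \<bar>\<sigma>\<bar> * cmod (K \<sigma>)" by (simp add: norm_mult)
    finally have "(cmod (\<integral>x. f x * cis (- (\<sigma> * s x)) \<partial>lborel))\<^sup>2 \<le> (\<bar>M\<bar> + \<bar>\<sigma>\<bar> * cmod (K \<sigma>))\<^sup>2"
      by (rule power_mono) simp
    also have "\<dots> \<le> 2 * M\<^sup>2 + 2 * (\<bar>\<sigma>\<bar>\<^sup>2 * (cmod (K \<sigma>))\<^sup>2)"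
      using sum_squares_bound[of "\<bar>M\<bar>" "\<bar>\<sigma>\<bar> * cmod (K \<sigma>)"] by (simp add: power2_sum power_mult_distrib)
    finally have N: "(cmod (\<integral>x. f x * cis (- (\<sigma> * s x)) \<partial>lborel))\<^sup>2 \<le> 2 * M\<^sup>2 + 2 * (\<bar>\<sigma>\<bar>\<^sup>2 * (cmod (K \<sigma>))\<^sup>2)" .
    define u where "u = t * \<bar>\<sigma>\<bar>"
    have u: "0 \<le> u" using t by (simp add: u_def)
    have u2: "t\<^sup>2 * \<sigma>\<^sup>2 = u\<^sup>2" by (simp add: u_def power_mult_distrib)
    have e: "exp (-(t\<^sup>2 * \<sigma>\<^sup>2 / 2)) = exp (-(u\<^sup>2/4)) * ?g \<sigma>" "?g \<sigma> = exp (-(u\<^sup>2/4))"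
      unfolding \<tau>2 by (simp_all add: exp_add[symmetric] u2[symmetric] field_simps)
    \<comment> \<open>the powers \<open>u\<close> and \<open>u\<^sup>3\<close> are compared with \<open>exp (u\<^sup>2/4)\<close> through \<open>1 + v \<le> exp v\<close>\<close>
    have "u \<le> 1 + u\<^sup>2/4" using zero_le_power2[of "u/2 - 1"] by (simp add: power2_eq_square field_simps)
    also have "\<dots> \<le> exp (u\<^sup>2/4)" by (rule exp_ge_add_one_self)
    finally have "u * exp (-(u\<^sup>2/4)) \<le> exp (u\<^sup>2/4) * exp (-(u\<^sup>2/4))" by (rule mult_right_mono) simp
    then have 1: "u * exp (-(u\<^sup>2/4)) \<le> 1" by (simp add: exp_add[symmetric])
    have "u / 2 \<le> 1 + u\<^sup>2/12" using zero_le_power2[of "u - 3"] by (simp add: power2_eq_square field_simps)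
    also have "\<dots> \<le> exp (u\<^sup>2/12)" by (rule exp_ge_add_one_self)
    finally have "(u / 2) ^ 3 \<le> exp (u\<^sup>2/12) ^ 3" using u by (intro power_mono) auto
    also have "\<dots> = exp (u\<^sup>2/4)" by (simp add: exp_of_nat_mult[symmetric])
    finally have "(u / 2) ^ 3 * exp (-(u\<^sup>2/4)) \<le> exp (u\<^sup>2/4) * exp (-(u\<^sup>2/4))" by (rule mult_right_mono) simp
    then have 3: "u ^ 3 * exp (-(u\<^sup>2/4)) \<le> 8" by (simp add: exp_add[symmetric] power_divide)
    have a1: "\<bar>\<sigma>\<bar> * exp (-(u\<^sup>2/4)) \<le> 1 / t" using 1 t by (simp add: u_def field_simps)
    have a3: "\<bar>\<sigma>\<bar> ^ 3 * exp (-(u\<^sup>2/4)) \<le> 8 / t ^ 3" using 3 t by (simp add: u_def field_simps power_mult_distrib)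
    have "\<bar>\<sigma>\<bar> * (exp (-(t\<^sup>2 * \<sigma>\<^sup>2 / 2)) * (cmod (\<integral>x. f x * cis (- (\<sigma> * s x)) \<partial>lborel))\<^sup>2)
        \<le> \<bar>\<sigma>\<bar> * (exp (-(t\<^sup>2 * \<sigma>\<^sup>2 / 2)) * (2 * M\<^sup>2 + 2 * (\<bar>\<sigma>\<bar>\<^sup>2 * (cmod (K \<sigma>))\<^sup>2)))"
      by (intro mult_left_mono N) auto
    also have "\<dots> = (\<bar>\<sigma>\<bar> * exp (-(u\<^sup>2/4))) * (2 * M\<^sup>2 * ?g \<sigma>) + (\<bar>\<sigma>\<bar> ^ 3 * exp (-(u\<^sup>2/4))) * (2 * (?g \<sigma> * (cmod (K \<sigma>))\<^sup>2))"
      unfolding e(1) by (simp add: algebra_simps power2_eq_square power3_eq_cube)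
    also have "\<dots> \<le> (1 / t) * (2 * M\<^sup>2 * ?g \<sigma>) + (8 / t ^ 3) * (2 * (?g \<sigma> * (cmod (K \<sigma>))\<^sup>2))"
      by (intro add_mono mult_right_mono a1 a3) auto
    finally show ?thesis by (simp add: mult_ac)
  qed
  have "(\<integral>\<^sup>+\<sigma>. ennreal (\<bar>\<sigma>\<bar> * (exp (-(t\<^sup>2 * \<sigma>\<^sup>2 / 2)) * (cmod (\<integral>x. f x * cis (- (\<sigma> * s x)) \<partial>lborel))\<^sup>2)) \<partial>lborel)
      \<le> (\<integral>\<^sup>+\<sigma>. ennreal (2 * M\<^sup>2 / t * ?g \<sigma> + 16 / t ^ 3 * (?g \<sigma> * (cmod (K \<sigma>))\<^sup>2)) \<partial>lborel)"
    by (intro nn_integral_mono ennreal_leI pt)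
  also have "\<dots> = ennreal (\<integral>\<sigma>. 2 * M\<^sup>2 / t * ?g \<sigma> + 16 / t ^ 3 * (?g \<sigma> * (cmod (K \<sigma>))\<^sup>2) \<partial>lborel)"
    using G B(1) t by (intro nn_integral_eq_integral) auto
  also have "(\<integral>\<sigma>. 2 * M\<^sup>2 / t * ?g \<sigma> + 16 / t ^ 3 * (?g \<sigma> * (cmod (K \<sigma>))\<^sup>2) \<partial>lborel)
      = 2 * M\<^sup>2 / t * (sqrt (2 * pi) / \<tau>) + 16 / t ^ 3 * (\<integral>\<sigma>. ?g \<sigma> * (cmod (K \<sigma>))\<^sup>2 \<partial>lborel)"
    using G B(1) by (simp add: G'[symmetric])
  also have "\<dots> \<le> 32 * pi / t ^ 3 * M\<^sup>2 + 32 * pi / t ^ 3 * J"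
  proof (rule add_mono)
    have "sqrt (2 * pi) / \<tau> = 2 * sqrt pi / t"
      by (simp add: \<tau>_def real_sqrt_mult)
    also have "\<dots> \<le> 2 * pi / t"
      using t pi_ge_two by (intro divide_right_mono mult_left_mono real_le_lsqrt) (auto simp: power2_eq_square)
    finally have "2 * M\<^sup>2 / t * (sqrt (2 * pi) / \<tau>) \<le> 2 * M\<^sup>2 / t * (2 * pi / t)"
      using t by (intro mult_left_mono) auto
    also have "\<dots> = 4 * pi * M\<^sup>2 / t\<^sup>2" by (simp add: power2_eq_square)
    also have "\<dots> \<le> 32 * pi * M\<^sup>2 / t ^ 3"
      using t power_decreasing[of 2 3 t] by (intro frac_le) auto
    finally show "2 * M\<^sup>2 / t * (sqrt (2 * pi) / \<tau>) \<le> 32 * pi / t ^ 3 * M\<^sup>2" by simp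
    have "16 / t ^ 3 * (\<integral>\<sigma>. ?g \<sigma> * (cmod (K \<sigma>))\<^sup>2 \<partial>lborel) \<le> 16 / t ^ 3 * (2 * pi * J)"
      using t by (intro mult_left_mono B(2)) auto
    then show "16 / t ^ 3 * (\<integral>\<sigma>. ?g \<sigma> * (cmod (K \<sigma>))\<^sup>2 \<partial>lborel) \<le> 32 * pi / t ^ 3 * J" by simp
  qed
  finally show ?thesis unfolding M_def[symmetric] J_def[symmetric]
    by (simp add: distrib_left ennreal_leI)
qed

end

section \<open>The disc transform as half-plane masses of the inverted image\<close>

definition inverted_coord :: "real \<Rightarrow> real \<times> real \<Rightarrow> real" where
  "inverted_coord \<phi> x = (cos \<phi>, sin \<phi>) \<bullet> inversion x"

lemma inverted_coord_eq: "inverted_coord \<phi> x = (cos \<phi>, sin \<phi>) \<bullet> x / (norm x)\<^sup>2"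
  by (simp add: inverted_coord_def inversion_def divide_inverse mult.commute)

lemma inverted_coord_plus_pi: "inverted_coord (\<phi> + pi) x = - inverted_coord \<phi> x"
proof -
  have "(cos (\<phi> + pi), sin (\<phi> + pi)) = - (cos \<phi>, sin \<phi>)" by simp
  then show ?thesis unfolding inverted_coord_def by (simp only: inner_minus_left)
qed

lemma norm_angle: "norm (cos \<phi>, sin \<phi> :: real) = 1"
  by (simp add: norm_Pair)

lemma borel_measurable_inverted_coord [measurable]: "inverted_coord \<phi> \<in> borel_measurable borel"
  unfolding inverted_coord_def[abs_def] by measurable

lemma measurable_inverted_coord_pair: "(\<lambda>z. inverted_coord (fst z) (snd z)) \<in> borel_measurable (borel \<Otimes>\<^sub>M borel)"
proof -
  have [measurable]: "(\<lambda>z::real \<times> real \<times> real. (cos (fst z), sin (fst z))) \<in> borel_measurable (borel \<Otimes>\<^sub>M borel)"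
    unfolding borel_prod by (intro borel_measurable_continuous_onI continuous_intros)
  show ?thesis unfolding inverted_coord_def by measurable
qed

text \<open>The disc condition \<open>|x - q \<theta>| < q\<close> with \<open>q = 1/(2p)\<close> reads \<open>p |x|\<^sup>2 < \<theta> \<bullet> x\<close>
  after completing the square, and division by \<open>|x|\<^sup>2\<close> gives the half plane of the inverted point.\<close>

lemma origin_disc_iff:
  assumes p: "p > 0" and x: "x \<noteq> 0"
  shows "x \<in> origin_disc (1 / p) \<phi> \<longleftrightarrow> p < inverted_coord \<phi> x"
proof -
  define q where "q = 1 / (2 * p)"
  have q: "q > 0" "2 * p * q = 1" using p by (simp_all add: q_def)
  let ?\<theta> = "(cos \<phi>, sin \<phi>)"
  have "x \<in> origin_disc (1 / p) \<phi> \<longleftrightarrow> norm (q *\<^sub>R ?\<theta> - x) < q"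
    by (simp add: origin_disc_def q_def dist_norm mult.commute)
  also have "\<dots> \<longleftrightarrow> (norm (q *\<^sub>R ?\<theta> - x))\<^sup>2 < q\<^sup>2"
    using q(1) by (auto intro!: power_strict_mono intro: power_less_imp_less_base[of _ 2])
  also have "(norm (q *\<^sub>R ?\<theta> - x))\<^sup>2 = q\<^sup>2 - 2 * q * (?\<theta> \<bullet> x) + (norm x)\<^sup>2"
  proof -
    have "?\<theta> \<bullet> ?\<theta> = 1" using norm_angle[of \<phi>] by (simp add: norm_eq_1)
    then show ?thesis
      unfolding power2_norm_eq_inner by (simp add: inner_diff_left inner_diff_right inner_commute power2_eq_square del: inner_Pair scaleR_Pair)
  qed
  also have "q\<^sup>2 - 2 * q * (?\<theta> \<bullet> x) + (norm x)\<^sup>2 < q\<^sup>2 \<longleftrightarrow> (norm x)\<^sup>2 < 2 * q * (?\<theta> \<bullet> x)"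
    by linarith
  also have "\<dots> \<longleftrightarrow> p * (norm x)\<^sup>2 < ?\<theta> \<bullet> x"
    using p by (simp add: q_def field_simps del: inner_Pair)
  also have "\<dots> \<longleftrightarrow> p < inverted_coord \<phi> x"
    using x by (simp add: inverted_coord_eq pos_less_divide_eq del: inner_Pair)
  finally show ?thesis .
qed

text \<open>The inversion maps the disc with diameter from \<open>(0, 1)\<close> to \<open>(0, r)\<close> onto the one with
  diameter from \<open>(0, 1/r)\<close> to \<open>(0, 1)\<close>, whose centre is \<open>(0, (1 + 1/r)/2)\<close> and whose radius is
  \<open>(1 - 1/r)/2\<close>. Its projection to the direction \<open>\<phi>\<close> is an interval of that radius.\<close>

lemma inverted_coord_D_region:
  assumes r: "r > 1" and x: "x \<in> D_region r"
  shows "\<bar>inverted_coord \<phi> x\<bar> < 1"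
    and "\<bar>inverted_coord \<phi> x - (1 + 1 / r) / 2 * sin \<phi>\<bar> < (1 - 1 / r) / 2"
proof -
  have nx: "1 < norm x" by (rule D_region_norm[OF r x])
  have "\<bar>inverted_coord \<phi> x\<bar> \<le> norm (cos \<phi>, sin \<phi>) * norm (inversion x)"
    unfolding inverted_coord_def by (rule Cauchy_Schwarz_ineq2)
  also have "\<dots> = 1 / norm x" using nx by (simp add: norm_angle inversion_def power2_eq_square field_simps)
  also have "\<dots> < 1" using nx by (simp add: divide_less_eq_1)
  finally show "\<bar>inverted_coord \<phi> x\<bar> < 1" .
  obtain u v where w: "inversion x = (u, v)" by (cases "inversion x")
  obtain x1 x2 where x12: "x = (x1, x2)" by (cases x)
  define n where "n = (norm x)\<^sup>2"
  have n: "n > 0" "n = x1\<^sup>2 + x2\<^sup>2" using nx by (simp_all add: n_def x12 norm_Pair)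
  have uv: "u = x1 / n" "v = x2 / n"
    using w by (simp_all add: inversion_def n_def x12 divide_inverse mult.commute)
  have "n - (r + 1) * x2 + r < 0"
    using x unfolding n by (simp add: x12 D_region_def power2_eq_square field_simps)
  then have "(n - (r + 1) * x2 + r) / (r * n) < 0" using n(1) r by (simp add: divide_neg_pos)
  also have "(n - (r + 1) * x2 + r) / (r * n) = 1 / r - (1 + 1 / r) * v + 1 / n"
    using n(1) r by (simp add: uv field_simps)
  also have "1 / n = u\<^sup>2 + v\<^sup>2"
    using n by (simp add: uv power_divide add_divide_distrib[symmetric] power2_eq_square)
  finally have lt: "1 / r - (1 + 1 / r) * v + (u\<^sup>2 + v\<^sup>2) < 0" .
  have "u\<^sup>2 + (v - (1 + 1 / r) / 2)\<^sup>2 < ((1 - 1 / r) / 2)\<^sup>2"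
  proof -
    define d where "d = 1 / r"
    have "u\<^sup>2 + (v - (1 + d) / 2)\<^sup>2 - ((1 - d) / 2)\<^sup>2 = d - (1 + d) * v + (u\<^sup>2 + v\<^sup>2)"
      by (simp add: power2_eq_square field_simps)
    then show ?thesis using lt unfolding d_def[symmetric] by linarith
  qed
  then have "(norm (u, v - (1 + 1 / r) / 2))\<^sup>2 < ((1 - 1 / r) / 2)\<^sup>2"
    unfolding norm_prod_power2 by (simp only: fst_conv snd_conv)
  then have b: "norm (u, v - (1 + 1 / r) / 2) < (1 - 1 / r) / 2"
    by (rule power_less_imp_less_base) (use r in simp)
  have "inverted_coord \<phi> x - (1 + 1 / r) / 2 * sin \<phi> = (cos \<phi>, sin \<phi>) \<bullet> (u, v - (1 + 1 / r) / 2)"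
    unfolding inverted_coord_def w inner_Pair inner_real_def right_diff_distrib
    by (simp only: mult.commute[of "sin \<phi>"] add_diff_eq)
  also have "\<bar>\<dots>\<bar> \<le> norm (cos \<phi>, sin \<phi>) * norm (u, v - (1 + 1 / r) / 2)"
    by (rule Cauchy_Schwarz_ineq2)
  finally show "\<bar>inverted_coord \<phi> x - (1 + 1 / r) / 2 * sin \<phi>\<bar> < (1 - 1 / r) / 2"
    using b unfolding norm_angle mult_1 by (rule le_less_trans)
qed

definition mass_above :: "(real \<times> real \<Rightarrow> real) \<Rightarrow> real \<Rightarrow> real \<Rightarrow> real" where
  "mass_above f p \<phi> = (\<integral>x. f x * of_bool (p < inverted_coord \<phi> x) \<partial>lborel)"

definition mass_below :: "(real \<times> real \<Rightarrow> real) \<Rightarrow> real \<Rightarrow> real \<Rightarrow> real" where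
  "mass_below f p \<phi> = (\<integral>x. f x * of_bool (inverted_coord \<phi> x < p) \<partial>lborel)"

lemma disc_D1_eq:
  assumes "f 0 = 0" "p > 0"
  shows "disc_D1 f p \<phi> = mass_above f p \<phi>"
  unfolding disc_D1_def mass_above_def set_lebesgue_integral_def
proof (rule Bochner_Integration.integral_cong[OF refl])
  fix x show "indicator (origin_disc (1 / p) \<phi>) x *\<^sub>R f x = f x * of_bool (p < inverted_coord \<phi> x)"
    using assms origin_disc_iff[of p x \<phi>] by (cases "x = 0") (auto simp: indicator_def)
qed

text \<open>Dominated convergence: the discs grow to an open half plane as \<open>p\<close> decreases to
  \<open>0\<close>.\<close>

lemma disc_D1_zero_eq:
  assumes f: "integrable lborel f" and f0: "f 0 = 0"
  shows "disc_D1_zero f \<phi> = mass_above f 0 \<phi>"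
  unfolding disc_D1_zero_def
proof (rule tendsto_Lim)
  have [measurable]: "f \<in> borel_measurable borel" using f by auto
  have "((\<lambda>p. mass_above f p \<phi>) \<longlongrightarrow> mass_above f 0 \<phi>) (at_right 0)"
  proof (rule tendsto_at_right_sequentially[of 0 1])
    fix S :: "nat \<Rightarrow> real"
    assume pos: "\<And>n. 0 < S n" and S0: "S \<longlonglongrightarrow> 0"
    show "(\<lambda>n. mass_above f (S n) \<phi>) \<longlonglongrightarrow> mass_above f 0 \<phi>"
      unfolding mass_above_def
    proof (rule integral_dominated_convergence)
      show "integrable lborel (\<lambda>x. \<bar>f x\<bar>)" using f by simp
      show "AE x in lborel. (\<lambda>n. f x * of_bool (S n < inverted_coord \<phi> x)) \<longlonglongrightarrow> f x * of_bool (0 < inverted_coord \<phi> x)"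
      proof (rule AE_I2)
        fix x
        show "(\<lambda>n. f x * of_bool (S n < inverted_coord \<phi> x)) \<longlonglongrightarrow> f x * of_bool (0 < inverted_coord \<phi> x)"
        proof (cases "0 < inverted_coord \<phi> x")
          case True
          have "eventually (\<lambda>n. S n < inverted_coord \<phi> x) sequentially" using S0 True by (rule order_tendstoD)
          then show ?thesis by (intro tendsto_eventually) (auto elim!: eventually_mono simp: True)
        next
          case False
          then have "\<not> S n < inverted_coord \<phi> x" for n using pos[of n] by linarith
          then show ?thesis using False by simp
        qed
      qed
    qed (auto simp: abs_mult)
  qed simp
  then show "((\<lambda>p. disc_D1 f p \<phi>) \<longlongrightarrow> mass_above f 0 \<phi>) (at_right 0)"
    by (rule Lim_transform_eventually) (auto simp: eventually_at_filter disc_D1_eq f0)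
qed simp

lemma mass_above_plus_pi: "mass_above f p (\<phi> + pi) = mass_below f (- p) \<phi>"
proof -
  have "p < - s \<longleftrightarrow> s < - p" for s :: real by linarith
  then show ?thesis by (simp add: mass_above_def mass_below_def inverted_coord_plus_pi)
qed

lemma jump_correction_eq:
  assumes "integrable lborel f" "f 0 = 0"
  shows "jump_correction f \<phi> = (mass_below f 0 \<phi> - mass_above f 0 \<phi>) / 2"
  by (simp add: jump_correction_def disc_D1_zero_eq[OF assms] mass_above_plus_pi)

text \<open>For \<open>p < 0\<close> the disc in direction \<open>\<phi> + \<pi>\<close> becomes the half plane below \<open>p\<close> in direction
  \<open>\<phi>\<close>.\<close>

lemma disc_transform_eq:
  assumes "integrable lborel f" "f 0 = 0"
  shows "disc_transform f (p, \<phi>) =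
    (if p > 0 then mass_above f p \<phi> + jump_correction f \<phi>
     else if p < 0 then mass_below f p \<phi> - jump_correction f \<phi>
     else (mass_above f 0 \<phi> + mass_below f 0 \<phi>) / 2)"
  using assms by (auto simp: disc_transform_def disc_D2_def disc_D1_zero_eq disc_D1_eq mass_above_plus_pi)

lemma borel_measurable_masses:
  assumes f: "integrable lborel f"
  shows "(\<lambda>z. mass_above f (fst z) (snd z)) \<in> borel_measurable borel"
    and "(\<lambda>z. mass_below f (fst z) (snd z)) \<in> borel_measurable borel"
proof -
  have [measurable]: "f \<in> borel_measurable borel" using f by auto
  have m: "(\<lambda>w::(real \<times> real) \<times> (real \<times> real). inverted_coord (snd (fst w)) (snd w)) \<in> borel_measurable ((borel \<Otimes>\<^sub>M borel) \<Otimes>\<^sub>M borel)"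
  proof -
    have "(\<lambda>w::(real \<times> real) \<times> (real \<times> real). (snd (fst w), snd w)) \<in> (borel \<Otimes>\<^sub>M borel) \<Otimes>\<^sub>M borel \<rightarrow>\<^sub>M borel \<Otimes>\<^sub>M borel"
      by measurable
    from measurable_compose[OF this measurable_inverted_coord_pair] show ?thesis by simp
  qed
  note [measurable] = m
  have "(\<lambda>z. \<integral>x. f x * of_bool (fst (fst (z, x)) < inverted_coord (snd (fst (z, x))) (snd (z, x))) \<partial>lborel) \<in> borel_measurable (borel \<Otimes>\<^sub>M borel)"
    unfolding of_bool_def by measurable
  then show "(\<lambda>z. mass_above f (fst z) (snd z)) \<in> borel_measurable borel"
    by (simp add: mass_above_def borel_prod)
  have "(\<lambda>z. \<integral>x. f x * of_bool (inverted_coord (snd (fst (z, x))) (snd (z, x)) < fst (fst (z, x))) \<partial>lborel) \<in> borel_measurable (borel \<Otimes>\<^sub>M borel)"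
    unfolding of_bool_def by measurable
  then show "(\<lambda>z. mass_below f (fst z) (snd z)) \<in> borel_measurable borel"
    by (simp add: mass_below_def borel_prod)
qed

lemma masses_bound:
  assumes f: "integrable lborel f"
  shows "\<bar>mass_above f p \<phi>\<bar> \<le> (\<integral>x. \<bar>f x\<bar> \<partial>lborel)" "\<bar>mass_below f p \<phi>\<bar> \<le> (\<integral>x. \<bar>f x\<bar> \<partial>lborel)"
proof -
  have *: "\<bar>\<integral>x. f x * of_bool (Q x) \<partial>lborel\<bar> \<le> (\<integral>x. \<bar>f x\<bar> \<partial>lborel)" for Q
  proof -
    have "\<bar>\<integral>x. f x * of_bool (Q x) \<partial>lborel\<bar> \<le> (\<integral>x. \<bar>f x * of_bool (Q x)\<bar> \<partial>lborel)"
      by (rule integral_abs_bound)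
    also have "\<dots> \<le> (\<integral>x. \<bar>f x\<bar> \<partial>lborel)"
      by (rule integral_mono') (use f in auto)
    finally show ?thesis .
  qed
  show "\<bar>mass_above f p \<phi>\<bar> \<le> (\<integral>x. \<bar>f x\<bar> \<partial>lborel)" "\<bar>mass_below f p \<phi>\<bar> \<le> (\<integral>x. \<bar>f x\<bar> \<partial>lborel)"
    unfolding mass_above_def mass_below_def by (rule *)+
qed

lemma borel_measurable_disc_transform:
  assumes f: "integrable lborel f" and f0: "f 0 = 0"
  shows "disc_transform f \<in> borel_measurable borel"
proof -
  note m[measurable] = borel_measurable_masses[OF f]
  have z: "(\<lambda>z::real \<times> real. (0::real, snd z)) \<in> borel_measurable borel"
    by (intro borel_measurable_continuous_onI continuous_intros)
  have [measurable]: "(\<lambda>z::real \<times> real. mass_above f 0 (snd z)) \<in> borel_measurable borel"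
    "(\<lambda>z::real \<times> real. mass_below f 0 (snd z)) \<in> borel_measurable borel"
    using measurable_compose[OF z m(1)] measurable_compose[OF z m(2)] by simp_all
  have [measurable]: "(\<lambda>z::real \<times> real. fst z) \<in> borel_measurable borel"
    by (intro borel_measurable_continuous_onI continuous_intros)
  have "(\<lambda>z. if fst z > 0 then mass_above f (fst z) (snd z) + (mass_below f 0 (snd z) - mass_above f 0 (snd z)) / 2
     else if fst z < 0 then mass_below f (fst z) (snd z) - (mass_below f 0 (snd z) - mass_above f 0 (snd z)) / 2
     else (mass_above f 0 (snd z) + mass_below f 0 (snd z)) / 2) \<in> borel_measurable borel"
    by measurable
  also have "(\<lambda>z. if fst z > 0 then mass_above f (fst z) (snd z) + (mass_below f 0 (snd z) - mass_above f 0 (snd z)) / 2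
     else if fst z < 0 then mass_below f (fst z) (snd z) - (mass_below f 0 (snd z) - mass_above f 0 (snd z)) / 2
     else (mass_above f 0 (snd z) + mass_below f 0 (snd z)) / 2) = disc_transform f"
    by (auto simp: fun_eq_iff disc_transform_eq[OF f f0] jump_correction_eq[OF f f0])
  finally show ?thesis .
qed

lemma disc_transform_bound:
  assumes f: "integrable lborel f" and f0: "f 0 = 0"
  shows "\<bar>disc_transform f z\<bar> \<le> 2 * (\<integral>x. \<bar>f x\<bar> \<partial>lborel)"
proof (cases z)
  case (Pair p \<phi>)
  show ?thesis
    using masses_bound[OF f, of p \<phi>] masses_bound[OF f, of 0 \<phi>]
    unfolding Pair disc_transform_eq[OF f f0] jump_correction_eq[OF f f0] by (auto simp: abs_le_iff field_simps)
qed

lemma disc_transform_diff: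
  assumes f: "integrable lborel f" "f 0 = 0" and g: "integrable lborel g" "g 0 = 0"
  shows "disc_transform (\<lambda>x. f x - g x) z = disc_transform f z - disc_transform g z"
proof (cases z)
  case (Pair p \<phi>)
  have [measurable]: "f \<in> borel_measurable borel" "g \<in> borel_measurable borel" using f g by auto
  have *: "(\<integral>x. (f x - g x) * of_bool (Q x) \<partial>lborel) = (\<integral>x. f x * of_bool (Q x) \<partial>lborel) - (\<integral>x. g x * of_bool (Q x) \<partial>lborel)"
    if [measurable]: "Measurable.pred borel Q" for Q
  proof -
    have "integrable lborel (\<lambda>x. f x * of_bool (Q x))" "integrable lborel (\<lambda>x. g x * of_bool (Q x))"
      using f(1) g(1) by (auto intro: Bochner_Integration.integrable_bound)
    then show ?thesis unfolding left_diff_distrib by (rule Bochner_Integration.integral_diff)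
  qed
  have d: "mass_above (\<lambda>x. f x - g x) p \<phi> = mass_above f p \<phi> - mass_above g p \<phi>"
    "mass_below (\<lambda>x. f x - g x) p \<phi> = mass_below f p \<phi> - mass_below g p \<phi>" for p
    unfolding mass_above_def mass_below_def by (rule *, measurable)+
  have fg: "integrable lborel (\<lambda>x. f x - g x)" "f 0 - g 0 = 0" using f g by auto
  show ?thesis
    unfolding Pair disc_transform_eq[OF f] disc_transform_eq[OF g] disc_transform_eq[OF fg]
      jump_correction_eq[OF f] jump_correction_eq[OF g] jump_correction_eq[OF fg] d
    by (auto simp: field_simps)
qed

section \<open>Recovering half-plane masses from the data\<close>

lemma power2_sum3_le: "(a + b + c)\<^sup>2 \<le> 3 * (a\<^sup>2 + b\<^sup>2 + c\<^sup>2)" for a b c :: real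
proof -
  have "3 * (a\<^sup>2 + b\<^sup>2 + c\<^sup>2) - (a + b + c)\<^sup>2 = (a - b)\<^sup>2 + (a - c)\<^sup>2 + (b - c)\<^sup>2"
    by (simp add: power2_eq_square algebra_simps)
  moreover have "0 \<le> (a - b)\<^sup>2 + (a - c)\<^sup>2 + (b - c)\<^sup>2" by simp
  ultimately show ?thesis by linarith
qed

lemma upper_mass_inverted_coord:
  assumes f: "integrable lborel f"
  shows "0 \<le> p \<Longrightarrow> upper_mass f (inverted_coord \<phi>) p = mass_above f p \<phi>"
    and "p < 0 \<Longrightarrow> upper_mass f (inverted_coord \<phi>) p = (\<integral>x. f x \<partial>lborel) - mass_below f p \<phi>"
proof -
  have [measurable]: "f \<in> borel_measurable borel" using f by auto
  show "upper_mass f (inverted_coord \<phi>) p = mass_above f p \<phi>" if "0 \<le> p"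
    using that by (simp add: upper_mass_def mass_above_def beyond_def)
  assume p: "p < 0"
  have i: "integrable lborel (\<lambda>x. f x * of_bool (inverted_coord \<phi> x < p))"
    by (rule Bochner_Integration.integrable_bound[OF f]) auto
  have "f x * of_bool (beyond p (inverted_coord \<phi> x)) = f x - f x * of_bool (inverted_coord \<phi> x < p)" for x
    using p by (auto simp: beyond_def)
  then show "upper_mass f (inverted_coord \<phi>) p = (\<integral>x. f x \<partial>lborel) - mass_below f p \<phi>"
    unfolding upper_mass_def mass_below_def using f i by simp
qed

definition slice_energy :: "(real \<times> real \<Rightarrow> real) \<Rightarrow> real \<Rightarrow> real" where
  "slice_energy f \<phi> = (\<integral>p. indicator {-1..1} p * (disc_transform f (p, \<phi>))\<^sup>2 \<partial>lborel)"

definition cylinder_energy :: "(real \<times> real \<Rightarrow> real) \<Rightarrow> real" where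
  "cylinder_energy f = (\<integral>z. indicator cylinder z * (disc_transform f z)\<^sup>2 \<partial>lborel)"

text \<open>From this angle up to \<open>\<pi>/2\<close> the centre of the inverted disc projects to at least \<open>1/2\<close>,
  which exceeds the radius of that disc; seen in these directions it lies strictly on the positive
  side of the origin.\<close>

definition peak_angle :: "real \<Rightarrow> real" where
  "peak_angle r = arcsin (r / (r + 1))"

lemma peak_angle:
  assumes "r > 1"
  shows "0 < peak_angle r" "peak_angle r < pi / 2"
    "\<And>\<phi>. \<phi> \<in> {peak_angle r..<pi/2} \<Longrightarrow> 1/2 \<le> (1 + 1/r) / 2 * sin \<phi>"
proof -
  have s: "0 < r / (r + 1)" "r / (r + 1) < 1" using assms by auto
  have "arcsin 0 < arcsin (r / (r + 1))" using s by (intro arcsin_less_arcsin) auto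
  then show 0: "0 < peak_angle r" by (simp add: peak_angle_def)
  have "arcsin (r / (r + 1)) < arcsin 1" using s by (intro arcsin_less_arcsin) auto
  then show "peak_angle r < pi / 2" by (simp add: peak_angle_def)
  fix \<phi> assume \<phi>: "\<phi> \<in> {peak_angle r..<pi/2}"
  have "r / (r + 1) = sin (peak_angle r)" using s by (simp add: peak_angle_def)
  also have "\<dots> \<le> sin \<phi>" using \<phi> 0 by (intro sin_monotone_2pi_le) auto
  finally have "(1 + 1/r) / 2 * (r / (r + 1)) \<le> (1 + 1/r) / 2 * sin \<phi>"
    using assms by (intro mult_left_mono) auto
  moreover have "(1 + 1/r) / 2 * (r / (r + 1)) = 1/2"
  proof -
    have "1 + 1/r = (r + 1) / r" "r + 1 \<noteq> 0" "r \<noteq> 0" using assms by (auto simp: add_divide_distrib)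
    then show ?thesis by simp
  qed
  ultimately show "1/2 \<le> (1 + 1/r) / 2 * sin \<phi>" by (simp only:)
qed

context
  fixes r :: real and f :: "real \<times> real \<Rightarrow> real"
  assumes r: "r > 1" and f: "integrable lborel f" and supp: "\<And>x. x \<notin> D_region r \<Longrightarrow> f x = 0"
begin

lemma vanishes_at_origin: "f 0 = 0"
proof (rule supp)
  show "0 \<notin> D_region r" using D_region_norm(1)[OF r, of 0] by auto
qed

lemma slice_integrable: "integrable lborel (\<lambda>p. indicator {-1..1} p * (disc_transform f (p, \<phi>))\<^sup>2)"
proof -
  have "(\<lambda>p::real. (p, \<phi>)) \<in> borel_measurable borel"
    by (intro borel_measurable_continuous_onI continuous_intros)
  from measurable_compose[OF this borel_measurable_disc_transform[OF f vanishes_at_origin]]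
  have m: "(\<lambda>p. disc_transform f (p, \<phi>)) \<in> borel_measurable borel" .
  let ?B = "2 * (\<integral>x. \<bar>f x\<bar> \<partial>lborel)"
  show ?thesis
  proof (rule Bochner_Integration.integrable_bound)
    show "integrable lborel (\<lambda>p::real. indicator {-1..1} p * ?B\<^sup>2 :: real)" by simp
    have "(disc_transform f z)\<^sup>2 \<le> ?B\<^sup>2" for z
      using power_mono[OF disc_transform_bound[OF f vanishes_at_origin] abs_ge_zero, of z 2] by simp
    then show "AE p in lborel. norm (indicator {-1..1} p * (disc_transform f (p, \<phi>))\<^sup>2) \<le> norm (indicator {-1..1} p * ?B\<^sup>2 :: real)"
      unfolding norm_mult by (intro AE_I2 mult_left_mono) (simp_all only: real_norm_def abs_of_nonneg zero_le_power2 abs_ge_zero)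
    show "(\<lambda>p. indicator {-1..1} p * (disc_transform f (p, \<phi>))\<^sup>2 :: real) \<in> borel_measurable lborel"
      using m by (intro borel_measurable_times borel_measurable_power borel_measurable_indicator) simp_all
  qed
qed

lemma slice_energy_ge:
  assumes ab: "-1 \<le> a" "a \<le> b" "b \<le> 1" and eq: "\<And>p. p \<in> {a..<b} \<Longrightarrow> (disc_transform f (p, \<phi>))\<^sup>2 = v"
  shows "(b - a) * v \<le> slice_energy f \<phi>"
proof -
  have "(\<integral>p. indicator {a..<b} p * v \<partial>lborel) \<le> slice_energy f \<phi>"
    unfolding slice_energy_def
    by (rule integral_mono'[OF slice_integrable]) (use ab eq in \<open>auto simp: indicator_def\<close>)
  then show ?thesis using ab by simp
qed

lemma inverted_coord_on_support: "f x \<noteq> 0 \<Longrightarrow> \<bar>inverted_coord \<phi> x\<bar> < 1"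
  "f x \<noteq> 0 \<Longrightarrow> \<bar>inverted_coord \<phi> x - (1 + 1 / r) / 2 * sin \<phi>\<bar> < (1 - 1 / r) / 2"
  using inverted_coord_D_region[OF r] supp by blast+

text \<open>If the whole inverted disc projects to positive numbers, there is no mass on the negative
  side. Then the jump correction is minus half the total mass \<open>M\<close>, and the disc transform equals
  \<open>M/2\<close> on all of \<open>-1 \<le> p < 0\<close>.\<close>

lemma peak_slice:
  assumes \<phi>: "1/2 \<le> (1 + 1/r) / 2 * sin \<phi>"
  shows "(\<integral>x. f x \<partial>lborel)\<^sup>2 \<le> 4 * slice_energy f \<phi>" and "(jump_correction f \<phi>)\<^sup>2 \<le> slice_energy f \<phi>"
proof -
  have pos: "0 < inverted_coord \<phi> x" if "f x \<noteq> 0" for x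
  proof -
    have "(1 - 1/r) / 2 < 1/2" using r by simp
    then show ?thesis using inverted_coord_on_support(2)[OF that, of \<phi>] \<phi> by linarith
  qed
  have above: "mass_above f 0 \<phi> = (\<integral>x. f x \<partial>lborel)"
  proof -
    have "f x * of_bool (0 < inverted_coord \<phi> x) = f x" for x using pos[of x] by (cases "f x = 0") auto
    then show ?thesis unfolding mass_above_def by (simp only:)
  qed
  have below: "mass_below f p \<phi> = 0" if "p \<le> 0" for p
  proof -
    have "f x * of_bool (inverted_coord \<phi> x < p) = 0" for x using pos[of x] that by (cases "f x = 0") auto
    then show ?thesis unfolding mass_below_def by (simp only: Bochner_Integration.integral_zero)
  qed
  have c: "jump_correction f \<phi> = - (\<integral>x. f x \<partial>lborel) / 2"
    unfolding jump_correction_eq[OF f vanishes_at_origin] above below[OF order_refl] by simp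
  have "(0 - (-1)) * (jump_correction f \<phi>)\<^sup>2 \<le> slice_energy f \<phi>"
    by (rule slice_energy_ge) (auto simp: disc_transform_eq[OF f vanishes_at_origin] below)
  then show "(jump_correction f \<phi>)\<^sup>2 \<le> slice_energy f \<phi>" by simp
  then show "(\<integral>x. f x \<partial>lborel)\<^sup>2 \<le> 4 * slice_energy f \<phi>"
    unfolding c by (simp add: power_divide)
qed

text \<open>In the directions not covered by \<open>peak_slice\<close> the inverted disc projects below
  \<open>1/2 + (1 - 1/r)/2 = 1 - 1/(2r)\<close>. Beyond that value no mass is left and the disc transform reduces
  to the jump correction, on an interval of length \<open>1/(2r)\<close>.\<close>

lemma jump_correction_le: "(jump_correction f \<phi>)\<^sup>2 \<le> 2 * r * slice_energy f \<phi>"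
proof (cases "1/2 \<le> (1 + 1/r) / 2 * sin \<phi>")
  case True
  have "0 \<le> slice_energy f \<phi>" unfolding slice_energy_def by simp
  then have "1 * slice_energy f \<phi> \<le> 2 * r * slice_energy f \<phi>"
    using r by (intro mult_right_mono) auto
  then show ?thesis using peak_slice(2)[OF True] by linarith
next
  case False
  have above: "mass_above f p \<phi> = 0" if "1 - 1/(2*r) \<le> p" for p
  proof -
    have "inverted_coord \<phi> x < p" if "f x \<noteq> 0" for x
    proof -
      have "(1 - 1/r) / 2 + 1/2 = 1 - 1/(2*r)" by (simp add: diff_divide_distrib)
      define A B where "A = (1 + 1/r) / 2 * sin \<phi>" and "B = (1 - 1/r) / 2"
      have "B + 1/2 \<le> p" "\<bar>inverted_coord \<phi> x - A\<bar> < B" "A < 1/2"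
        using inverted_coord_on_support(2)[OF that, of \<phi>] False \<open>1 - 1/(2*r) \<le> p\<close> \<open>(1 - 1/r) / 2 + 1/2 = 1 - 1/(2*r)\<close>
        unfolding A_def B_def not_le by (simp_all only:)
      then show ?thesis by linarith
    qed
    then have "f x * of_bool (p < inverted_coord \<phi> x) = 0" for x by (cases "f x = 0") (auto simp: not_less less_imp_le)
    then show ?thesis unfolding mass_above_def by (simp only: Bochner_Integration.integral_zero)
  qed
  have q: "0 < 1 - 1/(2*r)" "1/(2*r) > 0" using r by (auto simp: field_simps)
  have "(1 - (1 - 1/(2*r))) * (jump_correction f \<phi>)\<^sup>2 \<le> slice_energy f \<phi>"
  proof (rule slice_energy_ge)
    fix p assume p: "p \<in> {1 - 1/(2*r)..<1}"
    have "0 < p" using p q(1) unfolding atLeastLessThan_iff by linarith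
    moreover have "mass_above f p \<phi> = 0" by (rule above) (use p in simp)
    ultimately show "(disc_transform f (p, \<phi>))\<^sup>2 = (jump_correction f \<phi>)\<^sup>2"
      by (simp add: disc_transform_eq[OF f vanishes_at_origin])
  qed (use q in linarith)+
  then show ?thesis using r by (simp add: field_simps)
qed

text \<open>With \<open>G = \<D>f\<close>, total mass \<open>M\<close> and jump correction \<open>c\<close>, the half-plane mass is
  \<open>G - c\<close> for \<open>p > 0\<close> and \<open>M - G - c\<close> for \<open>p < 0\<close>.\<close>

lemma upper_mass_energy_le:
  "(\<integral>p. (indicator {-1..1} p * upper_mass f (inverted_coord \<phi>) p)\<^sup>2 \<partial>lborel)
    \<le> 6 * (\<integral>x. f x \<partial>lborel)\<^sup>2 + 6 * (jump_correction f \<phi>)\<^sup>2 + 3 * slice_energy f \<phi>"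
proof -
  let ?M = "\<integral>x. f x \<partial>lborel" and ?c = "jump_correction f \<phi>"
  let ?G = "\<lambda>p. indicator {-1..1} p * (disc_transform f (p, \<phi>))\<^sup>2 :: real"
  have s_bound: "f x \<noteq> 0 \<Longrightarrow> -1 \<le> inverted_coord \<phi> x \<and> inverted_coord \<phi> x \<le> 1" for x
    using inverted_coord_on_support(1)[of x \<phi>] by auto
  note um = upper_mass_window_integrable(2)[OF f borel_measurable_inverted_coord s_bound]
  have i: "integrable lborel (\<lambda>p. indicator {-1..1} p * (3 * (?M\<^sup>2 + ?c\<^sup>2)) + 3 * ?G p)"
    using slice_integrable[of \<phi>] by simp
  have "(\<integral>p. (indicator {-1..1} p * upper_mass f (inverted_coord \<phi>) p)\<^sup>2 \<partial>lborel)
      \<le> (\<integral>p. indicator {-1..1} p * (3 * (?M\<^sup>2 + ?c\<^sup>2)) + 3 * ?G p \<partial>lborel)"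
  proof (rule integral_mono_AE[OF um i])
    have "AE p in lborel. p \<noteq> (0::real)" by (rule AE_lborel_singleton)
    then show "AE p in lborel. (indicator {-1..1} p * upper_mass f (inverted_coord \<phi>) p)\<^sup>2
        \<le> indicator {-1..1} p * (3 * (?M\<^sup>2 + ?c\<^sup>2)) + 3 * ?G p"
    proof eventually_elim
      case (elim p)
      define g where "g = disc_transform f (p, \<phi>)"
      have "\<bar>upper_mass f (inverted_coord \<phi>) p\<bar> \<le> \<bar>?M\<bar> + \<bar>?c\<bar> + \<bar>g\<bar>"
      proof (cases "p > 0")
        case True
        then have "g = upper_mass f (inverted_coord \<phi>) p + ?c"
          by (simp add: g_def disc_transform_eq[OF f vanishes_at_origin] upper_mass_inverted_coord(1)[OF f])
        then show ?thesis by linarith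
      next
        case False
        then have "g = ?M - upper_mass f (inverted_coord \<phi>) p - ?c"
          using elim by (simp add: g_def disc_transform_eq[OF f vanishes_at_origin] upper_mass_inverted_coord(2)[OF f])
        then show ?thesis by linarith
      qed
      then have "(upper_mass f (inverted_coord \<phi>) p)\<^sup>2 \<le> (\<bar>?M\<bar> + \<bar>?c\<bar> + \<bar>g\<bar>)\<^sup>2"
        by (metis abs_ge_zero power2_abs power_mono)
      also have "\<dots> \<le> 3 * (\<bar>?M\<bar>\<^sup>2 + \<bar>?c\<bar>\<^sup>2 + \<bar>g\<bar>\<^sup>2)"
        by (rule power2_sum3_le)
      finally show ?case by (simp add: g_def indicator_def)
    qed
  qed
  also have "\<dots> = 2 * (3 * (?M\<^sup>2 + ?c\<^sup>2)) + 3 * slice_energy f \<phi>"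
    using slice_integrable[of \<phi>] by (simp add: slice_energy_def)
  finally show ?thesis by simp
qed

lemma slice_data_bound:
  "(\<integral>x. f x \<partial>lborel)\<^sup>2 + (\<integral>p. (indicator {-1..1} p * upper_mass f (inverted_coord \<phi>) p)\<^sup>2 \<partial>lborel)
    \<le> 7 * (\<integral>x. f x \<partial>lborel)\<^sup>2 + (12 * r + 3) * slice_energy f \<phi>"
  using upper_mass_energy_le[of \<phi>] jump_correction_le[of \<phi>] by (simp add: algebra_simps)

lemma cylinder_integrable:
  "integrable lborel (\<lambda>z. indicator cylinder z * (disc_transform f z)\<^sup>2)"
proof (rule Bochner_Integration.integrable_bound)
  note [measurable] = borel_measurable_disc_transform[OF f vanishes_at_origin]
  have cyl[measurable]: "cylinder \<in> sets borel"
    unfolding cylinder_def by (rule borel_Times) auto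
  have "cylinder \<subseteq> cbox (-1, 0) (1, 2 * pi)"
    by (auto simp: cylinder_def cbox_Pair_eq)
  then have "emeasure lborel cylinder \<le> emeasure lborel (cbox (-1, 0) (1, 2 * pi) :: (real \<times> real) set)"
    by (intro emeasure_mono) auto
  also have "\<dots> < \<infinity>" by (rule emeasure_lborel_cbox_finite)
  finally have "integrable lborel (indicator cylinder :: _ \<Rightarrow> real)"
    by (intro integrable_real_indicator) auto
  let ?B = "2 * (\<integral>x. \<bar>f x\<bar> \<partial>lborel)"
  show "integrable lborel (\<lambda>z. indicator cylinder z * ?B\<^sup>2 :: real)"
    using \<open>integrable lborel (indicator cylinder)\<close> by simp
  have "(disc_transform f z)\<^sup>2 \<le> ?B\<^sup>2" for z
    using power_mono[OF disc_transform_bound[OF f vanishes_at_origin] abs_ge_zero, of z 2] by simp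
  then show "AE z in lborel. norm (indicator cylinder z * (disc_transform f z)\<^sup>2) \<le> norm (indicator cylinder z * ?B\<^sup>2 :: real)"
    unfolding norm_mult by (intro AE_I2 mult_left_mono) (simp_all only: real_norm_def abs_of_nonneg zero_le_power2 abs_ge_zero)
  show "(\<lambda>z. indicator cylinder z * (disc_transform f z)\<^sup>2) \<in> borel_measurable lborel"
    by measurable
qed

lemma slice_energy_integral:
  "integrable lborel (\<lambda>\<phi>. indicator {0<..<pi} \<phi> * slice_energy f \<phi>)"
  "(\<integral>\<phi>. indicator {0<..<pi} \<phi> * slice_energy f \<phi> \<partial>lborel) \<le> cylinder_energy f"
proof -
  let ?F = "\<lambda>z. indicator cylinder z * (disc_transform f z)\<^sup>2 :: real"
  have iF: "integrable (lborel \<Otimes>\<^sub>M lborel) (case_prod (\<lambda>p \<phi>. ?F (p, \<phi>)))"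
    using cylinder_integrable by (simp add: lborel_prod split_beta')
  let ?g = "\<lambda>\<phi>. \<integral>p. ?F (p, \<phi>) \<partial>lborel"
  have ig: "integrable lborel ?g" by (rule lborel_pair.integrable_snd[OF iF])
  have g: "?g \<phi> = indicator {0..<2*pi} \<phi> * slice_energy f \<phi>" for \<phi>
  proof -
    have "?F (p, \<phi>) = indicator {0..<2*pi} \<phi> * (indicator {-1..1} p * (disc_transform f (p, \<phi>))\<^sup>2)" for p
      by (auto simp: cylinder_def indicator_def)
    then show ?thesis unfolding slice_energy_def by (simp only: integral_mult_right_zero)
  qed
  have nonneg: "0 \<le> slice_energy f \<phi>" for \<phi> unfolding slice_energy_def by simp
  have e: "indicator {0<..<pi} \<phi> * slice_energy f \<phi> = indicator {0<..<pi} \<phi> * ?g \<phi>" for \<phi>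
    unfolding g by (auto simp: indicator_def)
  show i: "integrable lborel (\<lambda>\<phi>. indicator {0<..<pi} \<phi> * slice_energy f \<phi>)"
    unfolding e using integrable_mult_indicator[OF _ ig, of "{0<..<pi}"] by simp
  have "(\<integral>\<phi>. indicator {0<..<pi} \<phi> * slice_energy f \<phi> \<partial>lborel) \<le> (\<integral>\<phi>. ?g \<phi> \<partial>lborel)"
    by (rule integral_mono[OF i ig], unfold g) (auto simp: nonneg split: split_indicator)
  also have "\<dots> = cylinder_energy f"
    using lborel_pair.integral_snd[OF iF] by (simp add: cylinder_energy_def lborel_prod split_beta')
  finally show "(\<integral>\<phi>. indicator {0<..<pi} \<phi> * slice_energy f \<phi> \<partial>lborel) \<le> cylinder_energy f" .
qed

text \<open>The directions in which \<open>peak_slice\<close> determines the total mass fill an interval of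
  positive length.\<close>

lemma total_mass_le:
  "(pi / 2 - peak_angle r) * (\<integral>x. f x \<partial>lborel)\<^sup>2 \<le> 4 * cylinder_energy f"
proof -
  let ?I = "{peak_angle r..<pi/2}"
  note pk = peak_angle[OF r]
  have nonneg: "0 \<le> slice_energy f \<phi>" for \<phi> unfolding slice_energy_def by simp
  have "(\<integral>\<phi>. indicator ?I \<phi> * (\<integral>x. f x \<partial>lborel)\<^sup>2 \<partial>lborel)
      \<le> (\<integral>\<phi>. 4 * (indicator {0<..<pi} \<phi> * slice_energy f \<phi>) \<partial>lborel)"
  proof (rule integral_mono')
    fix \<phi>
    show "indicator ?I \<phi> * (\<integral>x. f x \<partial>lborel)\<^sup>2 \<le> 4 * (indicator {0<..<pi} \<phi> * slice_energy f \<phi>)"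
    proof (cases "\<phi> \<in> ?I")
      case True
      then have "\<phi> \<in> {0<..<pi}" using pk(1,2) by auto
      then show ?thesis using True peak_slice(1)[OF pk(3)[OF True]] by simp
    qed (simp add: nonneg)
  qed (use slice_energy_integral(1) nonneg in auto)
  then show ?thesis using pk(2) slice_energy_integral(2) by simp
qed

text \<open>Polar coordinates turn the Fourier side of the Gaussian form into the ray
  energies of \<open>ray_energy_bound\<close>. Only the directions \<open>0 < \<phi> < \<pi>\<close> occur, half of the cylinder. By
  \<open>slice_data_bound\<close> each of them costs a multiple of the squared total mass and of its share of the
  data, and \<open>total_mass_le\<close> charges the former to the data as well.\<close>

theorem inverted_energy_le_cylinder_energy:
  assumes t: "0 < t" "t \<le> 1"
  shows "(\<integral>(x, y). f x * f y * gauss t (inversion x - inversion y) \<partial>(lborel \<Otimes>\<^sub>M lborel))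
    \<le> 8 / pi * (28 * pi / (pi / 2 - peak_angle r) + 12 * r + 3) / t ^ 3 * cylinder_energy f"
proof -
  let ?M2 = "(\<integral>x. f x \<partial>lborel)\<^sup>2"
  let ?N = "\<lambda>\<xi>. \<integral>x. f x * cis (- (\<xi> \<bullet> inversion x)) \<partial>lborel"
  let ?g = "\<lambda>\<xi>::real \<times> real. exp (-(t\<^sup>2 * (norm \<xi>)\<^sup>2 / 2)) * (cmod (?N \<xi>))\<^sup>2"
  let ?h = "\<lambda>\<phi>. 32 * pi / t ^ 3 * (7 * ?M2 * indicator {0<..<pi} \<phi> + (12 * r + 3) * (indicator {0<..<pi} \<phi> * slice_energy f \<phi>)) :: real"
  have [measurable]: "f \<in> borel_measurable borel" using f by auto
  have nonneg: "0 \<le> slice_energy f \<phi>" for \<phi> unfolding slice_energy_def by simp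
  have pos: "0 < pi / 2 - peak_angle r" using peak_angle[OF r] by simp
  note E = gaussian_energy[OF f borel_measurable_inversion t(1)]
  have slice: "(\<integral>\<^sup>+\<sigma>. ennreal (\<bar>\<sigma>\<bar> * ?g (\<sigma> * cos \<phi>, \<sigma> * sin \<phi>)) \<partial>lborel) * indicator {0<..<pi} \<phi> \<le> ennreal (?h \<phi>)" for \<phi>
  proof (cases "\<phi> \<in> {0<..<pi}")
    case True
    have s_bound: "f x \<noteq> 0 \<Longrightarrow> -1 \<le> inverted_coord \<phi> x \<and> inverted_coord \<phi> x \<le> 1" for x
      using inverted_coord_on_support(1)[of x \<phi>] by auto
    have polar: "(\<sigma> * cos \<phi>, \<sigma> * sin \<phi>) \<bullet> inversion x = \<sigma> * inverted_coord \<phi> x" for \<sigma> x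
      using inner_scaleR_left[of \<sigma> "(cos \<phi>, sin \<phi>)" "inversion x"] unfolding inverted_coord_def by simp
    have n: "(norm (\<sigma> * cos \<phi>, \<sigma> * sin \<phi>))\<^sup>2 = \<sigma>\<^sup>2" for \<sigma>
      unfolding norm_prod_power2 by (simp add: power_mult_distrib distrib_left[symmetric])
    have "(\<integral>\<^sup>+\<sigma>. ennreal (\<bar>\<sigma>\<bar> * ?g (\<sigma> * cos \<phi>, \<sigma> * sin \<phi>)) \<partial>lborel)
        \<le> ennreal (32 * pi / t ^ 3 * (?M2 + (\<integral>p. (indicator {-1..1} p * upper_mass f (inverted_coord \<phi>) p)\<^sup>2 \<partial>lborel)))"
      unfolding polar n by (rule ray_energy_bound[OF f borel_measurable_inverted_coord s_bound t])
    also have "\<dots> \<le> ennreal (32 * pi / t ^ 3 * (7 * ?M2 + (12 * r + 3) * slice_energy f \<phi>))"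
      using t by (intro ennreal_leI mult_left_mono slice_data_bound) auto
    finally show ?thesis using True by simp
  qed simp
  have ih: "integrable lborel ?h"
    by (intro integrable_mult_right Bochner_Integration.integrable_add slice_energy_integral(1)) simp
  have "ennreal (\<integral>\<xi>. ?g \<xi> \<partial>lborel) = (\<integral>\<^sup>+\<xi>. ?g \<xi> \<partial>lborel)"
    by (rule nn_integral_eq_integral[OF E(1), symmetric]) simp
  also have "\<dots> = (\<integral>\<^sup>+\<phi>. (\<integral>\<^sup>+\<sigma>. ennreal (\<bar>\<sigma>\<bar> * ?g (\<sigma> * cos \<phi>, \<sigma> * sin \<phi>)) \<partial>lborel) * indicator {0<..<pi} \<phi> \<partial>lborel)"
    by (rule nn_integral_polar_half_circle) (use borel_measurable_integrable[OF E(1)] in simp_all)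
  also have "\<dots> \<le> (\<integral>\<^sup>+\<phi>. ennreal (?h \<phi>) \<partial>lborel)"
    by (intro nn_integral_mono slice)
  also have "\<dots> = ennreal (\<integral>\<phi>. ?h \<phi> \<partial>lborel)"
    using t r nonneg by (intro nn_integral_eq_integral ih AE_I2 mult_nonneg_nonneg add_nonneg_nonneg) auto
  finally have "(\<integral>\<xi>. ?g \<xi> \<partial>lborel) \<le> (\<integral>\<phi>. ?h \<phi> \<partial>lborel)"
    using t r nonneg
    by (subst (asm) ennreal_le_iff) (auto intro!: Bochner_Integration.integral_nonneg mult_nonneg_nonneg add_nonneg_nonneg)
  also have "\<dots> = 32 * pi / t ^ 3 * (7 * pi * ?M2 + (12 * r + 3) * (\<integral>\<phi>. indicator {0<..<pi} \<phi> * slice_energy f \<phi> \<partial>lborel))"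
    using slice_energy_integral(1) by simp
  also have "\<dots> \<le> 32 * pi / t ^ 3 * (7 * pi * (4 * cylinder_energy f / (pi / 2 - peak_angle r)) + (12 * r + 3) * cylinder_energy f)"
  proof (intro mult_left_mono add_mono slice_energy_integral(2))
    show "?M2 \<le> 4 * cylinder_energy f / (pi / 2 - peak_angle r)"
      using total_mass_le pos by (simp add: pos_le_divide_eq mult.commute)
  qed (use r t in auto)
  also have "\<dots> = (2 * pi)\<^sup>2 * (8 / pi * (28 * pi / (pi / 2 - peak_angle r) + 12 * r + 3) / t ^ 3 * cylinder_energy f)"
  proof -
    define k m e :: real where "k = 12 * r + 3" and "m = pi / 2 - peak_angle r" and "e = cylinder_energy f"
    have "32 * pi / t ^ 3 * (7 * pi * (4 * e / m) + k * e) = 32 * pi / t ^ 3 * ((28 * pi / m + k) * e)"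
      by (simp add: distrib_right)
    also have "\<dots> = (2 * pi)\<^sup>2 * (8 / pi * (28 * pi / m + k) / t ^ 3 * e)"
      by (simp add: power2_eq_square)
    finally show ?thesis unfolding k_def m_def e_def by (simp only: add.assoc)
  qed
  finally show ?thesis
    unfolding E(2) split_beta' by (rule mult_left_le_imp_le) simp
qed

end

section \<open>The trade-off between data error and smoothness\<close>

text \<open>At \<open>t = (\<epsilon>/\<rho>)\<^bsup>1/(\<beta> + 3/2)\<^esup>\<close> both terms equal the square of the claimed product of
  powers. This scale is admissible only for \<open>\<epsilon> \<le> \<rho>\<close>; otherwise the trivial bound is already of that
  size.\<close>

lemma optimise_scale:
  fixes X A B D \<epsilon> \<rho> \<beta> :: real
  assumes pos: "\<epsilon> > 0" "\<rho> > 0" "\<beta> > 0" "A \<ge> 0" "B \<ge> 0" "D \<ge> 0"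
    and trade: "\<And>t. 0 < t \<Longrightarrow> t \<le> 1 \<Longrightarrow> X \<le> A * (\<epsilon>\<^sup>2 / t ^ 3) + B * (t powr (2 * \<beta>) * \<rho>\<^sup>2)"
    and trivial: "X \<le> D * \<rho>\<^sup>2"
  shows "X \<le> (A + B + D) * (\<rho> powr ((3 / 2) / (\<beta> + 3 / 2)) * \<epsilon> powr (\<beta> / (\<beta> + 3 / 2)))\<^sup>2"
proof -
  define \<gamma> where "\<gamma> = \<beta> + 3 / 2"
  have \<gamma>: "\<gamma> > 0" using pos by (simp add: \<gamma>_def)
  define Q2 where "Q2 = (\<rho> powr ((3 / 2) / (\<beta> + 3 / 2)) * \<epsilon> powr (\<beta> / (\<beta> + 3 / 2)))\<^sup>2"
  have sq: "(x powr a)\<^sup>2 = x powr (2 * a)" if "x > 0" for x a :: real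
    using that by (simp add: power2_eq_square powr_add[symmetric])
  have Q2: "Q2 = \<rho> powr (3 / \<gamma>) * \<epsilon> powr (2 * \<beta> / \<gamma>)"
    unfolding Q2_def power_mult_distrib sq[OF pos(1)] sq[OF pos(2)] \<gamma>_def[symmetric] by simp
  have ex: "2 = 3 / \<gamma> + 2 * \<beta> / \<gamma>"
  proof -
    have "3 + 2 * \<beta> = 2 * \<gamma>" by (simp add: \<gamma>_def)
    then show ?thesis using \<gamma> by (simp add: add_divide_distrib[symmetric])
  qed
  have split: "x\<^sup>2 = x powr (3 / \<gamma>) * x powr (2 * \<beta> / \<gamma>)" if "x > 0" for x :: real
  proof -
    have "x\<^sup>2 = x powr 2" using that by simp
    also have "\<dots> = x powr (3 / \<gamma> + 2 * \<beta> / \<gamma>)" using ex by (rule arg_cong)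
    finally show ?thesis by (simp only: powr_add)
  qed
  have "0 \<le> Q2" by (simp add: Q2_def)
  show ?thesis
  proof (cases "\<epsilon> \<le> \<rho>")
    case True
    define t where "t = (\<epsilon> / \<rho>) powr (1 / \<gamma>)"
    have t: "0 < t" "t \<le> 1"
      using pos True \<gamma> by (auto simp: t_def intro!: powr_le1)
    have t3: "t ^ 3 = \<epsilon> powr (3 / \<gamma>) / \<rho> powr (3 / \<gamma>)"
    proof -
      have "t ^ 3 = t powr 3" using t by simp
      also have "\<dots> = (\<epsilon> / \<rho>) powr (3 / \<gamma>)" by (simp add: t_def powr_powr)
      also have "\<dots> = \<epsilon> powr (3 / \<gamma>) / \<rho> powr (3 / \<gamma>)" using pos by (simp add: powr_divide)
      finally show ?thesis .
    qed
    have "t powr (2 * \<beta>) = (\<epsilon> / \<rho>) powr (2 * \<beta> / \<gamma>)" by (simp add: t_def powr_powr)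
    also have "\<dots> = \<epsilon> powr (2 * \<beta> / \<gamma>) / \<rho> powr (2 * \<beta> / \<gamma>)" using pos by (simp add: powr_divide)
    finally have tb: "t powr (2 * \<beta>) = \<epsilon> powr (2 * \<beta> / \<gamma>) / \<rho> powr (2 * \<beta> / \<gamma>)" .
    have "\<epsilon>\<^sup>2 / t ^ 3 = Q2"
      unfolding Q2 t3 split[OF pos(1)] using pos by simp
    moreover have "t powr (2 * \<beta>) * \<rho>\<^sup>2 = Q2"
      unfolding Q2 tb split[OF pos(2)] using pos by simp
    ultimately have "X \<le> A * Q2 + B * Q2" using trade[OF t] by simp
    also have "\<dots> \<le> (A + B + D) * Q2" using pos(6) \<open>0 \<le> Q2\<close> by (simp add: distrib_right)
    finally show ?thesis unfolding Q2_def .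
  next
    case False
    have "\<rho>\<^sup>2 \<le> Q2"
      unfolding Q2 split[OF pos(2)] using False pos \<gamma> by (intro mult_left_mono powr_mono2) auto
    then have "X \<le> D * Q2" using trivial pos(6) mult_left_mono[of "\<rho>\<^sup>2" Q2 D] by linarith
    also have "\<dots> \<le> (A + B + D) * Q2" using pos \<open>0 \<le> Q2\<close> by (simp add: distrib_right)
    finally show ?thesis unfolding Q2_def .
  qed
qed

lemma lipschitz_supported_facts:
  fixes f :: "real \<times> real \<Rightarrow> real"
  assumes r: "r > 1" and lip: "\<And>x y. \<bar>f x - f y\<bar> \<le> L * norm (x - y)"
    and supp: "\<And>x. x \<notin> D_region r \<Longrightarrow> f x = 0"
  shows "integrable lborel f" "integrable lborel (\<lambda>x. (f x)\<^sup>2)"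
    "\<And>s. s > 0 \<Longrightarrow> gauss_modulus s f \<le> 8 * L\<^sup>2 * measure lborel (ball (0 :: real \<times> real) r) * s\<^sup>2"
proof -
  let ?S = "ball (0 :: real \<times> real) r"
  have suppS: "f x = 0" if "x \<notin> ?S" for x
    using supp[of x] D_region_norm(2)[OF r, of x] that by auto
  have "\<bar>L\<bar>-lipschitz_on UNIV f"
  proof (rule lipschitz_onI)
    fix x y
    have "\<bar>f x - f y\<bar> \<le> L * norm (x - y)" by (rule lip)
    also have "\<dots> \<le> \<bar>L\<bar> * norm (x - y)" by (intro mult_right_mono) auto
    finally show "dist (f x) (f y) \<le> \<bar>L\<bar> * dist x y" by (simp add: dist_norm)
  qed simp
  then have cont: "continuous_on UNIV f" by (rule lipschitz_on_continuous_on)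
  then have [measurable]: "f \<in> borel_measurable borel" by (rule borel_measurable_continuous_onI)
  have fin: "emeasure lborel ?S < \<infinity>" by (rule emeasure_lborel_ball_finite)
  then have iS: "integrable lborel (\<lambda>x. c * indicator ?S x :: real)" for c by simp
  have f0: "f 0 = 0"
    using supp[of 0] D_region_norm(1)[OF r, of 0] by auto
  have bound: "\<bar>f x\<bar> \<le> \<bar>L\<bar> * r" for x
  proof (cases "x \<in> ?S")
    case True
    have "\<bar>f x\<bar> \<le> L * norm x" using lip[of x 0] f0 by simp
    also have "\<dots> \<le> \<bar>L\<bar> * r" using True by (intro mult_mono) auto
    finally show ?thesis .
  qed (use suppS r in simp)
  show f: "integrable lborel f"
  proof (rule Bochner_Integration.integrable_bound[OF iS])
    show "AE x in lborel. norm (f x) \<le> norm (\<bar>L\<bar> * r * indicator ?S x)"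
    proof (rule AE_I2)
      fix x show "norm (f x) \<le> norm (\<bar>L\<bar> * r * indicator ?S x)"
        using bound[of x] suppS[of x] r by (cases "x \<in> ?S") (simp_all add: abs_mult del: mem_ball)
    qed
  qed simp
  show f2: "integrable lborel (\<lambda>x. (f x)\<^sup>2)"
  proof (rule Bochner_Integration.integrable_bound)
    show "integrable lborel (\<lambda>x. \<bar>L\<bar> * r * \<bar>f x\<bar>)" using f by simp
    show "AE x in lborel. norm ((f x)\<^sup>2) \<le> norm (\<bar>L\<bar> * r * \<bar>f x\<bar>)"
    proof (rule AE_I2)
      fix x
      have "\<bar>f x\<bar> * \<bar>f x\<bar> \<le> (\<bar>L\<bar> * r) * \<bar>f x\<bar>" by (intro mult_right_mono bound) auto
      also have "\<dots> \<le> norm (\<bar>L\<bar> * r * \<bar>f x\<bar>)" by simp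
      finally show "norm ((f x)\<^sup>2) \<le> norm (\<bar>L\<bar> * r * \<bar>f x\<bar>)" by (simp add: power2_eq_square abs_mult)
    qed
  qed simp
  show "gauss_modulus s f \<le> 8 * L\<^sup>2 * measure lborel ?S * s\<^sup>2" if "s > 0" for s
    by (rule gauss_modulus_lipschitz[OF _ f2 that lip _ fin suppS]) simp_all
qed

theorem stability_trade_off:
  fixes f :: "real \<times> real \<Rightarrow> real"
  assumes r: "r > 1" and \<beta>: "0 < \<beta>" "\<beta> < 1"
    and lip: "\<And>x y. \<bar>f x - f y\<bar> \<le> L * norm (x - y)"
    and supp: "\<And>x. x \<notin> D_region r \<Longrightarrow> f x = 0" and t: "0 < t" "t \<le> 1"
  shows "(\<integral>x. (f x)\<^sup>2 \<partial>lborel)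
    \<le> 8 * exp (1/2) * (8 / pi * (28 * pi / (pi / 2 - peak_angle r) + 12 * r + 3)) * (cylinder_energy f / t ^ 3)
      + 8 * exp (1/2) * ((r + 1) ^ 4 * ((r + 1)\<^sup>2) powr (2 * \<beta>)) * (t powr (2 * \<beta>) * (sobolev_norm \<beta> f)\<^sup>2)"
proof -
  note F = lipschitz_supported_facts[OF r lip supp]
  let ?R = "(r + 1)\<^sup>2"
  have Rt: "?R * t > 0" using r t by simp
  define A where "A = 8 / pi * (28 * pi / (pi / 2 - peak_angle r) + 12 * r + 3)"
  have "exp (-1/2) / 8 * (\<integral>x. (f x)\<^sup>2 \<partial>lborel)
      \<le> (\<integral>(x, y). f x * f y * gauss t (inversion x - inversion y) \<partial>(lborel \<Otimes>\<^sub>M lborel)) + (r + 1) ^ 4 * gauss_modulus (?R * t) f"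
    by (rule L2_le_inverted_energy[OF r F(1,2) supp t])
  also have "\<dots> \<le> A / t ^ 3 * cylinder_energy f + (r + 1) ^ 4 * ((?R * t) powr (2 * \<beta>) * (sobolev_norm \<beta> f)\<^sup>2)"
    unfolding A_def
    using r by (intro add_mono mult_left_mono inverted_energy_le_cylinder_energy[OF r F(1) supp t]
        sobolev_bounds(3)[OF F \<beta> Rt]) auto
  also have "(?R * t) powr (2 * \<beta>) = ?R powr (2 * \<beta>) * t powr (2 * \<beta>)"
    using t by (simp add: powr_mult)
  finally have "8 * exp (1/2) * (exp (-1/2) / 8 * (\<integral>x. (f x)\<^sup>2 \<partial>lborel))
    \<le> 8 * exp (1/2) * (A / t ^ 3 * cylinder_energy f + (r + 1) ^ 4 * (?R powr (2 * \<beta>) * t powr (2 * \<beta>) * (sobolev_norm \<beta> f)\<^sup>2))"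
    by (rule mult_left_mono) simp
  moreover have "8 * exp (1/2) * (exp (-1/2) / 8 * x) = x" for x :: real
    by (simp add: exp_add[symmetric] flip: mult.assoc)
  moreover have "k * (a / c * e + p * (q * u * v)) = k * a * (e / c) + k * (p * q) * (u * v)" for k a c e p q u v :: real
    by (simp add: distrib_left)
  ultimately show ?thesis unfolding A_def[symmetric] by (simp only:)
qed

text \<open>The norms of the statement are integrals for the completed measure restricted to a
  set; for Borel functions they reduce to integrals over the whole space for \<open>lborel\<close>.\<close>

lemma lebesgue_on_borel:
  fixes g :: "'a::euclidean_space \<Rightarrow> real"
  assumes S: "S \<in> sets borel" and g: "g \<in> borel_measurable borel"
  shows "integral\<^sup>L (lebesgue_on S) g = (\<integral>x. indicator S x * g x \<partial>lborel)"
    and "integrable (lebesgue_on S) g \<longleftrightarrow> integrable lborel (\<lambda>x. indicator S x * g x)"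
proof -
  have m: "(\<lambda>x. indicator S x *\<^sub>R g x) \<in> borel_measurable lborel" using S g by simp
  have S': "S \<inter> space lebesgue \<in> sets lebesgue" using S by simp
  show "integral\<^sup>L (lebesgue_on S) g = (\<integral>x. indicator S x * g x \<partial>lborel)"
    using integral_restrict_space[OF S', of g] integral_completion[OF m] by simp
  show "integrable (lebesgue_on S) g \<longleftrightarrow> integrable lborel (\<lambda>x. indicator S x * g x)"
    using integrable_restrict_space[OF S', of g] integrable_completion[OF m] by simp
qed

lemma cylinder_borel: "cylinder \<in> sets borel"
  unfolding cylinder_def by (rule borel_Times) auto

lemma C0_D_region_facts:
  assumes r: "r > 1" and f: "f \<in> C0_infinity (D_region r)"
  shows "\<exists>L. \<forall>x y. \<bar>f x - f y\<bar> \<le> L * norm (x - y)"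
    and "x \<notin> D_region r \<Longrightarrow> f x = 0"
proof -
  show "\<exists>L. \<forall>x y. \<bar>f x - f y\<bar> \<le> L * norm (x - y)"
    using C0_infinity_lipschitz[OF f] by metis
  show "f x = 0" if "x \<notin> D_region r"
    using that f closure_subset[of "{x. f x \<noteq> 0}"] by (auto simp: C0_infinity_def)
qed

text \<open>The triangle inequality in squared form. It needs the disc transforms to be
  square integrable on the cylinder, since a non-integrable square would have norm \<open>0\<close>.\<close>

lemma cylinder_energy_diff_le:
  assumes r: "r > 1" and f1: "f1 \<in> C0_infinity (D_region r)" and f2: "f2 \<in> C0_infinity (D_region r)"
    and g: "g \<in> L2_on cylinder"
    and d1: "L2_norm_on cylinder (\<lambda>z. disc_transform f1 z - g z) < \<epsilon>"
    and d2: "L2_norm_on cylinder (\<lambda>z. disc_transform f2 z - g z) < \<epsilon>"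
  shows "cylinder_energy (\<lambda>x. f1 x - f2 x) \<le> 4 * \<epsilon>\<^sup>2"
proof -
  let ?\<mu> = "lebesgue_on cylinder"
  have g2: "g \<in> borel_measurable ?\<mu>" "integrable ?\<mu> (\<lambda>z. (g z)\<^sup>2)" using g by (auto simp: L2_on_def)
  have facts: "integrable lborel f" "f 0 = 0" "disc_transform f \<in> borel_measurable borel"
      "integrable ?\<mu> (\<lambda>z. (disc_transform f z)\<^sup>2)" "disc_transform f \<in> borel_measurable ?\<mu>"
    if f: "f \<in> C0_infinity (D_region r)" for f
  proof -
    obtain L where L: "\<And>x y. \<bar>f x - f y\<bar> \<le> L * norm (x - y)" using C0_D_region_facts(1)[OF r f] by blast
    note supp = C0_D_region_facts(2)[OF r f]
    show i: "integrable lborel f" by (rule lipschitz_supported_facts(1)[OF r L supp])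
    show z: "f 0 = 0" by (rule vanishes_at_origin[OF r i supp])
    show m: "disc_transform f \<in> borel_measurable borel" by (rule borel_measurable_disc_transform[OF i z])
    then have "(\<lambda>z. (disc_transform f z)\<^sup>2) \<in> borel_measurable borel" by simp
    then show "integrable ?\<mu> (\<lambda>z. (disc_transform f z)\<^sup>2)"
      using lebesgue_on_borel(2)[OF cylinder_borel] cylinder_integrable[OF r i supp] by blast
    show "disc_transform f \<in> borel_measurable ?\<mu>"
      using m by (intro measurable_restrict_space1 measurable_completion) simp
  qed
  have sq: "integrable ?\<mu> (\<lambda>z. (disc_transform f z - g z)\<^sup>2)" if f: "f \<in> C0_infinity (D_region r)" for f
  proof (rule Bochner_Integration.integrable_bound)
    show "integrable ?\<mu> (\<lambda>z. 2 * (disc_transform f z)\<^sup>2 + 2 * (g z)\<^sup>2)"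
      using facts(4)[OF f] g2(2) by simp
    show "(\<lambda>z. (disc_transform f z - g z)\<^sup>2) \<in> borel_measurable ?\<mu>"
      using facts(5)[OF f] g2(1) by simp
    have "(a - b)\<^sup>2 \<le> 2 * a\<^sup>2 + 2 * b\<^sup>2" for a b :: real
      using zero_le_power2[of "a + b"] by (simp add: power2_eq_square algebra_simps)
    then show "AE z in ?\<mu>. norm ((disc_transform f z - g z)\<^sup>2) \<le> norm (2 * (disc_transform f z)\<^sup>2 + 2 * (g z)\<^sup>2)"
      by (intro AE_I2) (simp add: order_trans[OF _ abs_ge_self])
  qed
  have small: "(\<integral>z. (disc_transform f z - g z)\<^sup>2 \<partial>?\<mu>) \<le> \<epsilon>\<^sup>2"
    if "L2_norm_on cylinder (\<lambda>z. disc_transform f z - g z) < \<epsilon>" for f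
  proof -
    have "0 \<le> (\<integral>z. (disc_transform f z - g z)\<^sup>2 \<partial>?\<mu>)" by simp
    then show ?thesis
      using that real_sqrt_pow2[of "\<integral>z. (disc_transform f z - g z)\<^sup>2 \<partial>?\<mu>"]
        power_mono[of "sqrt (\<integral>z. (disc_transform f z - g z)\<^sup>2 \<partial>?\<mu>)" \<epsilon> 2]
      unfolding L2_norm_on_def by simp
  qed
  note F1 = facts[OF f1] and F2 = facts[OF f2]
  have dd: "disc_transform (\<lambda>x. f1 x - f2 x) z = disc_transform f1 z - disc_transform f2 z" for z
    by (rule disc_transform_diff[OF F1(1,2) F2(1,2)])
  have md: "(\<lambda>z. (disc_transform f1 z - disc_transform f2 z)\<^sup>2) \<in> borel_measurable borel"
    using F1(3) F2(3) by simp
  have pt: "(a - b)\<^sup>2 \<le> 2 * (a - c)\<^sup>2 + 2 * (b - c)\<^sup>2" for a b c :: real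
    using zero_le_power2[of "(a - c) + (b - c)"] by (simp add: power2_eq_square algebra_simps)
  have "cylinder_energy (\<lambda>x. f1 x - f2 x) = (\<integral>z. (disc_transform f1 z - disc_transform f2 z)\<^sup>2 \<partial>?\<mu>)"
    unfolding cylinder_energy_def dd lebesgue_on_borel(1)[OF cylinder_borel md] ..
  also have "\<dots> \<le> (\<integral>z. 2 * (disc_transform f1 z - g z)\<^sup>2 + 2 * (disc_transform f2 z - g z)\<^sup>2 \<partial>?\<mu>)"
    by (rule integral_mono') (use sq[OF f1] sq[OF f2] pt in auto)
  also have "\<dots> = 2 * (\<integral>z. (disc_transform f1 z - g z)\<^sup>2 \<partial>?\<mu>) + 2 * (\<integral>z. (disc_transform f2 z - g z)\<^sup>2 \<partial>?\<mu>)"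
    using sq[OF f1] sq[OF f2] by simp
  also have "\<dots> \<le> 4 * \<epsilon>\<^sup>2" using small[OF d1] small[OF d2] by linarith
  finally show ?thesis .
qed

text \<open>Integrability of the two weighted energies is what turns the pointwise inequality for
  the Fourier transforms into one for the norms.\<close>

lemma sobolev_norm_diff_le:
  assumes r: "r > 1" and \<beta>: "0 < \<beta>" "\<beta> < 1"
    and f1: "f1 \<in> C0_infinity (D_region r)" and f2: "f2 \<in> C0_infinity (D_region r)"
    and s1: "sobolev_norm \<beta> f1 \<le> \<rho>" and s2: "sobolev_norm \<beta> f2 \<le> \<rho>"
  shows "(sobolev_norm \<beta> (\<lambda>x. f1 x - f2 x))\<^sup>2 \<le> 4 * \<rho>\<^sup>2"
proof -
  let ?w = "\<lambda>\<xi>::real \<times> real. (1 + (norm \<xi>)\<^sup>2) powr \<beta>"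
  let ?I = "\<lambda>f. \<integral>\<xi>. ?w \<xi> * (cmod (fourier f \<xi>))\<^sup>2 \<partial>lborel"
  have facts: "integrable lborel f" "integrable lborel (\<lambda>\<xi>. ?w \<xi> * (cmod (fourier f \<xi>))\<^sup>2)"
    if f: "f \<in> C0_infinity (D_region r)" for f
  proof -
    obtain L where L: "\<And>x y. \<bar>f x - f y\<bar> \<le> L * norm (x - y)" using C0_D_region_facts(1)[OF r f] by blast
    note F = lipschitz_supported_facts[OF r L C0_D_region_facts(2)[OF r f]]
    show "integrable lborel f" by (rule F(1))
    show "integrable lborel (\<lambda>\<xi>. ?w \<xi> * (cmod (fourier f \<xi>))\<^sup>2)"
      by (rule sobolev_bounds(1)[OF F \<beta>])
  qed
  note F1 = facts[OF f1] and F2 = facts[OF f2]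
  have nonneg: "0 \<le> ?I f" for f by (intro Bochner_Integration.integral_nonneg) simp
  have sob: "(sobolev_norm \<beta> f)\<^sup>2 = ?I f" for f
    unfolding sobolev_norm_def by (rule real_sqrt_pow2[OF nonneg])
  have s: "?I f \<le> \<rho>\<^sup>2" if "sobolev_norm \<beta> f \<le> \<rho>" for f
  proof -
    have "0 \<le> sobolev_norm \<beta> f" unfolding sobolev_norm_def using nonneg by simp
    then show ?thesis unfolding sob[symmetric] using that by (intro power_mono)
  qed
  have ie: "integrable lborel (\<lambda>x. complex_of_real (f x) * exp (- \<i> * complex_of_real (x \<bullet> \<xi>)))"
    if f: "integrable lborel f" for f :: "real \<times> real \<Rightarrow> real" and \<xi>
  proof (rule Bochner_Integration.integrable_bound[OF f])
    have [measurable]: "f \<in> borel_measurable borel" using f by auto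
    show "(\<lambda>x. complex_of_real (f x) * exp (- \<i> * complex_of_real (x \<bullet> \<xi>))) \<in> borel_measurable lborel"
      by measurable
  qed (simp add: norm_mult)
  have lin: "fourier (\<lambda>x. f1 x - f2 x) \<xi> = fourier f1 \<xi> - fourier f2 \<xi>" for \<xi>
    unfolding fourier_def of_real_diff left_diff_distrib
    by (subst Bochner_Integration.integral_diff[OF ie[OF F1(1)] ie[OF F2(1)]]) (rule right_diff_distrib)
  have pt: "(cmod (a - b))\<^sup>2 \<le> 2 * (cmod a)\<^sup>2 + 2 * (cmod b)\<^sup>2" for a b :: complex
  proof -
    have "(cmod (a - b))\<^sup>2 \<le> (cmod a + cmod b)\<^sup>2" by (intro power_mono norm_triangle_ineq4) simp
    also have "\<dots> \<le> 2 * (cmod a)\<^sup>2 + 2 * (cmod b)\<^sup>2"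
      using sum_squares_bound[of "cmod a" "cmod b"] by (simp add: power2_sum)
    finally show ?thesis .
  qed
  have "?I (\<lambda>x. f1 x - f2 x) \<le> (\<integral>\<xi>. 2 * (?w \<xi> * (cmod (fourier f1 \<xi>))\<^sup>2) + 2 * (?w \<xi> * (cmod (fourier f2 \<xi>))\<^sup>2) \<partial>lborel)"
  proof (rule integral_mono')
    show "?w \<xi> * (cmod (fourier (\<lambda>x. f1 x - f2 x) \<xi>))\<^sup>2
        \<le> 2 * (?w \<xi> * (cmod (fourier f1 \<xi>))\<^sup>2) + 2 * (?w \<xi> * (cmod (fourier f2 \<xi>))\<^sup>2)" for \<xi>
      using mult_left_mono[OF pt[of "fourier f1 \<xi>" "fourier f2 \<xi>"], of "?w \<xi>"] by (simp add: lin algebra_simps)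
  qed (use F1(2) F2(2) in auto)
  also have "\<dots> = 2 * ?I f1 + 2 * ?I f2" using F1(2) F2(2) by simp
  also have "\<dots> \<le> 4 * \<rho>\<^sup>2" using s[OF s1] s[OF s2] by linarith
  finally show ?thesis unfolding sob .
qed

theorem corollary3:
  fixes r \<beta> :: real
  assumes "r > 1" and "0 < \<beta>" and "\<beta> < 1"
  shows "\<exists>c::real. \<forall>\<epsilon>>0. \<forall>\<rho>>0.
    \<forall>f \<in> C0_infinity (D_region r). \<forall>g. g = disc_transform f \<longrightarrow>
      (\<forall>g\<epsilon> \<in> L2_on cylinder. L2_norm_on cylinder (\<lambda>z. g\<epsilon> z - g z) < \<epsilon> \<longrightarrow>
        (\<forall>f1 \<in> C0_infinity (D_region r). \<forall>f2 \<in> C0_infinity (D_region r).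
           L2_norm_on cylinder (\<lambda>z. disc_transform f1 z - g\<epsilon> z) < \<epsilon> \<and>
           L2_norm_on cylinder (\<lambda>z. disc_transform f2 z - g\<epsilon> z) < \<epsilon> \<and>
           sobolev_norm \<beta> f1 \<le> \<rho> \<and> sobolev_norm \<beta> f2 \<le> \<rho> \<longrightarrow>
           L2_norm_on UNIV (\<lambda>x. f1 x - f2 x)
             \<le> c * \<rho> powr ((3 / 2) / (\<beta> + 3 / 2)) * \<epsilon> powr (\<beta> / (\<beta> + 3 / 2))))"
proof -
  define A where "A = 8 * exp (1/2) * (8 / pi * (28 * pi / (pi / 2 - peak_angle r) + 12 * r + 3))"
  define B where "B = 8 * exp (1/2) * ((r + 1) ^ 4 * ((r + 1)\<^sup>2) powr (2 * \<beta>))"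
  have A: "A \<ge> 0" unfolding A_def using peak_angle[OF assms(1)] assms(1)
    by (intro mult_nonneg_nonneg add_nonneg_nonneg divide_nonneg_nonneg) auto
  have B: "B \<ge> 0" unfolding B_def using assms(1) by simp
  have main: "L2_norm_on UNIV (\<lambda>x. f1 x - f2 x)
      \<le> sqrt (A * 4 + B * 4 + 4) * \<rho> powr ((3 / 2) / (\<beta> + 3 / 2)) * \<epsilon> powr (\<beta> / (\<beta> + 3 / 2))"
    if \<epsilon>: "\<epsilon> > 0" and \<rho>: "\<rho> > 0" and g: "g \<in> L2_on cylinder"
      and f1: "f1 \<in> C0_infinity (D_region r)" and f2: "f2 \<in> C0_infinity (D_region r)"
      and d1: "L2_norm_on cylinder (\<lambda>z. disc_transform f1 z - g z) < \<epsilon>"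
      and d2: "L2_norm_on cylinder (\<lambda>z. disc_transform f2 z - g z) < \<epsilon>"
      and s1: "sobolev_norm \<beta> f1 \<le> \<rho>" and s2: "sobolev_norm \<beta> f2 \<le> \<rho>"
    for \<epsilon> \<rho> :: real and g f1 f2
  proof -
    define h where "h x = f1 x - f2 x" for x
    obtain L1 where L1: "\<And>x y. \<bar>f1 x - f1 y\<bar> \<le> L1 * norm (x - y)" using C0_D_region_facts(1)[OF assms(1) f1] by blast
    obtain L2 where L2: "\<And>x y. \<bar>f2 x - f2 y\<bar> \<le> L2 * norm (x - y)" using C0_D_region_facts(1)[OF assms(1) f2] by blast
    have lip: "\<bar>h x - h y\<bar> \<le> (L1 + L2) * norm (x - y)" for x y
      using L1[of x y] L2[of x y] unfolding h_def distrib_right by linarith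
    have supp: "h x = 0" if "x \<notin> D_region r" for x
      using C0_D_region_facts(2)[OF assms(1) f1 that] C0_D_region_facts(2)[OF assms(1) f2 that] by (simp add: h_def)
    note H = lipschitz_supported_facts[OF assms(1) lip supp]
    have ce: "cylinder_energy h \<le> 4 * \<epsilon>\<^sup>2"
      unfolding h_def[abs_def] by (rule cylinder_energy_diff_le[OF assms(1) f1 f2 g d1 d2])
    have se: "(sobolev_norm \<beta> h)\<^sup>2 \<le> 4 * \<rho>\<^sup>2"
      unfolding h_def[abs_def] by (rule sobolev_norm_diff_le[OF assms f1 f2 s1 s2])
    let ?Q = "\<rho> powr ((3 / 2) / (\<beta> + 3 / 2)) * \<epsilon> powr (\<beta> / (\<beta> + 3 / 2))"
    have "(\<integral>x. (h x)\<^sup>2 \<partial>lborel) \<le> (A * 4 + B * 4 + 4) * ?Q\<^sup>2"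
    proof (rule optimise_scale)
      show "(\<integral>x. (h x)\<^sup>2 \<partial>lborel) \<le> 4 * \<rho>\<^sup>2"
        using sobolev_bounds(2)[OF H assms(2,3)] se by linarith
      fix t :: real assume t: "0 < t" "t \<le> 1"
      have "(\<integral>x. (h x)\<^sup>2 \<partial>lborel) \<le> A * (cylinder_energy h / t ^ 3) + B * (t powr (2 * \<beta>) * (sobolev_norm \<beta> h)\<^sup>2)"
        unfolding A_def B_def by (rule stability_trade_off[OF assms lip supp t])
      also have "\<dots> \<le> A * (4 * \<epsilon>\<^sup>2 / t ^ 3) + B * (t powr (2 * \<beta>) * (4 * \<rho>\<^sup>2))"
        using t by (intro add_mono mult_left_mono divide_right_mono ce se A B) auto
      finally show "(\<integral>x. (h x)\<^sup>2 \<partial>lborel) \<le> A * 4 * (\<epsilon>\<^sup>2 / t ^ 3) + B * 4 * (t powr (2 * \<beta>) * \<rho>\<^sup>2)"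
        by (simp add: mult_ac)
    qed (use \<epsilon> \<rho> A B assms in auto)
    moreover have "L2_norm_on UNIV h = sqrt (\<integral>x. (h x)\<^sup>2 \<partial>lborel)"
    proof -
      have "h \<in> borel_measurable borel" using H(1) by auto
      then have "(\<lambda>x. (h x)\<^sup>2) \<in> borel_measurable borel" by simp
      from lebesgue_on_borel(1)[OF _ this, of UNIV] show ?thesis
        by (simp add: L2_norm_on_def)
    qed
    ultimately have "L2_norm_on UNIV h \<le> sqrt ((A * 4 + B * 4 + 4) * ?Q\<^sup>2)" by simp
    also have "\<dots> = sqrt (A * 4 + B * 4 + 4) * ?Q" by (simp add: real_sqrt_mult)
    finally show ?thesis by (simp add: h_def[abs_def] mult.assoc)
  qed
  show ?thesis
    by (intro exI[of _ "sqrt (A * 4 + B * 4 + 4)"] allI impI ballI) (blast intro: main)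
qed

end
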